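(* For every $\varepsilon>0$ (and all $n,w,\ell$), there is a log-space explicit pseudorandom generator that $\varepsilon$-fools all ordered read-once branching programs of width $w$ and length $n$ with at most $\ell$ colliding layers, using seed length $O(\log\log n+\log(1/\varepsilon)+\log\ell+w)\cdot\log n$.
   Context: A read-once branching program (ROBP) of width $w$ and length $n$ is a layered directed graph with layers $V_1,\dots,V_{n+1}$, $V_1$ a single start vertex, other layers of at most $w$ vertices, each vertex of $V_i$ having two outgoing edges into $V_{i+1}$ labeled $1$ and $-1$, vertices of $V_{n+1}$ labeled accept/reject; on input $x\in\{\pm1\}^n$, step $i$ follows the edge labeled $x_i$; output $-1$ on acceptance, $1$ otherwise. A layer of edges is colliding if two edges with the same label enter the same vertex of the next layer. A generator $G:\{\pm1\}^r\to\{\pm1\}^n$ $\varepsilon$-fools a class $\mathcal{F}$ if $|\mathbb{E}_{x\sim U_n}[f(x)]-\mathbb{E}_{y\sim U_r}[f(G(y))]|\le\varepsilon$ for every $f\in\mathcal{F}$; log-space explicit means computable in space logarithmic in $n$. *)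

theory Defs
  imports "HOL-Probability.Probability"
begin

section \<open>Sign vectors, generators and fooling\<close>

definition cube :: "nat \<Rightarrow> int list set" where
  "cube n = {x. set x \<subseteq> {1, -1} \<and> length x = n}"

lemma finite_cube: "finite (cube n)"
  unfolding cube_def by (rule finite_lists_length_eq) simp

lemma card_cube: "card (cube n) = 2 ^ n"
  unfolding cube_def by (subst card_lists_length_eq) (simp_all add: numeral_2_eq_2)

abbreviation uniform :: "nat \<Rightarrow> int list pmf" where
  "uniform n \<equiv> pmf_of_set (cube n)"

definition fools ::
  "real \<Rightarrow> nat \<Rightarrow> nat \<Rightarrow> (int list \<Rightarrow> int list) \<Rightarrow> (int list \<Rightarrow> real) set \<Rightarrow> bool" where
  "fools \<epsilon> r n G F \<longleftrightarrow>
     (\<forall>f\<in>F. \<bar>measure_pmf.expectation (uniform n) f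
             - measure_pmf.expectation (uniform r) (\<lambda>y. f (G y))\<bar> \<le> \<epsilon>)"

section \<open>Ordered read-once branching programs\<close>

text \<open>
  The layers are numbered \<open>1, \<dots>, n + 1\<close>, and the edges from layer \<open>i\<close> to layer \<open>i + 1\<close>
  form edge layer \<open>i\<close>. Vertices are identified by their layer together with a number, so the sets
  \<open>layer B i\<close> need not be disjoint. The edge labelled \<open>b\<close> leaving vertex \<open>v\<close> of layer \<open>i\<close>
  enters vertex \<open>edge B i b v\<close> of layer \<open>i + 1\<close>.
\<close>

record robp =
  layer :: "nat \<Rightarrow> nat set"
  start :: nat
  edge :: "nat \<Rightarrow> int \<Rightarrow> nat \<Rightarrow> nat"
  accepting :: "nat set"

definition is_robp :: "nat \<Rightarrow> nat \<Rightarrow> robp \<Rightarrow> bool" where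
  "is_robp w n B \<longleftrightarrow>
     layer B 1 = {start B} \<and>
     (\<forall>i\<in>{2..n + 1}. finite (layer B i) \<and> card (layer B i) \<le> w) \<and>
     (\<forall>i\<in>{1..n}. \<forall>b\<in>{1, -1}. \<forall>v\<in>layer B i. edge B i b v \<in> layer B (i + 1)) \<and>
     accepting B \<subseteq> layer B (n + 1)"

text \<open>\<open>vertex_at B x i\<close> is the vertex of layer \<open>i + 1\<close> reached after reading the first \<open>i\<close> entries of \<open>x\<close>.\<close>

primrec vertex_at :: "robp \<Rightarrow> int list \<Rightarrow> nat \<Rightarrow> nat" where
  "vertex_at B x 0 = start B"
| "vertex_at B x (Suc i) = edge B (Suc i) (x ! i) (vertex_at B x i)"

definition robp_output :: "nat \<Rightarrow> robp \<Rightarrow> int list \<Rightarrow> real" where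
  "robp_output n B x = (if vertex_at B x n \<in> accepting B then -1 else 1)"

definition colliding :: "robp \<Rightarrow> nat \<Rightarrow> bool" where
  "colliding B i \<longleftrightarrow>
     (\<exists>b\<in>{1, -1}. \<exists>u\<in>layer B i. \<exists>v\<in>layer B i. u \<noteq> v \<and> edge B i b u = edge B i b v)"

definition robp_class :: "nat \<Rightarrow> nat \<Rightarrow> nat \<Rightarrow> (int list \<Rightarrow> real) set" where
  "robp_class w n l =
     {robp_output n B | B. is_robp w n B \<and> card {i\<in>{1..n}. colliding B i} \<le> l}"

section \<open>Space-bounded Turing machines\<close>

text \<open>
  Deterministic machines with a two-way read-only input tape whose ends are marked, a fixed number
  of read-write work tapes, and a write-only output tape. States and work symbols are initial
  segments of the natural numbers; state 0 is the initial state and work symbol 0 is the blank.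
\<close>

datatype in_symbol = Left_End | Right_End | Separator | Plus | Minus

datatype direction = Go_Left | Stay | Go_Right

text \<open>
  \<open>trans M q a u\<close> is the action in state \<open>q\<close> when \<open>a\<close> is scanned on the input tape and \<open>u ! j\<close>
  on work tape \<open>j\<close>: the next state, the move on the input tape, for each work tape the symbol
  written and the move, and the sign appended to the output, if any.
\<close>

record machine =
  num_states :: nat
  num_symbols :: nat
  num_tapes :: nat
  halt_state :: nat
  trans :: "nat \<Rightarrow> in_symbol \<Rightarrow> nat list \<Rightarrow>
              nat \<times> direction \<times> (nat \<times> direction) list \<times> int option"

definition is_machine :: "machine \<Rightarrow> bool" where
  "is_machine M \<longleftrightarrow>
     0 < num_states M \<and> 0 < num_symbols M \<and> halt_state M < num_states M \<and>
     (\<forall>q<num_states M. \<forall>a u. length u = num_tapes M \<and> set u \<subseteq> {..<num_symbols M} \<longrightarrow>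
        (case trans M q a u of (q', d, acts, out) \<Rightarrow>
           q' < num_states M \<and> length acts = num_tapes M \<and>
           fst ` set acts \<subseteq> {..<num_symbols M} \<and> out \<in> {None, Some 1, Some (-1)}))"

record config =
  state :: nat
  in_pos :: nat
  tape :: "nat \<Rightarrow> nat \<Rightarrow> nat"
  head :: "nat \<Rightarrow> nat"
  written :: "int list"

text \<open>The word occupies the input cells \<open>1, \<dots>, length inp\<close>.\<close>

definition in_cell :: "in_symbol list \<Rightarrow> nat \<Rightarrow> in_symbol" where
  "in_cell inp p =
     (if p = 0 then Left_End else if p \<le> length inp then inp ! (p - 1) else Right_End)"

text \<open>A head on cell 0 stays there when told to move left.\<close>

fun shift :: "direction \<Rightarrow> nat \<Rightarrow> nat" where
  "shift Go_Left p = p - 1"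
| "shift Stay p = p"
| "shift Go_Right p = p + 1"

definition init :: config where
  "init = \<lparr>state = 0, in_pos = 0, tape = (\<lambda>_ _. 0), head = (\<lambda>_. 0), written = []\<rparr>"

definition step :: "machine \<Rightarrow> in_symbol list \<Rightarrow> config \<Rightarrow> config" where
  "step M inp c =
     (if state c = halt_state M then c
      else
        case trans M (state c) (in_cell inp (in_pos c))
               (map (\<lambda>j. tape c j (head c j)) [0..<num_tapes M])
        of (q, d, acts, out) \<Rightarrow>
          \<lparr>state = q,
           in_pos = min (shift d (in_pos c)) (length inp + 1),
           tape = (\<lambda>j. if j < num_tapes M then (tape c j)(head c j := fst (acts ! j)) else tape c j),
           head = (\<lambda>j. if j < num_tapes M then shift (snd (acts ! j)) (head c j) else head c j),
           written = written c @ (case out of None \<Rightarrow> [] | Some b \<Rightarrow> [b])\<rparr>)"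

text \<open>Only work tapes count towards space: on each of them only the first \<open>s\<close> cells are visited.\<close>

definition computes_in_space ::
  "machine \<Rightarrow> in_symbol list \<Rightarrow> int list \<Rightarrow> nat \<Rightarrow> bool" where
  "computes_in_space M inp out s \<longleftrightarrow>
     (\<exists>t. state ((step M inp ^^ t) init) = halt_state M \<and> written ((step M inp ^^ t) init) = out) \<and>
     (\<forall>t. \<forall>j<num_tapes M. head ((step M inp ^^ t) init) j < s)"

section \<open>Log-space explicit generators\<close>

text \<open>
  The logarithm as it is meant inside an \<open>O\<close>-bound: to base 2 and truncated below at 1, so that
  bounds remain meaningful at degenerate arguments such as \<open>n = 1\<close>, \<open>l = 0\<close> or \<open>\<epsilon> \<ge> 1\<close>.
\<close>

definition lg :: "real \<Rightarrow> real" where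
  "lg x = max 1 (log 2 x)"

text \<open>
  A real \<open>\<epsilon>\<close> cannot be written on a tape; a machine is given the least natural number \<open>k\<close> with
  \<open>2 powr - k \<le> \<epsilon>\<close> instead.
\<close>

definition precision :: "real \<Rightarrow> nat" where
  "precision \<epsilon> = nat \<lceil>log 2 (1 / \<epsilon>)\<rceil>"

definition encode_sign :: "int \<Rightarrow> in_symbol" where
  "encode_sign b = (if b = 1 then Plus else Minus)"

text \<open>The parameters are given in unary, followed by the seed.\<close>

definition encode_input :: "nat \<Rightarrow> nat \<Rightarrow> nat \<Rightarrow> nat \<Rightarrow> int list \<Rightarrow> in_symbol list" where
  "encode_input k n w l y =
     replicate n Plus @ [Separator] @ replicate w Plus @ [Separator] @
     replicate l Plus @ [Separator] @ replicate k Plus @ [Separator] @ map encode_sign y"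

text \<open>
  Explicitness concerns a family of generators, one for each \<open>\<epsilon>\<close>, \<open>n\<close>, \<open>w\<close>, \<open>l\<close>, with seed
  length \<open>r \<epsilon> n w l\<close>: a single machine computes all of them in space \<open>O(log n)\<close>.
\<close>

definition log_space_explicit ::
  "(real \<Rightarrow> nat \<Rightarrow> nat \<Rightarrow> nat \<Rightarrow> nat) \<Rightarrow>
   (real \<Rightarrow> nat \<Rightarrow> nat \<Rightarrow> nat \<Rightarrow> int list \<Rightarrow> int list) \<Rightarrow> bool" where
  "log_space_explicit r G \<longleftrightarrow>
     (\<exists>M. is_machine M \<and>
       (\<exists>C::real. \<forall>\<epsilon>>0. \<forall>n w l. \<forall>y\<in>cube (r \<epsilon> n w l).
          \<exists>s. real s \<le> C * lg (real n) \<and>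
              computes_in_space M (encode_input (precision \<epsilon>) n w l y) (G \<epsilon> n w l y) s))"

end

theory Submission
  imports Defs "HOL-Library.Z2" "HOL-Library.Log_Nat"
begin

text \<open>
  The generator outputs the bitwise sum of \<open>k\<close> independent copies of Nisan's generator, with blocks
  of \<open>q\<close> bits and Toeplitz hash functions. Give every vertex \<open>u\<close> of a program, with successors
  \<open>u\<^sub>0\<close> and \<open>u\<^sub>1\<close>, the weight \<open>\<bar>p u\<^sub>0 - p u\<^sub>1\<bar>\<close>, where \<open>p\<close> is the expected output from a vertex on. The
  potential \<open>\<Sum>\<bar>p u - p v\<bar>\<close> over pairs of vertices of a layer shows that the weights of a program of
  width \<open>w\<close> with \<open>l\<close> colliding layers add up to \<open>O (w\<^sup>2 (l + 1))\<close>.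

  Cut a program into two halves. The error which the recursion step adds is a covariance between the
  vertex reached in the middle and the output of the second half. By pairwise independence, its
  second moment over the hash functions is at most a sum over nonempty sets \<open>E\<close> of copies of
  \<open>2\<^bsup>-q\<bar>E\<bar>\<^esup>\<close> (the probability that two inputs agree on \<open>E\<close>) times the squared error which the
  copies outside \<open>E\<close> make on the second half. By induction, the error is at most the weight times
  \<open>(log n \<cdot> w\<^sup>2 \<cdot> 2\<^bsup>-q/2\<^esup>)\<^bsup>k\<^esup>\<close>. So \<open>q\<close> can be a multiple of \<open>min w (log n) + log log n\<close>, which is
  \<open>O (log n)\<close>, while a small \<open>\<epsilon>\<close> is paid for by \<open>k\<close>. A machine treats one copy after the other and
  keeps a single block in memory; its input head detects the end of the last copy, so it needs
  neither \<open>k\<close>, \<open>l\<close> nor \<open>\<epsilon>\<close>.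
\<close>

text \<open>The space bound involves \<open>n\<close> alone, so a block of log(1/\<epsilon>) bits
  could not be stored, and accuracy has to come from copies treated one at a time. The obstacle is
  to make their errors multiply. Copies on which two inputs of the hash functions agree are frozen,
  and only the others stay random on the second half. A frozen copy just adds a fixed string, so the
  induction runs over arbitrary sets of copies and arbitrary masks. The weight then enters once and
  not once per copy; for the empty set of copies it bounds the error trivially. The estimate needs
  w^2 \<le> 2^(2 min w (log n)), up to rounding of the logarithm, which may fail for w > n. In that
  range the output is shown to be close to uniform, point by point, by means of programs of width 2.
  The output counter runs downwards, so that the end is recognised without storing \<open>n\<close>
  a second time. A counter bit 1 selects the first half of the generator's output; the value v thus
  addresses position 2^L - 1 - v, and the excess over \<open>n\<close> bits is cut off in
  front.\<close>

definition avg :: "'a set \<Rightarrow> ('a \<Rightarrow> real) \<Rightarrow> real" where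
  "avg A f = (\<Sum>x\<in>A. f x) / real (card A)"

text \<open>The L2 norm of the uniform distribution. Second moments are what pairwise independence
  controls, and the triangle inequality of this norm adds up the errors of the two halves of a
  program.\<close>

definition rms :: "'a set \<Rightarrow> ('a \<Rightarrow> real) \<Rightarrow> real" where
  "rms A f = sqrt (avg A (\<lambda>x. (f x)\<^sup>2))"

lemma avg_cong: "(\<And>x. x \<in> A \<Longrightarrow> f x = g x) \<Longrightarrow> avg A f = avg A g"
  unfolding avg_def by (simp cong: sum.cong)

lemma avg_const: "finite A \<Longrightarrow> A \<noteq> {} \<Longrightarrow> avg A (\<lambda>_. c) = c"
  unfolding avg_def by simp

lemma avg_add: "avg A (\<lambda>x. f x + g x) = avg A f + avg A g"
  unfolding avg_def by (simp add: sum.distrib add_divide_distrib)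

lemma avg_diff: "avg A (\<lambda>x. f x - g x) = avg A f - avg A g"
  unfolding avg_def by (simp add: sum_subtractf diff_divide_distrib)

lemma avg_cmult: "avg A (\<lambda>x. c * f x) = c * avg A f"
  unfolding avg_def by (simp add: sum_distrib_left)

lemma avg_multc: "avg A (\<lambda>x. f x * c) = avg A f * c"
  unfolding avg_def by (simp add: sum_distrib_right)

lemma avg_sum: "avg A (\<lambda>x. \<Sum>i\<in>I. f i x) = (\<Sum>i\<in>I. avg A (f i))"
  unfolding avg_def by (subst sum.swap) (simp add: sum_divide_distrib)

lemma avg_mono: "(\<And>x. x \<in> A \<Longrightarrow> f x \<le> g x) \<Longrightarrow> avg A f \<le> avg A g"
  unfolding avg_def by (simp add: sum_mono divide_right_mono)

lemma avg_nonneg: "(\<And>x. x \<in> A \<Longrightarrow> 0 \<le> f x) \<Longrightarrow> 0 \<le> avg A f"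
  unfolding avg_def by (simp add: sum_nonneg)

lemma avg_le_const:
  "finite A \<Longrightarrow> A \<noteq> {} \<Longrightarrow> (\<And>x. x \<in> A \<Longrightarrow> f x \<le> c) \<Longrightarrow> avg A f \<le> c"
  using avg_mono[of A f "\<lambda>_. c"] avg_const[of A c] by simp

lemma abs_avg_le: "\<bar>avg A f\<bar> \<le> avg A (\<lambda>x. \<bar>f x\<bar>)"
  unfolding avg_def by (simp add: sum_abs divide_right_mono)

lemma avg_swap: "avg A (\<lambda>a. avg B (f a)) = avg B (\<lambda>b. avg A (\<lambda>a. f a b))"
  unfolding avg_def by (simp add: sum_divide_distrib[symmetric] sum.swap[of _ B A] mult.commute)

lemma avg_Times: "avg (A \<times> B) f = avg A (\<lambda>a. avg B (\<lambda>b. f (a, b)))"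
  unfolding avg_def
  by (simp add: sum.cartesian_product card_cartesian_product sum_divide_distrib[symmetric] mult.commute)

lemma avg_bij: "bij_betw h A B \<Longrightarrow> avg B f = avg A (\<lambda>x. f (h x))"
  unfolding avg_def by (simp add: sum.reindex_bij_betw bij_betw_same_card)

text \<open>The mean is the best constant approximation in mean square. This replaces the mean in a
  variance by any convenient centre.\<close>

lemma avg_square_le:
  assumes "finite A" "A \<noteq> {}"
  shows "avg A (\<lambda>x. (f x - avg A f)\<^sup>2) \<le> avg A (\<lambda>x. (f x - c)\<^sup>2)"
proof -
  have e: "avg A (\<lambda>x. (f x - d)\<^sup>2) = avg A (\<lambda>x. (f x)\<^sup>2) - 2 * d * avg A f + d\<^sup>2" for d
  proof -
    have "avg A (\<lambda>x. (f x - d)\<^sup>2) = avg A (\<lambda>x. ((f x)\<^sup>2 - 2 * d * f x) + d\<^sup>2)"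
      by (rule avg_cong) (simp add: power2_diff)
    then show ?thesis by (simp add: avg_add avg_diff avg_cmult avg_const assms)
  qed
  have "0 \<le> (avg A f - c)\<^sup>2" by simp
  then show ?thesis unfolding e by (simp add: power2_eq_square algebra_simps)
qed

lemma avg_power2_le:
  assumes "finite A" "A \<noteq> {}"
  shows "(avg A f)\<^sup>2 \<le> avg A (\<lambda>x. (f x)\<^sup>2)"
proof -
  have "0 \<le> avg A (\<lambda>x. (f x - avg A f)\<^sup>2)" by (intro avg_nonneg) simp
  also have "\<dots> = avg A (\<lambda>x. ((f x)\<^sup>2 - 2 * avg A f * f x) + (avg A f)\<^sup>2)"
    by (rule avg_cong) (simp add: power2_diff)
  also have "\<dots> = avg A (\<lambda>x. (f x)\<^sup>2) - (avg A f)\<^sup>2"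
    by (simp add: avg_add avg_diff avg_cmult avg_const assms power2_eq_square)
  finally show ?thesis by simp
qed

lemma rms_L2_set: "rms A f = L2_set f A / sqrt (real (card A))"
  unfolding rms_def avg_def L2_set_def by (simp add: real_sqrt_divide)

lemma rms_nonneg: "0 \<le> rms A f"
  unfolding rms_L2_set by simp

lemma rms_power2: "(rms A f)\<^sup>2 = avg A (\<lambda>x. (f x)\<^sup>2)"
  unfolding rms_def by (simp add: avg_nonneg)

lemma rms_triangle: "rms A (\<lambda>x. f x + g x) \<le> rms A f + rms A g"
  unfolding rms_L2_set add_divide_distrib[symmetric]
  by (intro divide_right_mono L2_set_triangle_ineq) simp

lemma rms_sum: "finite I \<Longrightarrow> rms A (\<lambda>x. \<Sum>i\<in>I. f i x) \<le> (\<Sum>i\<in>I. rms A (f i))"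
proof (induction I rule: finite_induct)
  case empty
  then show ?case by (simp add: rms_def avg_def)
next
  case (insert i I)
  then show ?case using rms_triangle[of A "f i" "\<lambda>x. \<Sum>i\<in>I. f i x"] by simp
qed

lemma rms_abs: "rms A (\<lambda>x. \<bar>f x\<bar>) = rms A f"
  unfolding rms_def by simp

lemma rms_le: "0 \<le> c \<Longrightarrow> avg A (\<lambda>x. (f x)\<^sup>2) \<le> c\<^sup>2 \<Longrightarrow> rms A f \<le> c"
  unfolding rms_def by (simp add: real_le_lsqrt)

lemma avg_le_rms:
  assumes "finite A" "A \<noteq> {}"
  shows "avg A f \<le> rms A f"
  unfolding rms_def by (rule real_le_rsqrt) (rule avg_power2_le[OF assms])

section \<open>Averages over tuples\<close>

abbreviation tuples :: "'i set \<Rightarrow> 'a set \<Rightarrow> ('i \<Rightarrow> 'a) set" where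
  "tuples T A \<equiv> PiE T (\<lambda>_. A)"

lemma finite_tuples: "finite T \<Longrightarrow> finite A \<Longrightarrow> finite (tuples T A)"
  by (intro finite_PiE) auto

lemma tuples_nonempty: "A \<noteq> {} \<Longrightarrow> tuples T A \<noteq> {}"
  by (simp add: PiE_eq_empty_iff)

definition merge :: "'i set \<Rightarrow> ('i \<Rightarrow> 'a) \<Rightarrow> ('i \<Rightarrow> 'a) \<Rightarrow> 'i \<Rightarrow> 'a" where
  "merge E a b = (\<lambda>i. if i \<in> E then a i else b i)"

lemma avg_tuples_insert:
  assumes "i \<notin> T"
  shows "avg (tuples (insert i T) A) f = avg A (\<lambda>a. avg (tuples T A) (\<lambda>g. f (g(i := a))))"
proof -
  have "bij_betw (\<lambda>(y, g). g(i := y)) (A \<times> tuples T A) (tuples (insert i T) A)"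
    unfolding bij_betw_def PiE_insert_eq using inj_combinator[OF assms] by auto
  from avg_bij[OF this] show ?thesis by (simp add: avg_Times)
qed

lemma bij_betw_merge:
  assumes "E \<subseteq> T"
  shows "bij_betw (\<lambda>(a, b). merge E a b) (tuples E A \<times> tuples (T - E) A) (tuples T A)"
proof (rule bij_betw_byWitness[where f' = "\<lambda>g. (restrict g E, restrict g (T - E))"])
  show "\<forall>x\<in>tuples E A \<times> tuples (T - E) A.
      (restrict (case x of (a, b) \<Rightarrow> merge E a b) E,
       restrict (case x of (a, b) \<Rightarrow> merge E a b) (T - E)) = x"
    using assms by (fastforce simp: merge_def fun_eq_iff PiE_def extensional_def)
  show "\<forall>g\<in>tuples T A. (case (restrict g E, restrict g (T - E)) of (a, b) \<Rightarrow> merge E a b) = g"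
    using assms by (fastforce simp: merge_def fun_eq_iff PiE_def extensional_def)
  show "(\<lambda>(a, b). merge E a b) ` (tuples E A \<times> tuples (T - E) A) \<subseteq> tuples T A"
    using assms by (auto simp: merge_def PiE_def extensional_def Pi_def)
  show "(\<lambda>g. (restrict g E, restrict g (T - E))) ` tuples T A \<subseteq> tuples E A \<times> tuples (T - E) A"
    using assms by (auto simp: PiE_def extensional_def Pi_def)
qed

lemma avg_tuples_split:
  assumes "E \<subseteq> T"
  shows "avg (tuples T A) f = avg (tuples E A) (\<lambda>a. avg (tuples (T - E) A) (\<lambda>b. f (merge E a b)))"
  using avg_bij[OF bij_betw_merge[OF assms]] by (simp add: avg_Times)

definition seqs :: "'a set \<Rightarrow> nat \<Rightarrow> 'a list set" where
  "seqs H j = {hs. set hs \<subseteq> H \<and> length hs = j}"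

lemma seqs_0: "seqs H 0 = {[]}"
  by (auto simp: seqs_def)

lemma finite_seqs: "finite H \<Longrightarrow> finite (seqs H j)"
  unfolding seqs_def by (rule finite_lists_length_eq)

lemma seqs_nonempty: "H \<noteq> {} \<Longrightarrow> seqs H j \<noteq> {}"
proof -
  assume "H \<noteq> {}"
  then obtain h where "h \<in> H" by auto
  then have "replicate j h \<in> seqs H j" by (auto simp: seqs_def)
  then show ?thesis by auto
qed

lemma bij_betw_Cons_tuples:
  "bij_betw (\<lambda>(h, hs). \<lambda>c\<in>T. h c # hs c) (tuples T H \<times> tuples T (seqs H j))
   (tuples T (seqs H (Suc j)))"
proof (rule bij_betw_byWitness[where f' = "\<lambda>g. (\<lambda>c\<in>T. hd (g c), \<lambda>c\<in>T. tl (g c))"])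
  show "\<forall>g\<in>tuples T (seqs H (Suc j)).
      (case (\<lambda>c\<in>T. hd (g c), \<lambda>c\<in>T. tl (g c)) of (h, hs) \<Rightarrow> \<lambda>c\<in>T. h c # hs c) = g"
  proof (intro ballI ext)
    fix g c assume g: "g \<in> tuples T (seqs H (Suc j))"
    show "(case (\<lambda>c\<in>T. hd (g c), \<lambda>c\<in>T. tl (g c)) of (h, hs) \<Rightarrow> \<lambda>c\<in>T. h c # hs c) c = g c"
    proof (cases "c \<in> T")
      case True
      then have "g c \<in> seqs H (Suc j)" using g by auto
      then have "g c \<noteq> []" by (auto simp: seqs_def)
      then show ?thesis using True by simp
    next
      case False
      then show ?thesis using g by (auto simp: PiE_def extensional_def)
    qed
  qed
  have m: "hd (g c) \<in> H" "tl (g c) \<in> seqs H j"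
    if "g \<in> tuples T (seqs H (Suc j))" "c \<in> T" for g c
  proof -
    have "g c \<in> seqs H (Suc j)" using that by auto
    then show "hd (g c) \<in> H" "tl (g c) \<in> seqs H j" by (cases "g c"; auto simp: seqs_def)+
  qed
  show "(\<lambda>g. (\<lambda>c\<in>T. hd (g c), \<lambda>c\<in>T. tl (g c))) ` tuples T (seqs H (Suc j))
      \<subseteq> tuples T H \<times> tuples T (seqs H j)"
    using m by auto
  show "(\<lambda>(h, hs). \<lambda>c\<in>T. h c # hs c) ` (tuples T H \<times> tuples T (seqs H j))
      \<subseteq> tuples T (seqs H (Suc j))"
    by (fastforce simp: seqs_def PiE_def Pi_def)
  show "\<forall>x\<in>tuples T H \<times> tuples T (seqs H j).
      (\<lambda>c\<in>T. hd ((case x of (h, hs) \<Rightarrow> \<lambda>c\<in>T. h c # hs c) c),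
       \<lambda>c\<in>T. tl ((case x of (h, hs) \<Rightarrow> \<lambda>c\<in>T. h c # hs c) c)) = x"
    by (auto simp: fun_eq_iff PiE_def extensional_def)
qed

lemma avg_tuples_seqs_Suc:
  "avg (tuples T (seqs H (Suc j))) f =
   avg (tuples T H \<times> tuples T (seqs H j)) (\<lambda>(h, hs). f (\<lambda>c\<in>T. h c # hs c))"
  unfolding avg_bij[OF bij_betw_Cons_tuples] by (simp add: case_prod_unfold)

section \<open>Pairwise independent hashing of several copies\<close>

text \<open>The two independence conditions are identities between averages of arbitrary functions,
  so that they can be applied to one copy at a time, underneath the averages over the other
  copies.\<close>

locale hash_family =
  fixes Q :: "'x set" and H :: "'h set" and hash :: "'h \<Rightarrow> 'x \<Rightarrow> 'x"
  assumes Q: "finite Q" "Q \<noteq> {}" and H: "finite H" "H \<noteq> {}"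
    and hash_in: "h \<in> H \<Longrightarrow> x \<in> Q \<Longrightarrow> hash h x \<in> Q"
    and hash_uniform: "x \<in> Q \<Longrightarrow> avg H (\<lambda>h. \<phi> (hash h x)) = avg Q \<phi>"
    and hash_pairwise: "x \<in> Q \<Longrightarrow> x' \<in> Q \<Longrightarrow> x \<noteq> x' \<Longrightarrow>
      avg H (\<lambda>h. \<psi> (hash h x) (hash h x')) = avg Q (\<lambda>y. avg Q (\<psi> y))"
begin

definition act :: "'i set \<Rightarrow> ('i \<Rightarrow> 'h) \<Rightarrow> ('i \<Rightarrow> 'x) \<Rightarrow> 'i \<Rightarrow> 'x" where
  "act T h x = (\<lambda>c\<in>T. hash (h c) (x c))"

lemma act_insert: "i \<notin> T \<Longrightarrow> act (insert i T) (h(i := a)) x = (act T h x)(i := hash a (x i))"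
  by (auto simp: act_def fun_eq_iff)

lemma act_merge: "E \<subseteq> T \<Longrightarrow> act T (merge E a b) x = merge E (act E a x) (act (T - E) b x)"
  by (auto simp: act_def merge_def fun_eq_iff)

lemma act_cong: "(\<And>c. c \<in> T \<Longrightarrow> x c = x' c) \<Longrightarrow> act T h x = act T h x'"
  by (auto simp: act_def fun_eq_iff)

lemma avg_act:
  assumes "finite T" "\<And>c. c \<in> T \<Longrightarrow> x c \<in> Q"
  shows "avg (tuples T H) (\<lambda>h. \<phi> (act T h x)) = avg (tuples T Q) \<phi>"
  using assms
proof (induction T arbitrary: \<phi> rule: finite_induct)
  case empty
  then show ?case by (simp add: avg_def act_def)
next
  case (insert i T)
  have "avg (tuples (insert i T) H) (\<lambda>h. \<phi> (act (insert i T) h x))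
      = avg H (\<lambda>a. avg (tuples T H) (\<lambda>h. \<phi> ((act T h x)(i := hash a (x i)))))"
    using insert.hyps by (simp add: avg_tuples_insert act_insert)
  also have "\<dots> = avg H (\<lambda>a. avg (tuples T Q) (\<lambda>y. \<phi> (y(i := hash a (x i)))))"
    by (intro avg_cong insert.IH) (auto intro: insert.prems)
  also have "\<dots> = avg Q (\<lambda>a. avg (tuples T Q) (\<lambda>y. \<phi> (y(i := a))))"
    by (rule hash_uniform) (auto intro: insert.prems)
  finally show ?case using insert.hyps by (simp add: avg_tuples_insert)
qed

lemma avg_act_pair:
  assumes "finite T" "\<And>c. c \<in> T \<Longrightarrow> x c \<in> Q" "\<And>c. c \<in> T \<Longrightarrow> x' c \<in> Q"
    "\<And>c. c \<in> T \<Longrightarrow> x c \<noteq> x' c"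
  shows "avg (tuples T H) (\<lambda>h. \<psi> (act T h x) (act T h x'))
    = avg (tuples T Q) (\<lambda>y. avg (tuples T Q) (\<psi> y))"
  using assms
proof (induction T arbitrary: \<psi> rule: finite_induct)
  case empty
  then show ?case by (simp add: avg_def act_def)
next
  case (insert i T)
  have "avg (tuples (insert i T) H) (\<lambda>h. \<psi> (act (insert i T) h x) (act (insert i T) h x'))
      = avg H (\<lambda>a. avg (tuples T H) (\<lambda>h. \<psi> ((act T h x)(i := hash a (x i)))
          ((act T h x')(i := hash a (x' i)))))"
    using insert.hyps by (simp add: avg_tuples_insert act_insert)
  also have "\<dots> = avg H (\<lambda>a. avg (tuples T Q) (\<lambda>y. avg (tuples T Q) (\<lambda>y'.
      \<psi> (y(i := hash a (x i))) (y'(i := hash a (x' i))))))"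
    by (intro avg_cong insert.IH) (use insert.prems in auto)
  also have "\<dots> = avg Q (\<lambda>a. avg Q (\<lambda>a'. avg (tuples T Q) (\<lambda>y. avg (tuples T Q) (\<lambda>y'.
      \<psi> (y(i := a)) (y'(i := a'))))))"
    by (rule hash_pairwise) (use insert.prems in auto)
  also have "\<dots> = avg Q (\<lambda>a. avg (tuples T Q) (\<lambda>y. avg Q (\<lambda>a'. avg (tuples T Q) (\<lambda>y'.
      \<psi> (y(i := a)) (y'(i := a'))))))"
    by (intro avg_cong avg_swap)
  finally show ?case using insert.hyps by (simp add: avg_tuples_insert)
qed

text \<open>On \<open>E\<close> the two hash values coincide; off \<open>E\<close> they are
  independent and uniform. For fixed values on \<open>E\<close> the two factors therefore average
  separately, to the same number, and a square appears.\<close>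

lemma avg_act_square:
  assumes "finite T" "E \<subseteq> T" "\<And>c. c \<in> T \<Longrightarrow> x c \<in> Q" "\<And>c. c \<in> T \<Longrightarrow> x' c \<in> Q"
    "\<And>c. c \<in> T \<Longrightarrow> x c = x' c \<longleftrightarrow> c \<in> E"
  shows "avg (tuples T H) (\<lambda>h. \<gamma> (act T h x) * \<gamma> (act T h x'))
    = avg (tuples E Q) (\<lambda>y. (avg (tuples (T - E) Q) (\<lambda>b. \<gamma> (merge E y b)))\<^sup>2)"
proof -
  have fE: "finite E" "finite (T - E)" using assms finite_subset by auto
  have "avg (tuples T H) (\<lambda>h. \<gamma> (act T h x) * \<gamma> (act T h x'))
      = avg (tuples E H) (\<lambda>a. avg (tuples (T - E) H) (\<lambda>b.
          \<gamma> (merge E (act E a x) (act (T - E) b x)) * \<gamma> (merge E (act E a x) (act (T - E) b x'))))"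
  proof -
    have "act E a x' = act E a x" for a using assms(2,5) by (intro act_cong) (metis subsetD)
    then show ?thesis by (simp add: avg_tuples_split[OF assms(2)] act_merge[OF assms(2)])
  qed
  also have "\<dots> = avg (tuples E H) (\<lambda>a. avg (tuples (T - E) Q) (\<lambda>b. avg (tuples (T - E) Q) (\<lambda>b'.
          \<gamma> (merge E (act E a x) b) * \<gamma> (merge E (act E a x) b'))))"
    using assms by (intro avg_cong avg_act_pair fE) auto
  also have "\<dots> = avg (tuples E Q) (\<lambda>y. avg (tuples (T - E) Q) (\<lambda>b. avg (tuples (T - E) Q) (\<lambda>b'.
          \<gamma> (merge E y b) * \<gamma> (merge E y b'))))"
    using assms by (intro avg_act fE) auto
  finally show ?thesis by (simp add: avg_cmult avg_multc power2_eq_square)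
qed

lemma avg_agree:
  assumes "finite T" "E \<subseteq> T" "x \<in> tuples T Q"
  shows "avg (tuples T Q) (\<lambda>x'. of_bool (\<forall>c\<in>E. x c = x' c)) = (1 / card Q) ^ card E"
proof -
  have fE: "finite E" using assms finite_subset by auto
  have "avg (tuples T Q) (\<lambda>x'. of_bool (\<forall>c\<in>E. x c = x' c))
      = avg (tuples E Q) (\<lambda>a. avg (tuples (T - E) Q) (\<lambda>b. of_bool (a = restrict x E)))"
  proof (subst avg_tuples_split[OF assms(2)], intro avg_cong)
    fix a :: "'a \<Rightarrow> 'x" and b assume "a \<in> tuples E Q"
    then have "(\<forall>c\<in>E. x c = a c) \<longleftrightarrow> a = restrict x E"
      by (metis PiE_restrict restrict_apply' restrict_ext)
    then show "of_bool (\<forall>c\<in>E. x c = merge E a b c) = (of_bool (a = restrict x E) :: real)"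
      by (simp add: merge_def)
  qed
  also have "\<dots> = avg (tuples E Q) (\<lambda>a. of_bool (a = restrict x E))"
    by (intro avg_cong avg_const finite_tuples tuples_nonempty Q) (use assms in auto)
  also have "\<dots> = 1 / card (tuples E Q)"
  proof -
    have "restrict x E \<in> tuples E Q" using assms by (auto simp: PiE_def Pi_def)
    then have "tuples E Q \<inter> {a. a = restrict x E} = {restrict x E}" by auto
    then show ?thesis
      by (simp add: avg_def sum_of_bool_eq finite_tuples fE Q Int_def[symmetric])
  qed
  also have "\<dots> = (1 / card Q) ^ card E"
    by (simp add: card_PiE fE power_divide)
  finally show ?thesis .
qed

text \<open>
  Replacing the factor \<open>f\<close> by 1 is allowed because, for fixed \<open>x\<close> and \<open>x'\<close>, the average over the
  hash functions is a nonnegative number depending only on the set \<open>E\<close> of copies on which \<open>x\<close> and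
  \<open>x'\<close> agree. The set \<open>E = {}\<close> contributes nothing.
\<close>

lemma covariance_bound:
  fixes g :: "('i \<Rightarrow> 'x) \<Rightarrow> real"
  assumes T: "finite T" and f: "\<And>x. x \<in> tuples T Q \<Longrightarrow> 0 \<le> f x \<and> f x \<le> 1"
  defines "m \<equiv> avg (tuples T Q) g"
  shows "avg (tuples T H) (\<lambda>h. (avg (tuples T Q) (\<lambda>x. f x * (g (act T h x) - m)))\<^sup>2)
    \<le> (\<Sum>E\<in>Pow T - {{}}. (1 / card Q) ^ card E *
        avg (tuples E Q) (\<lambda>y. (avg (tuples (T - E) Q) (\<lambda>b. g (merge E y b)) - c)\<^sup>2))"
proof -
  define \<gamma> where "\<gamma> = (\<lambda>y. g y - m)"
  define \<Gamma> where "\<Gamma> E = avg (tuples E Q) (\<lambda>y. (avg (tuples (T - E) Q) (\<lambda>b. \<gamma> (merge E y b)))\<^sup>2)" for E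
  have \<Gamma>0: "0 \<le> \<Gamma> E" for E unfolding \<Gamma>_def by (intro avg_nonneg) simp
  let ?A = "tuples T Q"
  have fin: "finite ?A" "?A \<noteq> {}" by (simp_all add: finite_tuples tuples_nonempty T Q)
  have "avg (tuples T H) (\<lambda>h. (avg ?A (\<lambda>x. f x * \<gamma> (act T h x)))\<^sup>2)
      = avg (tuples T H) (\<lambda>h. avg ?A (\<lambda>x. avg ?A (\<lambda>x'. (f x * f x') * (\<gamma> (act T h x) * \<gamma> (act T h x')))))"
    by (intro avg_cong) (simp add: power2_eq_square avg_multc[symmetric] avg_cmult[symmetric] mult_ac)
  also have "\<dots> = avg ?A (\<lambda>x. avg ?A (\<lambda>x'. (f x * f x') *
      avg (tuples T H) (\<lambda>h. \<gamma> (act T h x) * \<gamma> (act T h x'))))"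
    by (subst avg_swap, rule avg_cong, subst avg_swap, rule avg_cong) (simp add: avg_cmult)
  also have "\<dots> \<le> avg ?A (\<lambda>x. avg ?A (\<lambda>x'. \<Sum>E\<in>Pow T. of_bool (\<forall>c\<in>E. x c = x' c) * \<Gamma> E))"
  proof (intro avg_mono)
    fix x x' assume xx: "x \<in> ?A" "x' \<in> ?A"
    define E where "E = {c \<in> T. x c = x' c}"
    have "avg (tuples T H) (\<lambda>h. \<gamma> (act T h x) * \<gamma> (act T h x')) = \<Gamma> E"
      unfolding \<Gamma>_def by (rule avg_act_square) (use xx T in \<open>auto simp: E_def\<close>)
    then have "(f x * f x') * avg (tuples T H) (\<lambda>h. \<gamma> (act T h x) * \<gamma> (act T h x')) \<le> 1 * \<Gamma> E"
      using f[OF xx(1)] f[OF xx(2)] \<Gamma>0[of E] mult_mono[of "f x" 1 "f x'" 1]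
        mult_right_mono[of "f x * f x'" 1 "\<Gamma> E"] by simp
    also have "1 * \<Gamma> E = (\<Sum>E\<in>{E}. of_bool (\<forall>c\<in>E. x c = x' c) * \<Gamma> E)" by (simp add: E_def)
    \<comment> \<open>Only the exact set of agreement occurs. Adding the nonnegative terms of all
      its subsets leaves the events "\<open>x\<close> and \<open>x'\<close> agree on
      \<open>E\<close>", whose probability is a plain product by \<open>avg_agree\<close>.\<close>
    also have "\<dots> \<le> (\<Sum>E\<in>Pow T. of_bool (\<forall>c\<in>E. x c = x' c) * \<Gamma> E)"
      using T \<Gamma>0 by (intro sum_mono2) (auto simp: E_def)
    finally show "f x * f x' * avg (tuples T H) (\<lambda>h. \<gamma> (act T h x) * \<gamma> (act T h x'))
        \<le> (\<Sum>E\<in>Pow T. of_bool (\<forall>c\<in>E. x c = x' c) * \<Gamma> E)" .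
  qed
  also have "\<dots> = avg ?A (\<lambda>x. \<Sum>E\<in>Pow T. (1 / card Q) ^ card E * \<Gamma> E)"
    by (intro avg_cong, simp only: avg_sum avg_multc, intro sum.cong refl)
      (simp add: avg_agree T)
  also have "\<dots> = (\<Sum>E\<in>Pow T. (1 / card Q) ^ card E * \<Gamma> E)" by (rule avg_const[OF fin])
  also have "\<dots> = (\<Sum>E\<in>Pow T - {{}}. (1 / card Q) ^ card E * \<Gamma> E)"
  proof -
    have "avg ?A (\<lambda>b. \<gamma> (merge {} y b)) = 0" for y
      unfolding \<gamma>_def merge_def using fin by (simp add: avg_diff avg_const m_def)
    then have "\<Gamma> {} = 0" unfolding \<Gamma>_def by (simp add: avg_def[of "{_}"])
    moreover have "finite (Pow T)" using T by simp
    ultimately show ?thesis by (intro sum.mono_neutral_right) auto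
  qed
  also have "\<dots> \<le> (\<Sum>E\<in>Pow T - {{}}. (1 / card Q) ^ card E *
        avg (tuples E Q) (\<lambda>y. (avg (tuples (T - E) Q) (\<lambda>b. g (merge E y b)) - c)\<^sup>2))"
  proof (intro sum_mono mult_left_mono)
    fix E assume "E \<in> Pow T - {{}}"
    then have ET: "E \<subseteq> T" by auto
    have fE: "finite E" using ET T finite_subset by auto
    let ?k = "\<lambda>y. avg (tuples (T - E) Q) (\<lambda>b. g (merge E y b))"
    have "avg (tuples E Q) ?k = m"
      unfolding m_def by (rule avg_tuples_split[OF ET, symmetric])
    moreover have "avg (tuples (T - E) Q) (\<lambda>b. \<gamma> (merge E y b)) = ?k y - m" for y
      unfolding \<gamma>_def using T Q by (simp add: avg_diff avg_const finite_tuples tuples_nonempty)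
    ultimately have "\<Gamma> E = avg (tuples E Q) (\<lambda>y. (?k y - avg (tuples E Q) ?k)\<^sup>2)"
      unfolding \<Gamma>_def by simp
    also have "\<dots> \<le> avg (tuples E Q) (\<lambda>y. (?k y - c)\<^sup>2)"
      by (intro avg_square_le finite_tuples tuples_nonempty fE Q)
    finally show "\<Gamma> E \<le> avg (tuples E Q) (\<lambda>y. (?k y - c)\<^sup>2)" .
  qed simp
  finally show ?thesis unfolding \<gamma>_def .
qed

end

section \<open>Layered programs and their weight\<close>

type_synonym 's prog_layer = "'s set \<times> (bit \<Rightarrow> 's \<Rightarrow> 's)"

fun run :: "'s prog_layer list \<Rightarrow> bit list \<Rightarrow> 's \<Rightarrow> 's" where
  "run [] z s = s"
| "run (p # ps) z s = run ps (tl z) (snd p (hd z) s)"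

fun val :: "'s prog_layer list \<Rightarrow> ('s \<Rightarrow> real) \<Rightarrow> 's \<Rightarrow> real" where
  "val [] v s = v s"
| "val (p # ps) v s = (val ps v (snd p 0 s) + val ps v (snd p 1 s)) / 2"

fun weight :: "'s prog_layer list \<Rightarrow> ('s \<Rightarrow> real) \<Rightarrow> real" where
  "weight [] v = 0"
| "weight (p # ps) v =
     (\<Sum>s\<in>fst p. \<bar>val ps v (snd p 0 s) - val ps v (snd p 1 s)\<bar>) + weight ps v"

fun first_layer :: "'s prog_layer list \<Rightarrow> 's set \<Rightarrow> 's set" where
  "first_layer [] F = F"
| "first_layer (p # ps) F = fst p"

fun wf_layers :: "nat \<Rightarrow> 's prog_layer list \<Rightarrow> 's set \<Rightarrow> bool" where
  "wf_layers w [] F \<longleftrightarrow> finite F \<and> card F \<le> w"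
| "wf_layers w (p # ps) F \<longleftrightarrow> finite (fst p) \<and> card (fst p) \<le> w \<and>
     (\<forall>s\<in>fst p. \<forall>b. snd p b s \<in> first_layer ps F) \<and> wf_layers w ps F"

lemma run_append:
  "length z = length ps \<Longrightarrow> run (ps @ ps') (z @ z') s = run ps' z' (run ps z s)"
proof (induction ps arbitrary: z s)
  case (Cons p ps)
  then show ?case by (cases z) auto
qed simp

lemma val_append: "val (ps @ ps') v = val ps (val ps' v)"
  by (induction ps) (auto simp: fun_eq_iff)

lemma weight_append: "weight (ps @ ps') v = weight ps (val ps' v) + weight ps' v"
  by (induction ps) (auto simp: val_append)

lemma weight_nonneg: "0 \<le> weight ps v"
  by (induction ps) (auto intro!: add_nonneg_nonneg sum_nonneg)

lemma first_layer_append: "first_layer (ps @ ps') F = first_layer ps (first_layer ps' F)"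
  by (cases ps) auto

lemma wf_first_layer: "wf_layers w ps F \<Longrightarrow> finite (first_layer ps F) \<and> card (first_layer ps F) \<le> w"
  by (cases ps) auto

lemma wf_append:
  "wf_layers w (ps @ ps') F \<longleftrightarrow> wf_layers w ps (first_layer ps' F) \<and> wf_layers w ps' F"
  using wf_first_layer[of w ps' F] by (induction ps) (auto simp: first_layer_append)

lemma run_in: "wf_layers w ps F \<Longrightarrow> s \<in> first_layer ps F \<Longrightarrow> run ps z s \<in> F"
  by (induction ps arbitrary: z s) auto

text \<open>Along the path each step changes \<open>val\<close> by half the difference of the two
  successor values, which is at most the weight of that layer. This is the trivial bound for an
  empty set of copies.\<close>

lemma run_val_le_weight:
  "wf_layers w ps F \<Longrightarrow> s \<in> first_layer ps F \<Longrightarrow> \<bar>v (run ps z s) - val ps v s\<bar> \<le> weight ps v"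
proof (induction ps arbitrary: z s)
  case (Cons p ps)
  let ?s' = "snd p (hd z) s"
  have "\<bar>v (run ps (tl z) ?s') - val ps v ?s'\<bar> \<le> weight ps v"
    using Cons by auto
  moreover have "\<bar>val ps v ?s' - val (p # ps) v s\<bar> \<le> \<bar>val ps v (snd p 0 s) - val ps v (snd p 1 s)\<bar>"
    by (cases "hd z") (auto simp: abs_if field_simps)
  moreover have "\<dots> \<le> (\<Sum>s\<in>fst p. \<bar>val ps v (snd p 0 s) - val ps v (snd p 1 s)\<bar>)"
    using Cons.prems by (intro member_le_sum) auto
  ultimately show ?case by simp
qed simp

text \<open>The string \<open>z\<close> stands for the sum of the copies that have already been
  fixed.\<close>

definition mask :: "bit list \<Rightarrow> 'i set \<Rightarrow> ('i \<Rightarrow> bit list) \<Rightarrow> bit list" where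
  "mask z T g = map (\<lambda>p. z ! p + (\<Sum>c\<in>T. g c ! p)) [0..<length z]"

lemma length_mask [simp]: "length (mask z T g) = length z"
  by (simp add: mask_def)

lemma mask_cong: "(\<And>c. c \<in> T \<Longrightarrow> g c = g' c) \<Longrightarrow> mask z T g = mask z T g'"
  by (simp add: mask_def)

lemma mask_split: "finite T \<Longrightarrow> E \<subseteq> T \<Longrightarrow> mask z T g = mask (mask z E g) (T - E) g"
  by (auto simp: mask_def sum.subset_diff[of E T] add_ac)

lemma mask_append:
  assumes "\<And>c. c \<in> T \<Longrightarrow> length (g c) = length z"
  shows "mask (z @ z') T (\<lambda>c. g c @ g' c) = mask z T g @ mask z' T g'"
proof (rule nth_equalityI)
  fix p assume "p < length (mask (z @ z') T (\<lambda>c. g c @ g' c))"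
  then show "mask (z @ z') T (\<lambda>c. g c @ g' c) ! p = (mask z T g @ mask z' T g') ! p"
    using assms by (auto simp: mask_def nth_append intro!: sum.cong)
qed simp

text \<open>The sum over nonempty sets of agreeing copies produces the left side without the factor;
  the right side is the growth of the claimed error bound when one level is added. In the induction
  step the difference for \<open>Suc t\<close> is g(A - B) + aA, and the cross term of its square is
  nonnegative.\<close>

lemma power_diff_bound:
  fixes a g :: real
  assumes "1 \<le> a" "0 \<le> g"
  shows "a\<^sup>2 * ((1 + g\<^sup>2) ^ t - (g\<^sup>2) ^ t) \<le> ((g + a) ^ t - g ^ t)\<^sup>2"
proof (induction t)
  case (Suc t)
  define A where "A = (g + a) ^ t"
  define B where "B = g ^ t"
  define C where "C = (1 + g\<^sup>2) ^ t"
  have AB: "B \<le> A" "0 \<le> A" unfolding A_def B_def using assms by (auto intro!: power_mono)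
  have "1 + g\<^sup>2 \<le> (g + a)\<^sup>2"
  proof -
    have "1 \<le> a\<^sup>2" "0 \<le> 2 * g * a" using assms by simp_all
    then show ?thesis unfolding power2_sum by linarith
  qed
  then have "(1 + g\<^sup>2) ^ t \<le> ((g + a)\<^sup>2) ^ t" by (intro power_mono) auto
  then have CA: "C \<le> A\<^sup>2" unfolding C_def A_def by (simp add: power_mult[symmetric] mult.commute)
  have B2: "(g\<^sup>2) ^ t = B\<^sup>2" unfolding B_def by (simp add: power_mult[symmetric] mult.commute)
  have "a\<^sup>2 * ((1 + g\<^sup>2) ^ Suc t - (g\<^sup>2) ^ Suc t) = g\<^sup>2 * (a\<^sup>2 * (C - B\<^sup>2)) + a\<^sup>2 * C"
    unfolding C_def B2[symmetric] by (simp add: algebra_simps)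
  also have "\<dots> \<le> g\<^sup>2 * (A - B)\<^sup>2 + a\<^sup>2 * A\<^sup>2"
    using Suc unfolding A_def[symmetric] B_def[symmetric] C_def[symmetric] B2
    by (intro add_mono mult_left_mono CA) auto
  also have "\<dots> \<le> g\<^sup>2 * (A - B)\<^sup>2 + a\<^sup>2 * A\<^sup>2 + 2 * g * a * A * (A - B)"
    using AB assms by simp
  also have "\<dots> = ((g + a) ^ Suc t - g ^ Suc t)\<^sup>2"
    unfolding A_def[symmetric] B_def[symmetric] power_Suc by (simp add: power2_eq_square algebra_simps)
  finally show ?case .
qed simp

section \<open>The generator and its error on a program\<close>

locale nisan = hash_family Q H hash for Q :: "'x set" and H :: "'h set" and hash +
  fixes out :: "'x \<Rightarrow> bit"
  assumes out_uniform: "avg Q (\<lambda>x. \<psi> (out x)) = (\<psi> 0 + \<psi> 1) / 2"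
begin

primrec gen :: "'h list \<Rightarrow> 'x \<Rightarrow> bit list" where
  "gen [] x = [out x]"
| "gen (h # hs) x = gen hs x @ gen hs (hash h x)"

lemma length_gen [simp]: "length (gen hs x) = 2 ^ length hs"
  by (induction hs arbitrary: x) auto

definition outcome :: "'i set \<Rightarrow> ('i \<Rightarrow> 'h list) \<Rightarrow> bit list \<Rightarrow> 's prog_layer list \<Rightarrow> 's \<Rightarrow> ('i \<Rightarrow> 'x) \<Rightarrow> 's" where
  "outcome T hs z ps s x = run ps (mask z T (\<lambda>c. gen (hs c) (x c))) s"

definition dev :: "'i set \<Rightarrow> ('i \<Rightarrow> 'h list) \<Rightarrow> bit list \<Rightarrow> 's prog_layer list \<Rightarrow> ('s \<Rightarrow> real) \<Rightarrow> 's \<Rightarrow> real" where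
  "dev T hs z ps v s = avg (tuples T Q) (\<lambda>x. v (outcome T hs z ps s x)) - val ps v s"

text \<open>On the event that the first half ends in \<open>u\<close>, this compares the second half
  run on the hashed blocks with the second half run on fresh uniform blocks.\<close>

definition cov :: "'i set \<Rightarrow> ('i \<Rightarrow> 'h) \<Rightarrow> ('i \<Rightarrow> 'h list) \<Rightarrow> bit list \<Rightarrow> 's prog_layer list \<Rightarrow>
    bit list \<Rightarrow> 's prog_layer list \<Rightarrow> ('s \<Rightarrow> real) \<Rightarrow> 's \<Rightarrow> 's \<Rightarrow> real" where
  "cov T h hs z1 ps1 z2 ps2 v s u =
     avg (tuples T Q) (\<lambda>x. of_bool (outcome T hs z1 ps1 s x = u) *
       (v (outcome T hs z2 ps2 u (act T h x)) - avg (tuples T Q) (\<lambda>y. v (outcome T hs z2 ps2 u y))))"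

lemma outcome_merge:
  assumes "finite T" "E \<subseteq> T"
  shows "outcome T (merge E a b) z ps s (merge E y x)
    = outcome (T - E) b (mask z E (\<lambda>c. gen (a c) (y c))) ps s x"
proof -
  let ?g = "\<lambda>c. gen (merge E a b c) (merge E y x c)"
  have "mask z T ?g = mask (mask z E ?g) (T - E) ?g" by (rule mask_split[OF assms])
  also have "mask z E ?g = mask z E (\<lambda>c. gen (a c) (y c))" by (rule mask_cong) (simp add: merge_def)
  also have "mask \<dots> (T - E) ?g = mask \<dots> (T - E) (\<lambda>c. gen (b c) (x c))"
    by (rule mask_cong) (simp add: merge_def)
  finally show ?thesis by (simp add: outcome_def)
qed

lemma outcome_append:
  assumes "\<And>c. c \<in> T \<Longrightarrow> length (hs c) = j" "length z1 = 2 ^ j" "length ps1 = 2 ^ j"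
  shows "outcome T (\<lambda>c\<in>T. h c # hs c) (z1 @ z2) (ps1 @ ps2) s x
    = outcome T hs z2 ps2 (outcome T hs z1 ps1 s x) (act T h x)"
proof -
  have "mask (z1 @ z2) T (\<lambda>c. gen ((\<lambda>c\<in>T. h c # hs c) c) (x c))
      = mask (z1 @ z2) T (\<lambda>c. gen (hs c) (x c) @ gen (hs c) (act T h x c))"
    by (rule mask_cong) (simp add: act_def)
  also have "\<dots> = mask z1 T (\<lambda>c. gen (hs c) (x c)) @ mask z2 T (\<lambda>c. gen (hs c) (act T h x c))"
    using assms by (intro mask_append) simp
  finally show ?thesis unfolding outcome_def using assms by (simp add: run_append)
qed

text \<open>Splitting off one copy suffices: whatever the others contribute, its output bit is
  uniform.\<close>

lemma avg_parity:
  assumes "finite T" "T \<noteq> {}"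
  shows "avg (tuples T Q) (\<lambda>x. \<psi> (b + (\<Sum>c\<in>T. out (x c)))) = (\<psi> 0 + \<psi> 1) / 2"
proof -
  obtain i S where T: "T = insert i S" "i \<notin> S" using assms by (metis Set.set_insert equals0I)
  have S: "finite S" using assms T by simp
  have "avg (tuples T Q) (\<lambda>x. \<psi> (b + (\<Sum>c\<in>T. out (x c))))
      = avg Q (\<lambda>a. avg (tuples S Q) (\<lambda>g. \<psi> (b + (out a + (\<Sum>c\<in>S. out (g c))))))"
  proof -
    have "(\<Sum>c\<in>T. out ((g(i := a)) c)) = out a + (\<Sum>c\<in>S. out (g c))" for g a
    proof -
      have "(\<Sum>c\<in>S. out ((g(i := a)) c)) = (\<Sum>c\<in>S. out (g c))"
        by (rule sum.cong) (use T in auto)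
      then show ?thesis using T S by simp
    qed
    then show ?thesis using T by (simp add: avg_tuples_insert)
  qed
  also have "\<dots> = avg (tuples S Q) (\<lambda>g. avg Q (\<lambda>a. \<psi> (b + (out a + (\<Sum>c\<in>S. out (g c))))))"
    by (rule avg_swap)
  also have "\<dots> = avg (tuples S Q) (\<lambda>g. (\<psi> 0 + \<psi> 1) / 2)"
  proof (rule avg_cong)
    fix g
    show "avg Q (\<lambda>a. \<psi> (b + (out a + (\<Sum>c\<in>S. out (g c))))) = (\<psi> 0 + \<psi> 1) / 2"
      using out_uniform[of "\<lambda>o'. \<psi> (b + (o' + (\<Sum>c\<in>S. out (g c))))"]
      by (cases b; cases "\<Sum>c\<in>S. out (g c)") auto
  qed
  also have "\<dots> = (\<psi> 0 + \<psi> 1) / 2"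
    by (intro avg_const finite_tuples tuples_nonempty Q S)
  finally show ?thesis .
qed

text \<open>A hybrid argument. First the hashed blocks of the second half are replaced by
  independent ones, at the cost of the covariances; then the second half is replaced by its exact
  value, which costs its own deviation at a random middle vertex; what remains is the first half
  with \<open>val ps2 v\<close> as output.\<close>

lemma dev_append:
  assumes T: "finite T" and wf: "wf_layers w (ps1 @ ps2) F" and s: "s \<in> first_layer (ps1 @ ps2) F"
    and len: "\<And>c. c \<in> T \<Longrightarrow> length (hs c) = j" "length z1 = 2 ^ j" "length ps1 = 2 ^ j"
  shows "dev T (\<lambda>c\<in>T. h c # hs c) (z1 @ z2) (ps1 @ ps2) v s =
    (\<Sum>u\<in>first_layer ps2 F. cov T h hs z1 ps1 z2 ps2 v s u) + dev T hs z1 ps1 (val ps2 v) s +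
    avg (tuples T Q) (\<lambda>x. dev T hs z2 ps2 v (outcome T hs z1 ps1 s x))"
proof -
  let ?A = "tuples T Q" and ?V = "first_layer ps2 F"
  define L where "L = outcome T hs z1 ps1 s"
  define R where "R = (\<lambda>u y. v (outcome T hs z2 ps2 u y))"
  have L: "L x \<in> ?V" for x
    unfolding L_def outcome_def using wf s by (intro run_in) (auto simp: wf_append first_layer_append)
  have fV: "finite ?V" using wf wf_first_layer by (auto simp: wf_append)
  have "(\<Sum>u\<in>?V. cov T h hs z1 ps1 z2 ps2 v s u)
      = avg ?A (\<lambda>x. \<Sum>u\<in>?V. of_bool (L x = u) * (R u (act T h x) - avg ?A (R u)))"
    unfolding cov_def L_def R_def avg_sum ..
  also have "\<dots> = avg ?A (\<lambda>x. R (L x) (act T h x) - avg ?A (R (L x)))"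
  proof (rule avg_cong)
    fix x
    have "(\<Sum>u\<in>?V. of_bool (L x = u) * (R u (act T h x) - avg ?A (R u)))
        = (\<Sum>u\<in>?V. if u = L x then (R u (act T h x) - avg ?A (R u)) else 0)"
      by (rule sum.cong) auto
    then show "(\<Sum>u\<in>?V. of_bool (L x = u) * (R u (act T h x) - avg ?A (R u)))
        = R (L x) (act T h x) - avg ?A (R (L x))"
      using L fV by (simp add: sum.delta)
  qed
  also have "\<dots> = avg ?A (\<lambda>x. R (L x) (act T h x)) - (avg ?A (\<lambda>x. val ps2 v (L x))
      + avg ?A (\<lambda>x. dev T hs z2 ps2 v (L x)))"
    unfolding avg_diff avg_add[symmetric] by (simp add: dev_def R_def)
  moreover have app: "outcome T (\<lambda>c\<in>T. h c # hs c) (z1 @ z2) (ps1 @ ps2) s x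
      = outcome T hs z2 ps2 (outcome T hs z1 ps1 s x) (act T h x)" for x
    by (rule outcome_append[OF len])
  ultimately show ?thesis
    unfolding dev_def[of T "\<lambda>c\<in>T. h c # hs c"] dev_def[of _ _ z1] app
    by (simp add: R_def L_def val_append)
qed

text \<open>Once the copies in \<open>E\<close> are frozen, the second half sees the copies in
  \<open>T - E\<close> and the mask \<open>mask z2 E _\<close>, to which the induction hypothesis
  applies with centre \<open>val ps2 v u\<close>. Summing over all \<open>E\<close> is the binomial
  expansion of \<open>prod_add\<close>, and the term of the empty set is subtracted.\<close>

lemma avg_cov_square:
  assumes T: "finite T" and u: "u \<in> first_layer ps2 F" and z2: "length z2 = 2 ^ j"
    and IH: "\<And>E z. E \<subseteq> T \<Longrightarrow> length z = 2 ^ j \<Longrightarrow>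
      \<exists>\<beta>. (\<forall>hs\<in>tuples E (seqs H j). \<forall>u\<in>first_layer ps2 F. \<bar>dev E hs z ps2 v u\<bar> \<le> \<beta> hs) \<and>
        avg (tuples E (seqs H j)) (\<lambda>hs. (\<beta> hs)\<^sup>2) \<le> W\<^sup>2 * (g\<^sup>2 / card Q) ^ card E"
  shows "avg (tuples T H \<times> tuples T (seqs H j)) (\<lambda>(h, hs). (cov T h hs z1 ps1 z2 ps2 v s u)\<^sup>2)
    \<le> W\<^sup>2 * (1 / card Q) ^ card T * ((1 + g\<^sup>2) ^ card T - (g\<^sup>2) ^ card T)"
proof -
  define \<delta> where "\<delta> = 1 / real (card Q)"
  let ?S = "tuples T (seqs H j)"
  let ?R = "\<lambda>hs y. v (outcome T hs z2 ps2 u y)"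
  let ?d = "\<lambda>hs E y. avg (tuples (T - E) Q) (\<lambda>b. ?R hs (merge E y b)) - val ps2 v u"
  have fS: "finite (tuples E (seqs H j))" "tuples E (seqs H j) \<noteq> {}" if "finite E" for E :: "'a set"
    using H that by (auto intro!: finite_tuples finite_seqs simp: PiE_eq_empty_iff seqs_nonempty)
  have "avg (tuples T H \<times> ?S) (\<lambda>(h, hs). (cov T h hs z1 ps1 z2 ps2 v s u)\<^sup>2)
      = avg ?S (\<lambda>hs. avg (tuples T H) (\<lambda>h. (cov T h hs z1 ps1 z2 ps2 v s u)\<^sup>2))"
    unfolding avg_Times by (subst avg_swap) simp
  also have "\<dots> \<le> avg ?S (\<lambda>hs. \<Sum>E\<in>Pow T - {{}}. \<delta> ^ card E * avg (tuples E Q) (\<lambda>y. (?d hs E y)\<^sup>2))"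
    unfolding cov_def \<delta>_def by (intro avg_mono covariance_bound T) auto
  also have "\<dots> = (\<Sum>E\<in>Pow T - {{}}. \<delta> ^ card E * avg (tuples E Q) (\<lambda>y. avg ?S (\<lambda>hs. (?d hs E y)\<^sup>2)))"
    unfolding avg_sum avg_cmult by (intro sum.cong refl arg_cong2[of _ _ _ _ times] avg_swap)
  also have "\<dots> \<le> (\<Sum>E\<in>Pow T - {{}}. \<delta> ^ card E * (W\<^sup>2 * (g\<^sup>2 * \<delta>) ^ card (T - E)))"
  proof (intro sum_mono mult_left_mono)
    fix E assume "E \<in> Pow T - {{}}"
    then have ET: "E \<subseteq> T" by auto
    then have fE: "finite E" using T finite_subset by auto
    have fTE: "finite (T - E)" using T by simp
    show "avg (tuples E Q) (\<lambda>y. avg ?S (\<lambda>hs. (?d hs E y)\<^sup>2)) \<le> W\<^sup>2 * (g\<^sup>2 * \<delta>) ^ card (T - E)"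
    proof (rule avg_le_const[OF finite_tuples[OF fE Q(1)] tuples_nonempty[OF Q(2)]])
      fix y
      have "avg ?S (\<lambda>hs. (?d hs E y)\<^sup>2) = avg (tuples E (seqs H j)) (\<lambda>a. avg (tuples (T - E) (seqs H j))
          (\<lambda>b. (dev (T - E) b (mask z2 E (\<lambda>c. gen (a c) (y c))) ps2 v u)\<^sup>2))"
        unfolding dev_def by (subst avg_tuples_split[OF ET]) (simp add: outcome_merge[OF T ET])
      also have "\<dots> \<le> W\<^sup>2 * (g\<^sup>2 * \<delta>) ^ card (T - E)"
      proof (rule avg_le_const[OF fS[OF fE]])
        fix a
        obtain \<beta> where \<beta>: "\<forall>hs\<in>tuples (T - E) (seqs H j). \<forall>u\<in>first_layer ps2 F.
            \<bar>dev (T - E) hs (mask z2 E (\<lambda>c. gen (a c) (y c))) ps2 v u\<bar> \<le> \<beta> hs"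
          "avg (tuples (T - E) (seqs H j)) (\<lambda>hs. (\<beta> hs)\<^sup>2) \<le> W\<^sup>2 * (g\<^sup>2 / card Q) ^ card (T - E)"
          using IH[OF Diff_subset[of T E], of "mask z2 E (\<lambda>c. gen (a c) (y c))",
              unfolded length_mask, OF z2] by blast
        have "avg (tuples (T - E) (seqs H j)) (\<lambda>b. (dev (T - E) b (mask z2 E (\<lambda>c. gen (a c) (y c))) ps2 v u)\<^sup>2)
            \<le> avg (tuples (T - E) (seqs H j)) (\<lambda>hs. (\<beta> hs)\<^sup>2)"
          using \<beta>(1) u by (intro avg_mono abs_le_square_iff[THEN iffD1]) (meson abs_ge_self order_trans)
        with \<beta>(2) show "avg (tuples (T - E) (seqs H j)) (\<lambda>b. (dev (T - E) b (mask z2 E (\<lambda>c. gen (a c) (y c))) ps2 v u)\<^sup>2)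
            \<le> W\<^sup>2 * (g\<^sup>2 * \<delta>) ^ card (T - E)" by (simp add: \<delta>_def)
      qed
      finally show "avg ?S (\<lambda>hs. (?d hs E y)\<^sup>2) \<le> W\<^sup>2 * (g\<^sup>2 * \<delta>) ^ card (T - E)" .
    qed
  qed (simp add: \<delta>_def)
  also have "\<dots> = W\<^sup>2 * (\<Sum>E\<in>Pow T - {{}}. \<delta> ^ card E * (g\<^sup>2 * \<delta>) ^ card (T - E))"
    by (simp add: sum_distrib_left mult_ac)
  also have "(\<Sum>E\<in>Pow T - {{}}. \<delta> ^ card E * (g\<^sup>2 * \<delta>) ^ card (T - E))
      = (\<Sum>E\<in>Pow T. \<delta> ^ card E * (g\<^sup>2 * \<delta>) ^ card (T - E)) - (g\<^sup>2 * \<delta>) ^ card T"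
    using T by (subst sum_diff1) auto
  also have "(\<Sum>E\<in>Pow T. \<delta> ^ card E * (g\<^sup>2 * \<delta>) ^ card (T - E)) = (\<delta> + g\<^sup>2 * \<delta>) ^ card T"
    using prod_add[OF T, of "\<lambda>_. \<delta>" "\<lambda>_. g\<^sup>2 * \<delta>"] by simp
  also have "\<delta> + g\<^sup>2 * \<delta> = \<delta> * (1 + g\<^sup>2)" by (simp add: algebra_simps)
  finally show ?thesis
    unfolding \<delta>_def[symmetric] power_mult_distrib by (simp add: right_diff_distrib mult_ac)
qed

text \<open>One function \<open>\<beta>\<close> of the hash functions has to serve all start
  vertices, because the second half is entered at a vertex that depends on the random blocks. A
  factor w^2 per level, instead of w, is the price.\<close>

theorem dev_bound:
  assumes "finite T" "wf_layers w ps F" "length ps = 2 ^ j" "length z = 2 ^ j" "1 \<le> w"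
  shows "\<exists>\<beta>. (\<forall>hs\<in>tuples T (seqs H j). \<forall>s\<in>first_layer ps F. \<bar>dev T hs z ps v s\<bar> \<le> \<beta> hs) \<and>
    avg (tuples T (seqs H j)) (\<lambda>hs. (\<beta> hs)\<^sup>2) \<le> (weight ps v)\<^sup>2 * ((real j * (real w)\<^sup>2)\<^sup>2 / card Q) ^ card T"
  using assms(1-4)
proof (induction j arbitrary: T ps F v z)
  case 0
  show ?case
  proof (cases "T = {}")
    \<comment> \<open>Without copies the program simply runs on \<open>z\<close>, and nothing better
      than the weight is available.\<close>
    case True
    then show ?thesis using 0
      by (intro exI[of _ "\<lambda>_. weight ps v"])
        (auto simp: avg_def dev_def outcome_def PiE_empty_domain intro!: run_val_le_weight)
  next
    case False
    obtain p b where pb: "ps = [p]" "z = [b]"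
      using 0 by (metis length_0_conv length_Suc_conv One_nat_def power_0)
    \<comment> \<open>For a single layer the sum of the output bits is exactly uniform, in
      accordance with the bound, which is 0 for j = 0 and a nonempty set of copies.\<close>
    have "dev T hs z ps v s = 0" if "hs \<in> tuples T (seqs H 0)" for hs s
    proof -
      have "outcome T hs z ps s x = snd p (b + (\<Sum>c\<in>T. out (x c))) s" for x
      proof -
        have "hs c = []" if "c \<in> T" for c
          using \<open>hs \<in> _\<close> that by (auto simp: seqs_0)
        then show ?thesis by (simp add: outcome_def pb mask_def)
      qed
      then show ?thesis
        using avg_parity[OF \<open>finite T\<close> False, of "\<lambda>b. v (snd p b s)" b] by (simp add: dev_def pb)
    qed
    then show ?thesis by (intro exI[of _ "\<lambda>_. 0"]) (auto simp: avg_def)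
  qed
next
  case (Suc j)
  show ?case
  proof (cases "T = {}")
    case True
    have fin: "finite (tuples T (seqs H (Suc j)))" "tuples T (seqs H (Suc j)) \<noteq> {}"
      using True by auto
    show ?thesis using Suc.prems fin True
      by (intro exI[of _ "\<lambda>_. weight ps v"])
        (auto simp: avg_const dev_def outcome_def avg_def[of "{_}"] intro!: run_val_le_weight)
  next
    case False
    define ps1 ps2 z1 z2 where "ps1 = take (2 ^ j) ps" and "ps2 = drop (2 ^ j) ps"
      and "z1 = take (2 ^ j) z" and "z2 = drop (2 ^ j) z"
    have split: "ps = ps1 @ ps2" "z = z1 @ z2" by (simp_all add: ps1_def ps2_def z1_def z2_def)
    have len: "length ps1 = 2 ^ j" "length ps2 = 2 ^ j" "length z1 = 2 ^ j" "length z2 = 2 ^ j"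
      using Suc.prems by (simp_all add: ps1_def ps2_def z1_def z2_def)
    let ?V = "first_layer ps F" and ?V' = "first_layer ps2 F"
    have wf: "wf_layers w ps1 ?V'" "wf_layers w ps2 F"
      using Suc.prems by (simp_all add: split wf_append)
    have V: "first_layer ps1 ?V' = ?V" by (simp add: split first_layer_append)
    have cV: "finite ?V" "card ?V \<le> w" "finite ?V'" "card ?V' \<le> w"
      using wf_first_layer Suc.prems(2) wf by blast+
    define a g t where "a = (real w)\<^sup>2" and "g = real j * (real w)\<^sup>2" and "t = card T"
    define r where "r = sqrt (1 / card Q)"
    define W1 W2 where "W1 = weight ps1 (val ps2 v)" and "W2 = weight ps2 v"
    have W0: "0 \<le> W1" "0 \<le> W2" by (simp_all add: W1_def W2_def weight_nonneg)
    have a1: "1 \<le> a" using assms(5) by (simp add: a_def)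
    have g0: "0 \<le> g" by (simp add: g_def)
    have r0: "0 \<le> r" by (simp add: r_def)
    have r2: "r\<^sup>2 = 1 / card Q" by (simp add: r_def)
    have ga: "g ^ t \<le> (g + a) ^ t" using a1 g0 by (intro power_mono) auto
    let ?S = "tuples T (seqs H j)"
    let ?HS = "tuples T H \<times> ?S"
    have fin: "finite (tuples T H)" "tuples T H \<noteq> {}"
      using Suc.prems(1) H by (auto intro!: finite_tuples simp: PiE_eq_empty_iff)
    obtain \<beta>1 where \<beta>1: "\<And>hs s. hs \<in> ?S \<Longrightarrow> s \<in> ?V \<Longrightarrow> \<bar>dev T hs z1 ps1 (val ps2 v) s\<bar> \<le> \<beta>1 hs"
      "avg ?S (\<lambda>hs. (\<beta>1 hs)\<^sup>2) \<le> W1\<^sup>2 * (g\<^sup>2 / card Q) ^ t"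
      using Suc.IH[OF Suc.prems(1) wf(1) len(1,3), of "val ps2 v"] unfolding V g_def W1_def t_def by metis
    obtain \<beta>2 where \<beta>2: "\<And>hs s. hs \<in> ?S \<Longrightarrow> s \<in> ?V' \<Longrightarrow> \<bar>dev T hs z2 ps2 v s\<bar> \<le> \<beta>2 hs"
      "avg ?S (\<lambda>hs. (\<beta>2 hs)\<^sup>2) \<le> W2\<^sup>2 * (g\<^sup>2 / card Q) ^ t"
      using Suc.IH[OF Suc.prems(1) wf(2) len(2,4), of v] unfolding g_def W2_def t_def by metis
    \<comment> \<open>Summing over the start vertices as well makes the bound independent of
      \<open>s\<close>.\<close>
    define K where "K h hs = (\<Sum>s\<in>?V. \<Sum>u\<in>?V'. \<bar>cov T h hs z1 ps1 z2 ps2 v s u\<bar>)" for h hs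
    define B where "B h hs = \<beta>1 hs + \<beta>2 hs + K h hs" for h hs
    define \<beta> where "\<beta> f = B (\<lambda>c\<in>T. hd (f c)) (\<lambda>c\<in>T. tl (f c))" for f
    have \<beta>B: "\<beta> (\<lambda>c\<in>T. h c # hs c) = B h hs" if "h \<in> tuples T H" "hs \<in> ?S" for h hs
    proof -
      have "(\<lambda>c\<in>T. hd ((\<lambda>c\<in>T. h c # hs c) c)) = h" "(\<lambda>c\<in>T. tl ((\<lambda>c\<in>T. h c # hs c) c)) = hs"
        using that by (auto simp: fun_eq_iff PiE_def extensional_def)
      then show ?thesis by (simp add: \<beta>_def)
    qed
    have "\<bar>dev T f z ps v s\<bar> \<le> \<beta> f" if f: "f \<in> tuples T (seqs H (Suc j))" and s: "s \<in> ?V" for f s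
    proof -
      obtain h hs where hs: "h \<in> tuples T H" "hs \<in> ?S" "f = (\<lambda>c\<in>T. h c # hs c)"
        using f unfolding bij_betw_imp_surj_on[OF bij_betw_Cons_tuples, symmetric] by auto
      have lhs: "\<And>c. c \<in> T \<Longrightarrow> length (hs c) = j" using hs(2) by (auto simp: seqs_def PiE_def Pi_def)
      have L: "outcome T hs z1 ps1 s x \<in> ?V'" for x
        unfolding outcome_def by (rule run_in[OF wf(1)]) (use s V in simp)
      have "\<bar>avg (tuples T Q) (\<lambda>x. dev T hs z2 ps2 v (outcome T hs z1 ps1 s x))\<bar> \<le> \<beta>2 hs"
        by (rule order_trans[OF abs_avg_le])
          (intro avg_le_const finite_tuples tuples_nonempty Q Suc.prems(1) \<beta>2(1) hs(2) L)
      moreover have "\<bar>\<Sum>u\<in>?V'. cov T h hs z1 ps1 z2 ps2 v s u\<bar> \<le> K h hs"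
      proof -
        have "(\<Sum>u\<in>?V'. \<bar>cov T h hs z1 ps1 z2 ps2 v s u\<bar>) \<le> K h hs"
          unfolding K_def by (rule member_le_sum[OF s]) (auto simp: cV intro!: sum_nonneg)
        then show ?thesis using sum_abs order_trans by blast
      qed
      moreover have "\<bar>dev T hs z1 ps1 (val ps2 v) s\<bar> \<le> \<beta>1 hs" using \<beta>1(1) hs(2) s by blast
      moreover have "dev T f z ps v s = (\<Sum>u\<in>?V'. cov T h hs z1 ps1 z2 ps2 v s u)
          + dev T hs z1 ps1 (val ps2 v) s
          + avg (tuples T Q) (\<lambda>x. dev T hs z2 ps2 v (outcome T hs z1 ps1 s x))"
        unfolding hs(3) split using Suc.prems(1,2) s lhs len
        by (intro dev_append[where w = w]) (auto simp: split)
      ultimately show ?thesis unfolding hs(3) \<beta>B[OF hs(1,2)] B_def by linarith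
    qed
    moreover have "avg (tuples T (seqs H (Suc j))) (\<lambda>hs. (\<beta> hs)\<^sup>2)
        \<le> (weight ps v)\<^sup>2 * ((real (Suc j) * (real w)\<^sup>2)\<^sup>2 / card Q) ^ card T"
    proof -
      have sq: "(x\<^sup>2) ^ n = (x ^ n)\<^sup>2" for x :: real and n
        by (metis mult.commute power_mult)
      have rp: "(g\<^sup>2 / card Q) ^ t = (g ^ t * r ^ t)\<^sup>2"
        unfolding power_mult_distrib[symmetric] sq[symmetric] by (simp add: power_mult_distrib r2)
      have avg2: "avg ?HS (\<lambda>(h, hs). (f hs)\<^sup>2) = avg ?S (\<lambda>hs. (f hs)\<^sup>2)" for f :: "_ \<Rightarrow> real"
        by (simp add: avg_Times avg_const fin)
      have c1: "rms ?HS (\<lambda>x. \<beta>1 (snd x)) \<le> W1 * (g ^ t * r ^ t)"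
        using \<beta>1(2) W0 g0 r0 avg2[of \<beta>1]
        by (intro rms_le) (auto simp: rp power_mult_distrib case_prod_unfold)
      have c2: "rms ?HS (\<lambda>x. \<beta>2 (snd x)) \<le> W2 * (g ^ t * r ^ t)"
        using \<beta>2(2) W0 g0 r0 avg2[of \<beta>2]
        by (intro rms_le) (auto simp: rp power_mult_distrib case_prod_unfold)
      have c3: "rms ?HS (\<lambda>x. cov T (fst x) (snd x) z1 ps1 z2 ps2 v s u) \<le> W2 * r ^ t * (((g + a) ^ t - g ^ t) / a)"
        if "u \<in> ?V'" for s u
      proof (rule rms_le)
        have "avg ?HS (\<lambda>(h, hs). (cov T h hs z1 ps1 z2 ps2 v s u)\<^sup>2)
            \<le> W2\<^sup>2 * (1 / card Q) ^ t * ((1 + g\<^sup>2) ^ t - (g\<^sup>2) ^ t)"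
          unfolding t_def
        proof (rule avg_cov_square[OF Suc.prems(1) that len(4)])
          fix E :: "'a set" and z :: "bit list" assume E: "E \<subseteq> T" "length z = 2 ^ j"
          have "finite E" using E Suc.prems(1) finite_subset by auto
          then show "\<exists>\<beta>. (\<forall>hs\<in>tuples E (seqs H j). \<forall>u\<in>?V'. \<bar>dev E hs z ps2 v u\<bar> \<le> \<beta> hs) \<and>
            avg (tuples E (seqs H j)) (\<lambda>hs. (\<beta> hs)\<^sup>2) \<le> W2\<^sup>2 * (g\<^sup>2 / card Q) ^ card E"
            using Suc.IH[of E ps2 F z v] wf(2) len(2) E(2) by (simp add: W2_def g_def)
        qed
        also have "\<dots> \<le> W2\<^sup>2 * (1 / card Q) ^ t * (((g + a) ^ t - g ^ t)\<^sup>2 / a\<^sup>2)"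
        proof (rule mult_left_mono)
          show "(1 + g\<^sup>2) ^ t - (g\<^sup>2) ^ t \<le> ((g + a) ^ t - g ^ t)\<^sup>2 / a\<^sup>2"
            using power_diff_bound[OF a1 g0, of t] a1 by (simp add: pos_le_divide_eq mult.commute)
        qed simp
        also have "\<dots> = (W2 * r ^ t * (((g + a) ^ t - g ^ t) / a))\<^sup>2"
          unfolding r2[symmetric] by (simp add: power_mult_distrib power_divide power_mult[symmetric] mult.commute)
        finally show "avg ?HS (\<lambda>x. (cov T (fst x) (snd x) z1 ps1 z2 ps2 v s u)\<^sup>2) \<le> \<dots>"
          by (simp add: case_prod_unfold)
      qed (use W0 r0 ga a1 in auto)
      \<comment> \<open>At most w^2 = \<open>a\<close> pairs of vertices occur, which cancels the
        denominator \<open>a\<close> from \<open>power_diff_bound\<close>.\<close>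
      have "rms ?HS (\<lambda>x. K (fst x) (snd x)) \<le> (\<Sum>s\<in>?V. \<Sum>u\<in>?V'. W2 * r ^ t * (((g + a) ^ t - g ^ t) / a))"
        unfolding K_def
        by (rule order_trans[OF rms_sum[OF cV(1)]], rule sum_mono,
            rule order_trans[OF rms_sum[OF cV(3)]], rule sum_mono, unfold rms_abs, rule c3)
      also have "\<dots> = real (card ?V) * real (card ?V') * (W2 * r ^ t * (((g + a) ^ t - g ^ t) / a))"
        by simp
      also have "\<dots> \<le> a * (W2 * r ^ t * (((g + a) ^ t - g ^ t) / a))"
      proof (rule mult_right_mono)
        show "real (card ?V) * real (card ?V') \<le> a"
          unfolding a_def power2_eq_square by (intro mult_mono) (use cV in auto)
      qed (use W0 r0 ga a1 in simp)
      also have "\<dots> = W2 * r ^ t * ((g + a) ^ t - g ^ t)" using a1 by simp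
      finally have c4: "rms ?HS (\<lambda>x. K (fst x) (snd x)) \<le> W2 * r ^ t * ((g + a) ^ t - g ^ t)" .
      have "rms ?HS (\<lambda>x. B (fst x) (snd x)) \<le> rms ?HS (\<lambda>x. \<beta>1 (snd x) + \<beta>2 (snd x)) + rms ?HS (\<lambda>x. K (fst x) (snd x))"
        unfolding B_def by (rule rms_triangle)
      also have "\<dots> \<le> (rms ?HS (\<lambda>x. \<beta>1 (snd x)) + rms ?HS (\<lambda>x. \<beta>2 (snd x))) + rms ?HS (\<lambda>x. K (fst x) (snd x))"
        by (intro add_right_mono rms_triangle)
      also have "\<dots> \<le> (W1 * (g ^ t * r ^ t) + W2 * (g ^ t * r ^ t)) + W2 * r ^ t * ((g + a) ^ t - g ^ t)"
        using c1 c2 c4 by linarith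
      also have "\<dots> = W1 * r ^ t * g ^ t + W2 * r ^ t * (g + a) ^ t" by (simp add: algebra_simps)
      also have "\<dots> \<le> W1 * r ^ t * (g + a) ^ t + W2 * r ^ t * (g + a) ^ t"
        using ga W0 r0 by (intro add_right_mono mult_left_mono) auto
      also have "\<dots> = weight ps v * ((g + a) ^ t * r ^ t)"
        by (simp add: split weight_append W1_def W2_def algebra_simps)
      finally have "(rms ?HS (\<lambda>x. B (fst x) (snd x)))\<^sup>2 \<le> (weight ps v * ((g + a) ^ t * r ^ t))\<^sup>2"
        by (intro power_mono rms_nonneg)
      moreover have "avg (tuples T (seqs H (Suc j))) (\<lambda>hs. (\<beta> hs)\<^sup>2) = (rms ?HS (\<lambda>x. B (fst x) (snd x)))\<^sup>2"
        unfolding rms_power2 avg_tuples_seqs_Suc by (rule avg_cong) (auto simp: \<beta>B)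
      moreover have "((g + a) ^ t * r ^ t)\<^sup>2 = ((real (Suc j) * (real w)\<^sup>2)\<^sup>2 / card Q) ^ card T"
      proof -
        have "g + a = real (Suc j) * (real w)\<^sup>2" by (simp add: g_def a_def algebra_simps)
        then show ?thesis
          unfolding t_def power_mult_distrib[symmetric] sq[symmetric]
          by (simp add: power_mult_distrib r2)
      qed
      ultimately show ?thesis by (simp add: power_mult_distrib)
    qed
    ultimately show ?thesis by blast
  qed
qed

end

section \<open>Toeplitz hashing\<close>

text \<open>By default, sums and products of bits are rewritten to \<open>XOR\<close> and \<open>AND\<close>, which hides the field.\<close>

declare add_bit_eq_xor [simp del] mult_bit_eq_and [simp del]

lemma bit_add_self [simp]: "a + a = 0" for a :: bit
  by (cases a) simp_all

lemma bit_add_cancel [simp]: "a + (a + b) = b" for a b :: bit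
  by (simp add: add.assoc[symmetric])

definition words :: "nat \<Rightarrow> bit list set" where
  "words m = {x. length x = m}"

lemma finite_words: "finite (words m)" and card_words: "card (words m) = 2 ^ m"
proof -
  have "UNIV = {0 :: bit, 1}"
    using bit_not_one_iff by blast
  then have U: "finite (UNIV :: bit set)" "card (UNIV :: bit set) = 2"
    by (metis finite.simps, metis card_2_iff zero_neq_one)
  show "finite (words m)" "card (words m) = 2 ^ m"
    using finite_lists_length_eq[OF U(1)] card_lists_length_eq[OF U(1)] U(2)
    by (simp_all add: words_def)
qed

lemma words_nonempty: "words m \<noteq> {}"
  unfolding words_def using Ex_list_of_length by auto

lemma words_0: "words 0 = {[]}"
  by (auto simp: words_def)

lemma words_Suc: "words (Suc m) = (\<lambda>(a, x). a # x) ` ({0, 1} \<times> words m)"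
  by (auto simp: words_def image_iff length_Suc_conv)

lemma avg_words_Suc:
  "avg (words (Suc m)) f = (avg (words m) (\<lambda>x. f (0 # x)) + avg (words m) (\<lambda>x. f (1 # x))) / 2"
proof -
  have "bij_betw (\<lambda>(a, x). a # x) ({0, 1} \<times> words m) (words (Suc m))"
    unfolding bij_betw_def words_Suc by (auto simp: inj_on_def)
  from avg_bij[OF this] have "avg (words (Suc m)) f = avg {0, 1} (\<lambda>a. avg (words m) (\<lambda>x. f (a # x)))"
    by (simp add: avg_Times)
  then show ?thesis by (simp add: avg_def[of "{0, 1}"])
qed

definition xor_list :: "bit list \<Rightarrow> bit list \<Rightarrow> bit list" where
  "xor_list x y = map (\<lambda>i. x ! i + y ! i) [0..<length x]"

lemma length_xor_list [simp]: "length (xor_list x y) = length x"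
  by (simp add: xor_list_def)

lemma nth_xor_list [simp]: "i < length x \<Longrightarrow> xor_list x y ! i = x ! i + y ! i"
  by (simp add: xor_list_def)

lemma avg_words_translate:
  assumes "t \<in> words m"
  shows "avg (words m) f = avg (words m) (\<lambda>x. f (xor_list x t))"
proof -
  have "bij_betw (\<lambda>x. xor_list x t) (words m) (words m)"
    by (rule bij_betw_byWitness[where f' = "\<lambda>x. xor_list x t"])
      (use assms in \<open>auto simp: words_def add.assoc intro!: nth_equalityI\<close>)
  from avg_bij[OF this] show ?thesis .
qed

lemma xor_list_commute: "length x = length y \<Longrightarrow> xor_list x y = xor_list y x"
  by (auto simp: xor_list_def add.commute)

text \<open>
  If translations of the word act on \<open>F h\<close> through \<open>g\<close>, then \<open>\<phi> (F h)\<close> may be averaged over the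
  orbit of \<open>F h\<close> first.
\<close>

lemma avg_words_orbit:
  assumes B: "finite B" "B \<noteq> {}"
    and g: "\<And>y. y \<in> B \<Longrightarrow> \<exists>t\<in>words m. \<forall>h\<in>words m. F (xor_list h t) = g y (F h)"
    and c: "\<And>h. avg B (\<lambda>y. \<phi> (g y (F h))) = c"
  shows "avg (words m) (\<lambda>h. \<phi> (F h)) = c"
proof -
  have "avg (words m) (\<lambda>h. \<phi> (F h)) = avg B (\<lambda>y. avg (words m) (\<lambda>h. \<phi> (F h)))"
    by (simp add: avg_const B)
  also have "\<dots> = avg B (\<lambda>y. avg (words m) (\<lambda>h. \<phi> (g y (F h))))"
  proof (rule avg_cong)
    fix y assume "y \<in> B"
    then obtain t where t: "t \<in> words m" "\<forall>h\<in>words m. F (xor_list h t) = g y (F h)" using g by blast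
    show "avg (words m) (\<lambda>h. \<phi> (F h)) = avg (words m) (\<lambda>h. \<phi> (g y (F h)))"
      unfolding avg_words_translate[OF t(1), of "\<lambda>h. \<phi> (F h)"] by (rule avg_cong) (simp add: t(2))
  qed
  also have "\<dots> = avg (words m) (\<lambda>h. avg B (\<lambda>y. \<phi> (g y (F h))))" by (rule avg_swap)
  finally show ?thesis by (simp add: c avg_const finite_words words_nonempty)
qed

text \<open>An affine map x \<mapsto> Ax + b over the field with two elements. The entry of A in row
  j and column i is a(q + j - i), where a is the sequence of the even positions of \<open>s\<close>;
  b is taken from the odd positions. Interleaving the two lets a machine read the word once, in
  pairs, while A passes through a shift register of \<open>q\<close> cells.\<close>

definition toeplitz :: "nat \<Rightarrow> bit list \<Rightarrow> bit list \<Rightarrow> bit list" where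
  "toeplitz q s x = map (\<lambda>j. s ! (2 * (q + j) + 1) + (\<Sum>i<q. s ! (2 * (q + j - i)) * x ! i)) [0..<q]"

lemma toeplitz_in: "toeplitz q s x \<in> words q"
  by (simp add: toeplitz_def words_def)

lemma toeplitz_xor:
  assumes "length s = 4 * q"
  shows "toeplitz q (xor_list s t) x = xor_list (toeplitz q s x) (toeplitz q t x)"
proof (rule nth_equalityI)
  fix j assume "j < length (toeplitz q (xor_list s t) x)"
  then have j: "j < q" by (simp add: toeplitz_def)
  have "(\<Sum>i<q. xor_list s t ! (2 * (q + j - i)) * x ! i)
      = (\<Sum>i<q. s ! (2 * (q + j - i)) * x ! i) + (\<Sum>i<q. t ! (2 * (q + j - i)) * x ! i)"
    unfolding sum.distrib[symmetric] using assms j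
    by (intro sum.cong) (auto simp: distrib_right)
  then show "toeplitz q (xor_list s t) x ! j = xor_list (toeplitz q s x) (toeplitz q t x) ! j"
    using assms j by (simp add: toeplitz_def add_ac)
qed (simp add: toeplitz_def)

text \<open>
  With \<open>k\<close> the least index such that \<open>d ! k = 1\<close>, the \<open>j\<close>-th equation determines \<open>a (q + j - k)\<close>
  in terms of entries of \<open>a\<close> with smaller index.
\<close>

lemma toeplitz_solvable:
  assumes "d \<in> words q" "d \<noteq> replicate q 0"
  shows "\<exists>a :: nat \<Rightarrow> bit. \<forall>j<q. (\<Sum>i<q. a (q + j - i) * d ! i) = y j"
proof -
  have "\<exists>i<q. d ! i = 1"
  proof (rule ccontr)
    assume "\<not> ?thesis"
    then have "d = replicate q 0" using assms(1) by (auto simp: words_def intro!: nth_equalityI)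
    with assms(2) show False by simp
  qed
  then have ex: "\<exists>i. i < q \<and> d ! i = 1" by blast
  define k where "k = (LEAST i. i < q \<and> d ! i = 1)"
  have k: "k < q" "d ! k = 1" using LeastI_ex[OF ex] by (simp_all add: k_def)
  have k0: "d ! i = 0" if "i < k" for i
    using not_less_Least[of i "\<lambda>i. i < q \<and> d ! i = 1"] that k by (simp add: k_def)
  have "\<exists>a. \<forall>j<m. (\<Sum>i<q. a (q + j - i) * d ! i) = y j" if "m \<le> q" for m
    using that
  proof (induction m)
    case (Suc m)
    then obtain a where a: "\<And>j. j < m \<Longrightarrow> (\<Sum>i<q. a (q + j - i) * d ! i) = y j" by auto
    define c where "c = (\<Sum>i\<in>{..<q} - {k}. a (q + m - i) * d ! i)"
    define a' where "a' = a(q + m - k := y m + c)"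
    have old: "(\<Sum>i\<in>S. a' (q + j - i) * d ! i) = (\<Sum>i\<in>S. a (q + j - i) * d ! i)"
      if S: "S \<subseteq> {..<q}" "\<And>i. i \<in> S \<Longrightarrow> k < i \<or> (i = k \<and> j < m) \<or> i < k" "j \<le> m" for S j
    proof (rule sum.cong)
      fix i assume i: "i \<in> S"
      have "i < k \<or> q + j - i \<noteq> q + m - k"
        using S(2)[OF i] S(3) k(1) by auto
      then consider "i < k" | "q + j - i \<noteq> q + m - k" by blast
      then show "a' (q + j - i) * d ! i = a (q + j - i) * d ! i"
        by cases (auto simp: a'_def k0)
    qed simp
    have "(\<Sum>i<q. a' (q + j - i) * d ! i) = y j" if "j < Suc m" for j
    proof (cases "j = m")
      case True
      have "(\<Sum>i<q. a' (q + m - i) * d ! i)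
          = a' (q + m - k) * d ! k + (\<Sum>i\<in>{..<q} - {k}. a' (q + m - i) * d ! i)"
        using k(1) by (simp add: sum.remove)
      also have "(\<Sum>i\<in>{..<q} - {k}. a' (q + m - i) * d ! i) = c"
        unfolding c_def by (rule old) auto
      finally show ?thesis by (simp add: True a'_def k(2) add.assoc)
    next
      case False
      then have "j < m" using that by simp
      then have "(\<Sum>i<q. a' (q + j - i) * d ! i) = (\<Sum>i<q. a (q + j - i) * d ! i)"
        by (intro old disjCI) auto
      then show ?thesis using a[OF \<open>j < m\<close>] by simp
    qed
    then show ?case by blast
  qed simp
  then show ?thesis by blast
qed

text \<open>The matrix is chosen to map x + x' to y + y', which is possible as x + x' is nonzero;
  the offset is then chosen to correct the image of x, and the image of x' is correct as
  well.\<close>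

lemma toeplitz_pair_surj:
  assumes "x \<in> words q" "x' \<in> words q" "x \<noteq> x'" "y \<in> words q" "y' \<in> words q"
  shows "\<exists>t\<in>words (4 * q). toeplitz q t x = y \<and> toeplitz q t x' = y'"
proof -
  have len: "length x = q" "length x' = q" "length y = q" "length y' = q"
    using assms by (auto simp: words_def)
  have "xor_list x x' \<noteq> replicate q 0"
  proof
    assume e: "xor_list x x' = replicate q 0"
    have "x ! i = x' ! i" if "i < q" for i
    proof -
      have "x ! i + x' ! i = 0" using arg_cong[OF e, of "\<lambda>l. l ! i"] that len by simp
      then show ?thesis by (cases "x ! i"; cases "x' ! i") auto
    qed
    then show False using assms(3) len by (auto intro: nth_equalityI)
  qed
  then obtain a :: "nat \<Rightarrow> bit" where
    a: "\<And>j. j < q \<Longrightarrow> (\<Sum>i<q. a (q + j - i) * xor_list x x' ! i) = y ! j + y' ! j"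
    using toeplitz_solvable[of "xor_list x x'" q "\<lambda>j. y ! j + y' ! j"] len by (auto simp: words_def)
  define b where "b m = y ! (m - q) + (\<Sum>i<q. a (m - i) * x ! i)" for m
  define t where "t = map (\<lambda>m. if even m then a (m div 2) else b (m div 2)) [0..<4 * q]"
  have T: "toeplitz q t u = map (\<lambda>j. b (q + j) + (\<Sum>i<q. a (q + j - i) * u ! i)) [0..<q]" for u
    unfolding toeplitz_def t_def by (auto intro!: sum.cong)
  have "toeplitz q t x = y"
    unfolding T by (rule nth_equalityI) (auto simp: len b_def add.assoc)
  moreover have "toeplitz q t x' = y'"
    unfolding T
  proof (rule nth_equalityI)
    fix j assume "j < length (map (\<lambda>j. b (q + j) + (\<Sum>i<q. a (q + j - i) * x' ! i)) [0..<q])"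
    then have j: "j < q" by simp
    have "(\<Sum>i<q. a (q + j - i) * x ! i) + (\<Sum>i<q. a (q + j - i) * x' ! i)
        = (\<Sum>i<q. a (q + j - i) * xor_list x x' ! i)"
      unfolding sum.distrib[symmetric] by (rule sum.cong) (auto simp: len distrib_left)
    then show "map (\<lambda>j. b (q + j) + (\<Sum>i<q. a (q + j - i) * x' ! i)) [0..<q] ! j = y' ! j"
      using a[OF j] j by (simp add: b_def add.assoc)
  qed (simp add: len)
  moreover have "t \<in> words (4 * q)" by (simp add: t_def words_def)
  ultimately show ?thesis by blast
qed

text \<open>With the zero matrix the offset alone reaches every value.\<close>

lemma toeplitz_surj:
  assumes "y \<in> words q"
  shows "\<exists>t\<in>words (4 * q). toeplitz q t x = y"
proof -
  define t where "t = map (\<lambda>m. if even m then 0 else y ! (m div 2 - q)) [0..<4 * q]"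
  have "toeplitz q t x = y"
    using assms unfolding toeplitz_def t_def by (intro nth_equalityI) (auto simp: words_def)
  moreover have "t \<in> words (4 * q)" by (simp add: t_def words_def)
  ultimately show ?thesis by blast
qed

lemma toeplitz_translate:
  assumes "h \<in> words (4 * q)"
  shows "toeplitz q (xor_list h t) u = xor_list (toeplitz q t u) (toeplitz q h u)"
  using assms toeplitz_in[of q _ u] by (simp add: words_def toeplitz_xor xor_list_commute)

lemma avg_toeplitz: "avg (words (4 * q)) (\<lambda>h. \<phi> (toeplitz q h x)) = avg (words q) \<phi>"
proof (rule avg_words_orbit[where g = xor_list])
  show "\<exists>t\<in>words (4 * q). \<forall>h\<in>words (4 * q). toeplitz q (xor_list h t) x = xor_list y (toeplitz q h x)"
    if "y \<in> words q" for y
    using toeplitz_surj[OF that, of x] toeplitz_translate by metis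
  show "avg (words q) (\<lambda>y. \<phi> (xor_list y (toeplitz q h x))) = avg (words q) \<phi>" for h
    by (rule avg_words_translate[OF toeplitz_in, symmetric])
qed (simp_all add: finite_words words_nonempty)

lemma avg_toeplitz_pair:
  assumes "x \<in> words q" "x' \<in> words q" "x \<noteq> x'"
  shows "avg (words (4 * q)) (\<lambda>h. \<psi> (toeplitz q h x) (toeplitz q h x'))
    = avg (words q) (\<lambda>y. avg (words q) (\<psi> y))"
proof -
  let ?g = "\<lambda>(y, y') (u, u'). (xor_list y u, xor_list y' u')"
  have "avg (words (4 * q)) (\<lambda>h. case_prod \<psi> (toeplitz q h x, toeplitz q h x'))
    = avg (words q) (\<lambda>y. avg (words q) (\<psi> y))"
  proof (rule avg_words_orbit[where g = ?g and B = "words q \<times> words q"])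
    show "\<exists>t\<in>words (4 * q). \<forall>h\<in>words (4 * q).
        (toeplitz q (xor_list h t) x, toeplitz q (xor_list h t) x') = ?g y (toeplitz q h x, toeplitz q h x')"
      if y: "y \<in> words q \<times> words q" for y
    proof -
      obtain t where "t \<in> words (4 * q)" "toeplitz q t x = fst y" "toeplitz q t x' = snd y"
        using toeplitz_pair_surj[OF assms, of "fst y" "snd y"] y by auto
      then show ?thesis by (intro bexI[of _ t]) (auto simp: toeplitz_translate split: prod.split)
    qed
    have "avg (words q) (\<lambda>y. avg (words q) (\<lambda>y'. \<psi> (xor_list y u) (xor_list y' u')))
        = avg (words q) (\<lambda>y. avg (words q) (\<psi> y))" if "u \<in> words q" "u' \<in> words q" for u u'
      unfolding avg_words_translate[OF that(2), symmetric] by (rule avg_words_translate[OF that(1), symmetric])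
    then show "avg (words q \<times> words q) (\<lambda>y. case_prod \<psi> (?g y (toeplitz q h x, toeplitz q h x')))
        = avg (words q) (\<lambda>y. avg (words q) (\<psi> y))" for h
      by (simp add: avg_Times toeplitz_in)
  qed (simp_all add: finite_words words_nonempty)
  then show ?thesis by simp
qed

lemma nisan_toeplitz:
  assumes "1 \<le> q"
  shows "nisan (words q) (words (4 * q)) (toeplitz q) hd"
proof unfold_locales
  obtain m where q: "q = Suc m" using assms by (cases q) auto
  show "avg (words q) (\<lambda>x. \<psi> (hd x)) = (\<psi> 0 + \<psi> 1) / 2" for \<psi> :: "bit \<Rightarrow> real"
    unfolding q avg_words_Suc by (simp add: avg_const finite_words words_nonempty)
qed (simp_all add: finite_words words_nonempty toeplitz_in avg_toeplitz avg_toeplitz_pair)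

section \<open>Weight of programs with few colliding layers\<close>

definition potential :: "'s set \<Rightarrow> ('s \<Rightarrow> real) \<Rightarrow> real" where
  "potential V f = (\<Sum>u\<in>V. \<Sum>v\<in>V. \<bar>f u - f v\<bar>)"

definition injective_layer :: "'s prog_layer \<Rightarrow> bool" where
  "injective_layer p \<longleftrightarrow> (\<forall>b. inj_on (snd p b) (fst p))"

lemma potential_le:
  assumes "\<And>u. u \<in> V \<Longrightarrow> \<bar>f u\<bar> \<le> 1" "card V \<le> w"
  shows "0 \<le> potential V f" "potential V f \<le> 2 * (real w)\<^sup>2"
proof -
  show "0 \<le> potential V f" unfolding potential_def by (intro sum_nonneg) simp
  have "\<bar>f u - f v\<bar> \<le> 2" if "u \<in> V" "v \<in> V" for u v
    using assms(1)[OF that(1)] assms(1)[OF that(2)] by linarith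
  then have "potential V f \<le> (\<Sum>u\<in>V. \<Sum>v\<in>V. 2)"
    unfolding potential_def by (intro sum_mono) auto
  also have "\<dots> = 2 * (real (card V))\<^sup>2" by (simp add: power2_eq_square)
  also have "\<dots> \<le> 2 * (real w)\<^sup>2" using assms(2) by (intro mult_left_mono power_mono) auto
  finally show "potential V f \<le> 2 * (real w)\<^sup>2" .
qed

lemma sum_pairs_le_potential:
  assumes "finite V'" "inj_on a V" "inj_on b V" "a ` V \<subseteq> V'" "b ` V \<subseteq> V'"
  shows "(\<Sum>u\<in>V. \<Sum>v\<in>V. \<bar>f (a u) - f (b v)\<bar>) \<le> potential V' f"
proof -
  have "(\<Sum>u\<in>V. \<Sum>v\<in>V. \<bar>f (a u) - f (b v)\<bar>) = (\<Sum>u\<in>a ` V. \<Sum>v\<in>b ` V. \<bar>f u - f v\<bar>)"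
    using assms by (simp add: sum.reindex)
  also have "\<dots> \<le> (\<Sum>u\<in>a ` V. \<Sum>v\<in>V'. \<bar>f u - f v\<bar>)"
    using assms by (intro sum_mono sum_mono2) auto
  also have "\<dots> \<le> potential V' f"
    unfolding potential_def using assms by (intro sum_mono2) (auto intro!: sum_nonneg)
  finally show ?thesis .
qed

text \<open>
  Replacing the two values \<open>x\<close>, \<open>y\<close> at the successors of a vertex by their mean does not increase
  the sum of all pairwise distances, and the distance between \<open>x\<close> and \<open>y\<close> itself is lost.
\<close>

lemma layer_weight_le_potential:
  assumes V: "finite V" "finite V'" and a: "inj_on a V" "a ` V \<subseteq> V'" and b: "inj_on b V" "b ` V \<subseteq> V'"
  shows "(\<Sum>u\<in>V. \<bar>f (a u) - f (b u)\<bar>)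
    \<le> 2 * (potential V' f - potential V (\<lambda>u. (f (a u) + f (b u)) / 2))"
proof -
  let ?g = "\<lambda>u. (f (a u) + f (b u)) / 2"
  let ?S = "\<lambda>u v. \<bar>f (a u) - f (a v)\<bar> + \<bar>f (b u) - f (b v)\<bar> + \<bar>f (a u) - f (b v)\<bar> + \<bar>f (b u) - f (a v)\<bar>"
  have "4 * potential V ?g + 2 * (\<Sum>u\<in>V. \<bar>f (a u) - f (b u)\<bar>)
      = (\<Sum>u\<in>V. \<Sum>v\<in>V. 4 * \<bar>?g u - ?g v\<bar> + (if u = v then 2 * \<bar>f (a u) - f (b u)\<bar> else 0))"
    using V(1) by (simp add: potential_def sum.distrib sum_distrib_left)
  also have "\<dots> \<le> (\<Sum>u\<in>V. \<Sum>v\<in>V. ?S u v)"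
    by (intro sum_mono) (auto simp: abs_if field_simps)
  also have "\<dots> \<le> potential V' f + potential V' f + potential V' f + potential V' f"
    unfolding sum.distrib by (intro add_mono sum_pairs_le_potential V a b)
  finally show ?thesis by simp
qed

lemma val_abs_le:
  "wf_layers w ps F \<Longrightarrow> (\<And>s. s \<in> F \<Longrightarrow> \<bar>v s\<bar> \<le> 1) \<Longrightarrow> s \<in> first_layer ps F \<Longrightarrow> \<bar>val ps v s\<bar> \<le> 1"
proof (induction ps arbitrary: s)
  case (Cons p ps)
  have "\<bar>val ps v (snd p 0 s)\<bar> \<le> 1" "\<bar>val ps v (snd p 1 s)\<bar> \<le> 1"
    using Cons by auto
  then show ?case by (auto simp: abs_if split: if_splits)
qed simp

text \<open>The potential telescopes over the injective layers. A layer that is not injective may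
  move the potential by up to 2w^2 in the wrong direction, counted twice, and has itself weight at
  most 2w.\<close>

lemma weight_le_potential:
  assumes "wf_layers w ps F" "\<And>s. s \<in> F \<Longrightarrow> \<bar>v s\<bar> \<le> 1"
  shows "weight ps v \<le> 2 * (potential F v - potential (first_layer ps F) (val ps v))
    + real (length (filter (\<lambda>p. \<not> injective_layer p) ps)) * (4 * (real w)\<^sup>2 + 2 * real w)"
  using assms(1)
proof (induction ps)
  case (Cons p ps)
  let ?V' = "first_layer ps F" and ?f = "val ps v"
  have wf: "wf_layers w ps F" "finite (fst p)" "card (fst p) \<le> w"
    and next_in: "\<And>s b. s \<in> fst p \<Longrightarrow> snd p b s \<in> ?V'"
    using Cons.prems by auto
  have V': "finite ?V'" "card ?V' \<le> w" using wf_first_layer[OF wf(1)] by auto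
  have b: "\<And>s. s \<in> ?V' \<Longrightarrow> \<bar>?f s\<bar> \<le> 1" by (rule val_abs_le[OF wf(1) assms(2)])
  have b': "\<And>s. s \<in> fst p \<Longrightarrow> \<bar>val (p # ps) v s\<bar> \<le> 1"
    by (rule val_abs_le[OF Cons.prems assms(2)]) simp_all
  let ?l = "\<Sum>s\<in>fst p. \<bar>?f (snd p 0 s) - ?f (snd p 1 s)\<bar>"
  show ?case
  proof (cases "injective_layer p")
    case True
    have "?l \<le> 2 * (potential ?V' ?f - potential (fst p) (val (p # ps) v))"
      using layer_weight_le_potential[of "fst p" ?V' "snd p 0" "snd p 1" ?f] wf V' True next_in
      by (auto simp: injective_layer_def image_subset_iff potential_def)
    then show ?thesis using Cons.IH[OF wf(1)] True by (simp del: val.simps)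
  next
    case False
    have "\<bar>?f (snd p 0 s) - ?f (snd p 1 s)\<bar> \<le> 2" if "s \<in> fst p" for s
      using b[OF next_in[OF that, of 0]] b[OF next_in[OF that, of 1]] by linarith
    then have "?l \<le> real (card (fst p)) * 2" by (rule sum_bounded_above)
    then have l: "?l \<le> 2 * real w" using wf(3) by linarith
    have "0 \<le> potential ?V' ?f" "potential (fst p) (val (p # ps) v) \<le> 2 * (real w)\<^sup>2"
      using potential_le[of ?V' ?f w] potential_le[of "fst p" "val (p # ps) v" w] b b' V' wf by auto
    then have "?l \<le> 2 * (potential ?V' ?f - potential (fst p) (val (p # ps) v)) + (4 * (real w)\<^sup>2 + 2 * real w)"
      by (intro order_trans[OF l]) (simp del: val.simps)
    then show ?thesis using Cons.IH[OF wf(1)] False by (simp add: algebra_simps del: val.simps)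
  qed
qed (simp add: potential_def)

lemma weight_bound:
  assumes "wf_layers w ps F" "\<And>s. s \<in> F \<Longrightarrow> \<bar>v s\<bar> \<le> 1" "1 \<le> w"
    "length (filter (\<lambda>p. \<not> injective_layer p) ps) \<le> l"
  shows "weight ps v \<le> 6 * (real w)\<^sup>2 * (real l + 1)"
proof -
  let ?m = "real (length (filter (\<lambda>p. \<not> injective_layer p) ps))"
  have "potential F v \<le> 2 * (real w)\<^sup>2"
    using potential_le(2)[of F v w] assms(2) wf_append[of w ps "[]" F] assms(1) by simp
  moreover have "0 \<le> potential (first_layer ps F) (val ps v)"
    unfolding potential_def by (intro sum_nonneg) simp
  ultimately have "weight ps v \<le> 4 * (real w)\<^sup>2 + ?m * (4 * (real w)\<^sup>2 + 2 * real w)"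
    using weight_le_potential[of w ps F v] assms by fastforce
  also have "\<dots> \<le> 4 * (real w)\<^sup>2 + real l * (4 * (real w)\<^sup>2 + 2 * (real w)\<^sup>2)"
    using assms(3,4) by (intro add_left_mono mult_mono) (auto simp: power2_eq_square)
  also have "\<dots> \<le> 6 * (real w)\<^sup>2 * (real l + 1)" by (simp add: algebra_simps)
  finally show ?thesis .
qed

section \<open>The generator on bit strings\<close>

primrec chunks :: "nat \<Rightarrow> nat \<Rightarrow> 'a list \<Rightarrow> 'a list list" where
  "chunks m 0 y = []"
| "chunks m (Suc k) y = take m y # chunks m k (drop m y)"

lemma length_chunks [simp]: "length (chunks m k y) = k"
  by (induction k arbitrary: y) auto

lemma concat_chunks: "length y = k * m \<Longrightarrow> concat (chunks m k y) = y"
  by (induction k arbitrary: y) auto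

lemma chunks_concat: "ys \<in> seqs (words m) k \<Longrightarrow> chunks m k (concat ys) = ys"
  by (induction k arbitrary: ys) (auto simp: seqs_def words_def length_Suc_conv)

lemma chunks_in_seqs: "y \<in> words (k * m) \<Longrightarrow> chunks m k y \<in> seqs (words m) k"
  by (induction k arbitrary: y) (auto simp: seqs_def words_def)

lemma concat_in_words: "ys \<in> seqs (words m) k \<Longrightarrow> concat ys \<in> words (k * m)"
  by (induction k arbitrary: ys) (auto simp: seqs_def words_def length_Suc_conv)

lemma bij_betw_chunks: "bij_betw (chunks m k) (words (k * m)) (seqs (words m) k)"
proof (rule bij_betw_byWitness[where f' = concat])
  show "\<forall>y\<in>words (k * m). concat (chunks m k y) = y"
    by (simp add: words_def concat_chunks)
qed (auto simp: chunks_concat chunks_in_seqs concat_in_words)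

lemma bij_betw_seqs_tuples:
  "bij_betw (\<lambda>l. \<lambda>c\<in>{..<k}. l ! c) (seqs A k) (tuples {..<k} A)"
proof (rule bij_betw_byWitness[where f' = "\<lambda>g. map g [0..<k]"])
  show "\<forall>l\<in>seqs A k. map (\<lambda>c\<in>{..<k}. l ! c) [0..<k] = l"
    by (auto simp: seqs_def intro!: nth_equalityI)
  show "\<forall>g\<in>tuples {..<k} A. (\<lambda>c\<in>{..<k}. map g [0..<k] ! c) = g"
    by (auto simp: fun_eq_iff PiE_def extensional_def)
  show "(\<lambda>l. \<lambda>c\<in>{..<k}. l ! c) ` seqs A k \<subseteq> tuples {..<k} A"
  proof (rule image_subsetI)
    fix l assume "l \<in> seqs A k"
    then have "l ! c \<in> A" if "c < k" for c using that nth_mem[of c l] unfolding seqs_def by blast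
    then show "(\<lambda>c\<in>{..<k}. l ! c) \<in> tuples {..<k} A" by simp
  qed
  show "(\<lambda>g. map g [0..<k]) ` tuples {..<k} A \<subseteq> seqs A k"
  proof (rule image_subsetI)
    fix g assume "g \<in> tuples {..<k} A"
    then have "g c \<in> A" if "c < k" for c using PiE_mem[of g "{..<k}" "\<lambda>_. A" c] that by simp
    then show "map g [0..<k] \<in> seqs A k" by (simp add: seqs_def image_subset_iff)
  qed
qed

lemma avg_tuples_bij:
  assumes "bij_betw h A B"
  shows "avg (tuples T B) f = avg (tuples T A) (\<lambda>g. f (\<lambda>c\<in>T. h (g c)))"
proof -
  have i: "inv_into A h (h x) = x" if "x \<in> A" for x
    using assms that by (auto simp: bij_betw_def)
  have j: "h (inv_into A h y) = y" "inv_into A h y \<in> A" if "y \<in> B" for y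
    using assms that by (auto simp: bij_betw_def f_inv_into_f inv_into_into)
  have "bij_betw (\<lambda>g. \<lambda>c\<in>T. h (g c)) (tuples T A) (tuples T B)"
  proof (rule bij_betw_byWitness[where f' = "\<lambda>g. \<lambda>c\<in>T. inv_into A h (g c)"])
    show "\<forall>g\<in>tuples T A. (\<lambda>c\<in>T. inv_into A h ((\<lambda>c\<in>T. h (g c)) c)) = g"
      by (auto simp: fun_eq_iff i PiE_def extensional_def Pi_def)
    show "\<forall>g\<in>tuples T B. (\<lambda>c\<in>T. h ((\<lambda>c\<in>T. inv_into A h (g c)) c)) = g"
      by (auto simp: fun_eq_iff j PiE_def extensional_def Pi_def)
    show "(\<lambda>g. \<lambda>c\<in>T. h (g c)) ` tuples T A \<subseteq> tuples T B"
      using assms by (auto simp: bij_betw_def)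
    show "(\<lambda>g. \<lambda>c\<in>T. inv_into A h (g c)) ` tuples T B \<subseteq> tuples T A"
      by (auto intro!: j(2))
  qed
  from avg_bij[OF this] show ?thesis .
qed

lemma avg_words_chunks:
  "avg (words (k * (l * m))) (\<lambda>y. f (\<lambda>c\<in>{..<k}. chunks m l (chunks (l * m) k y ! c)))
    = avg (tuples {..<k} (seqs (words m) l)) f"
proof -
  have "avg (tuples {..<k} (seqs (words m) l)) f
      = avg (tuples {..<k} (words (l * m))) (\<lambda>g. f (\<lambda>c\<in>{..<k}. chunks m l (g c)))"
    by (rule avg_tuples_bij[OF bij_betw_chunks])
  also have "\<dots> = avg (seqs (words (l * m)) k) (\<lambda>ys. f (\<lambda>c\<in>{..<k}. chunks m l (ys ! c)))"
    unfolding avg_bij[OF bij_betw_seqs_tuples]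
    by (intro avg_cong arg_cong[of _ _ f]) (auto simp: fun_eq_iff)
  finally show ?thesis unfolding avg_bij[OF bij_betw_chunks] by simp
qed

text \<open>The start block is the hash of the zero block under an additional first hash function.
  It is uniform, and the seed becomes a sequence of words of equal length, so that a machine treats
  the start block as one more level.\<close>

definition copy_output :: "nat \<Rightarrow> nat \<Rightarrow> bit list \<Rightarrow> bit list" where
  "copy_output q L y = (let hs = chunks (4 * q) (Suc L) y in
     nisan.gen (toeplitz q) hd (tl hs) (toeplitz q (hd hs) (replicate q 0)))"

text \<open>The last \<open>n\<close> bits are kept because the output counter measures the distance
  from the end.\<close>

definition gen_bits :: "nat \<Rightarrow> nat \<Rightarrow> nat \<Rightarrow> nat \<Rightarrow> bit list \<Rightarrow> bit list" where
  "gen_bits q L k n y = drop (2 ^ L - n)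
     (mask (replicate (2 ^ L) 0) {..<k} (\<lambda>c. copy_output q L (chunks (Suc L * (4 * q)) k y ! c)))"

lemma length_gen_bits: "n \<le> 2 ^ L \<Longrightarrow> length (gen_bits q L k n y) = n"
  by (simp add: gen_bits_def)

text \<open>Idle layers in front turn a program of length \<open>n\<close> into one whose length is a power of 2.\<close>

definition pad :: "nat \<Rightarrow> 's \<Rightarrow> 's prog_layer list \<Rightarrow> 's prog_layer list" where
  "pad m s ps = replicate m ({s}, \<lambda>_ u. u) @ ps"

lemma pad_props:
  assumes "wf_layers w ps F" "s \<in> first_layer ps F" "1 \<le> w"
  shows "wf_layers w (pad m s ps) F \<and> s \<in> first_layer (pad m s ps) F \<and>
    weight (pad m s ps) v = weight ps v \<and> val (pad m s ps) v s = val ps v s"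
  using assms by (induction m) (auto simp: pad_def)

lemma run_pad: "m \<le> length z \<Longrightarrow> run (pad m s ps) z u = run ps (drop m z) u"
  by (induction m arbitrary: z) (auto simp: pad_def Suc_le_length_iff drop_Suc)

theorem gen_bits_error:
  assumes wf: "wf_layers w ps F" "s \<in> first_layer ps F" "1 \<le> w"
    and n: "length ps = n" "n \<le> 2 ^ L" and q: "q = 8 * \<beta>" "1 \<le> \<beta>"
  shows "\<bar>avg (words (k * (Suc L * (4 * q)))) (\<lambda>y. v (run ps (gen_bits q L k n y) s)) - val ps v s\<bar>
    \<le> weight ps v * (real L * (real w)\<^sup>2 / 2 ^ (4 * \<beta>)) ^ k"
proof -
  interpret nisan "words q" "words (4 * q)" "toeplitz q" hd
    using q by (intro nisan_toeplitz) simp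
  define ps' where "ps' = pad (2 ^ L - n) s ps"
  define z0 :: "bit list" where "z0 = replicate (2 ^ L) 0"
  have ps': "wf_layers w ps' F" "s \<in> first_layer ps' F" "weight ps' v = weight ps v"
      "val ps' v s = val ps v s"
    using pad_props[OF wf] by (simp_all add: ps'_def)
  have len: "length ps' = 2 ^ L" "length z0 = 2 ^ L"
    using n by (simp_all add: ps'_def pad_def z0_def)
  let ?T = "{..<k}" and ?H = "words (4 * q)" and ?Q = "words q" and ?x0 = "\<lambda>c::nat. replicate q (0::bit)"
  let ?S = "tuples ?T (seqs ?H L)"
  have x0: "replicate q 0 \<in> ?Q" by (simp add: words_def)
  define f where "f hs = v (run ps' (mask z0 ?T (\<lambda>c. gen (tl (hs c)) (toeplitz q (hd (hs c)) (replicate q 0)))) s)" for hs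
  have "v (run ps (gen_bits q L k n y) s)
      = f (\<lambda>c\<in>?T. chunks (4 * q) (Suc L) (chunks (Suc L * (4 * q)) k y ! c))" for y
  proof -
    have "gen_bits q L k n y = drop (2 ^ L - n) (mask z0 ?T (\<lambda>c. gen
        (tl ((\<lambda>c\<in>?T. chunks (4 * q) (Suc L) (chunks (Suc L * (4 * q)) k y ! c)) c))
        (toeplitz q (hd ((\<lambda>c\<in>?T. chunks (4 * q) (Suc L) (chunks (Suc L * (4 * q)) k y ! c)) c)) (replicate q 0))))"
      unfolding gen_bits_def z0_def copy_output_def Let_def
      by (rule arg_cong[of _ _ "drop (2 ^ L - n)"], rule mask_cong) (simp only: restrict_apply')
    then show ?thesis
      unfolding f_def ps'_def by (subst run_pad) (simp_all add: z0_def)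
  qed
  then have "avg (words (k * (Suc L * (4 * q)))) (\<lambda>y. v (run ps (gen_bits q L k n y) s))
      = avg (tuples ?T (seqs ?H (Suc L))) f"
    by (simp only: avg_words_chunks)
  also have "\<dots> = avg (tuples ?T ?H) (\<lambda>h. avg ?S (\<lambda>hs. v (outcome ?T hs z0 ps' s (act ?T h ?x0))))"
    unfolding avg_tuples_seqs_Suc avg_Times f_def outcome_def
    unfolding prod.case
    by (rule avg_cong, rule avg_cong, rule arg_cong[of _ _ "\<lambda>z. v (run ps' z s)"], rule mask_cong)
      (simp add: act_def)
  also have "\<dots> = avg ?S (\<lambda>hs. avg (tuples ?T ?H) (\<lambda>h. v (outcome ?T hs z0 ps' s (act ?T h ?x0))))"
    by (rule avg_swap)
  also have "\<dots> = avg ?S (\<lambda>hs. avg (tuples ?T ?Q) (\<lambda>x. v (outcome ?T hs z0 ps' s x)))"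
    by (rule avg_cong, rule avg_act) (use x0 in auto)
  also have "\<dots> = avg ?S (\<lambda>hs. dev ?T hs z0 ps' v s + val ps v s)"
    by (simp add: dev_def ps')
  also have "\<dots> = avg ?S (\<lambda>hs. dev ?T hs z0 ps' v s) + val ps v s"
    using H by (simp add: avg_add avg_const finite_tuples tuples_nonempty finite_seqs seqs_nonempty)
  finally have eq: "avg (words (k * (Suc L * (4 * q)))) (\<lambda>y. v (run ps (gen_bits q L k n y) s)) - val ps v s
      = avg ?S (\<lambda>hs. dev ?T hs z0 ps' v s)" by simp
  obtain B where B: "\<forall>hs\<in>?S. \<forall>s\<in>first_layer ps' F. \<bar>dev ?T hs z0 ps' v s\<bar> \<le> B hs"
    "avg ?S (\<lambda>hs. (B hs)\<^sup>2) \<le> (weight ps' v)\<^sup>2 * ((real L * (real w)\<^sup>2)\<^sup>2 / card ?Q) ^ card ?T"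
    using dev_bound[OF _ ps'(1) len wf(3), of ?T v] by auto
  \<comment> \<open>The factor 8 makes \<open>card Q\<close> the square of 2^(4\<beta>), which
    matches the squares in the second moment.\<close>
  have cQ: "real (card ?Q) = (2 ^ (4 * \<beta>))\<^sup>2"
    by (simp add: card_words q power_mult[symmetric])
  have "\<bar>avg ?S (\<lambda>hs. dev ?T hs z0 ps' v s)\<bar> \<le> avg ?S (\<lambda>hs. \<bar>dev ?T hs z0 ps' v s\<bar>)"
    by (rule abs_avg_le)
  also have "\<dots> \<le> avg ?S B" by (rule avg_mono) (use B(1) ps'(2) in auto)
  also have "\<dots> \<le> rms ?S B"
    using H by (intro avg_le_rms finite_tuples tuples_nonempty finite_seqs seqs_nonempty) auto
  also have "\<dots> \<le> weight ps v * (real L * (real w)\<^sup>2 / 2 ^ (4 * \<beta>)) ^ k"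
  proof (rule rms_le)
    have "((real L * (real w)\<^sup>2)\<^sup>2 / card ?Q) ^ card ?T = ((real L * (real w)\<^sup>2 / 2 ^ (4 * \<beta>)) ^ k)\<^sup>2"
      unfolding cQ power_divide[symmetric] by (simp add: power_mult[symmetric] mult.commute[of _ 2])
    then show "avg ?S (\<lambda>hs. (B hs)\<^sup>2) \<le> (weight ps v * (real L * (real w)\<^sup>2 / 2 ^ (4 * \<beta>)) ^ k)\<^sup>2"
      using B(2) by (simp add: ps' power_mult_distrib)
  qed (simp add: weight_nonneg)
  finally show ?thesis unfolding eq .
qed

lemma val_eq_avg: "val ps v s = avg (words (length ps)) (\<lambda>z. v (run ps z s))"
  by (induction ps arbitrary: s) (simp_all add: words_0 avg_words_Suc avg_def[of "{_}"])

section \<open>Parameters\<close>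

text \<open>
  If \<open>w \<le> n\<close> then \<open>unit_size n w\<close> is a number \<open>\<beta>\<close> with \<open>levels n \<cdot> w\<^sup>2 \<le> 2\<^bsup>2\<beta>\<^esup>\<close>; as a block has \<open>8\<beta>\<close> bits,
  each copy then contributes a factor \<open>2\<^bsup>-2\<beta>\<^esup>\<close> to the error.
\<close>

definition levels :: "nat \<Rightarrow> nat" where
  "levels n = floorlog 2 n"

definition unit_size :: "nat \<Rightarrow> nat \<Rightarrow> nat" where
  "unit_size n w = min w (levels n) + floorlog 2 (levels n)"

definition block_size :: "nat \<Rightarrow> nat \<Rightarrow> nat" where
  "block_size n w = 8 * unit_size n w"

text \<open>Let \<kappa> be the numerator. The copies reduce the error by 2^(-2\<kappa>), where
  2\<kappa> consists of 2w + 4 + \<open>floorlog 2 l\<close>, which outweighs the weight 6 w^2 (l +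
  1), and of a rest of at least \<open>precision \<epsilon>\<close>. \<open>Suc\<close> rounds the
  quotient up.\<close>

definition num_copies :: "real \<Rightarrow> nat \<Rightarrow> nat \<Rightarrow> nat \<Rightarrow> nat" where
  "num_copies \<epsilon> n w l = Suc ((precision \<epsilon> + floorlog 2 l + w + 2) div unit_size n w)"

definition seed_length :: "real \<Rightarrow> nat \<Rightarrow> nat \<Rightarrow> nat \<Rightarrow> nat" where
  "seed_length \<epsilon> n w l = num_copies \<epsilon> n w l * (Suc (levels n) * (4 * block_size n w))"

definition sign :: "bit \<Rightarrow> int" where
  "sign b = (if b = 0 then 1 else -1)"

definition unsign :: "int \<Rightarrow> bit" where
  "unsign b = (if b = 1 then 0 else 1)"

definition generator :: "real \<Rightarrow> nat \<Rightarrow> nat \<Rightarrow> nat \<Rightarrow> int list \<Rightarrow> int list" where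
  "generator \<epsilon> n w l y =
     map sign (gen_bits (block_size n w) (levels n) (num_copies \<epsilon> n w l) n (map unsign y))"

lemma le_power_floorlog: "Suc n \<le> 2 ^ floorlog 2 n"
  using floorlog_bounds[of n 2] by (cases "n = 0") (auto simp: floorlog_def)

lemma length_generator: "length (generator \<epsilon> n w l y) = n"
  unfolding generator_def levels_def
  using le_power_floorlog[of n] by (simp add: length_gen_bits)

lemma generator_in_cube: "generator \<epsilon> n w l y \<in> cube n"
  using length_generator[of \<epsilon> n w l y] by (auto simp: cube_def generator_def sign_def)

lemma floorlog_le: "real (floorlog 2 n) \<le> lg (real n) + 1"
proof (cases "n = 0")
  case False
  then have "0 \<le> log 2 (real n)" by simp
  then have "real (floorlog 2 n) \<le> log 2 (real n) + 1"
    using False of_int_floor_le[of "log 2 (real n)"] by (simp add: floorlog_def)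
  then show ?thesis by (simp add: lg_def)
qed (simp add: floorlog_def lg_def)

lemma lg_ge_1: "1 \<le> lg x"
  by (simp add: lg_def)

text \<open>384 = 32 * 4 * 3: a hash function has 4 * 8 bits per unit, copies times unit size are at
  most 4 times the sum in parentheses, because rounding up costs at most one unit, and
  \<open>levels n\<close> + 1 is at most 3 \<open>lg n\<close>.\<close>

lemma seed_length_bound:
  assumes "0 < \<epsilon>"
  shows "real (seed_length \<epsilon> n w l)
    \<le> 384 * (lg (lg (real n)) + lg (1 / \<epsilon>) + lg (real l) + real w) * lg (real n)"
proof (cases "n = 0")
  case True
  then show ?thesis
    using lg_ge_1[of "lg (real n)"] lg_ge_1[of "1 / \<epsilon>"] lg_ge_1[of "real l"] lg_ge_1[of "real n"]
    by (simp add: seed_length_def block_size_def unit_size_def levels_def floorlog_def)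
next
  case False
  define S where "S = lg (lg (real n)) + lg (1 / \<epsilon>) + lg (real l) + real w"
  define \<kappa> where "\<kappa> = precision \<epsilon> + floorlog 2 l + w + 2"
  let ?L = "levels n" and ?\<beta> = "unit_size n w"
  have L: "real ?L \<le> 2 * lg (real n)"
    using floorlog_le[of n] lg_ge_1[of "real n"] by (simp add: levels_def)
  have L0: "1 \<le> ?L" using False by (simp add: levels_def floorlog_def)
  have "log 2 (real ?L) \<le> log 2 (2 * lg (real n))"
    using L L0 by simp
  also have "\<dots> = 1 + log 2 (lg (real n))"
    using lg_ge_1[of "real n"] by (subst log_mult) auto
  also have "\<dots> \<le> 1 + lg (lg (real n))" by (simp add: lg_def[of "lg (real n)"])
  finally have "real (floorlog 2 ?L) \<le> 2 + lg (lg (real n))"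
    using L0 by (simp add: floorlog_def) linarith
  then have \<beta>: "real ?\<beta> \<le> real w + 3 * lg (lg (real n))"
    using lg_ge_1[of "lg (real n)"] by (simp add: unit_size_def)
  have "real (precision \<epsilon>) \<le> lg (1 / \<epsilon>) + 1"
    unfolding precision_def lg_def by linarith
  then have "real \<kappa> \<le> 2 * lg (1 / \<epsilon>) + 4 * lg (real l) + real w"
    using floorlog_le[of l] lg_ge_1[of "real l"] lg_ge_1[of "1 / \<epsilon>"] by (simp add: \<kappa>_def)
  then have \<kappa>\<beta>: "real (\<kappa> + ?\<beta>) \<le> 4 * S"
    using \<beta> lg_ge_1[of "1 / \<epsilon>"] lg_ge_1[of "lg (real n)"] by (simp add: S_def)
  have "num_copies \<epsilon> n w l * ?\<beta> \<le> \<kappa> + ?\<beta>"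
    unfolding num_copies_def \<kappa>_def[symmetric] by (simp add: div_times_less_eq_dividend)
  then have k: "real (num_copies \<epsilon> n w l * ?\<beta>) \<le> 4 * S" using \<kappa>\<beta> by linarith
  have "real (seed_length \<epsilon> n w l) = 32 * real (num_copies \<epsilon> n w l * ?\<beta>) * real (Suc ?L)"
    by (simp add: seed_length_def block_size_def algebra_simps)
  also have "\<dots> \<le> 32 * (4 * S) * (3 * lg (real n))"
  proof (intro mult_mono)
    show "0 \<le> 32 * (4 * S)" using k by linarith
  qed (use k L lg_ge_1[of "real n"] in auto)
  also have "\<dots> = 384 * S * lg (real n)" by simp
  finally show ?thesis unfolding S_def .
qed

section \<open>Fooling branching programs\<close>

lemma unsign_sign [simp]: "unsign (sign b) = b"
  by (cases b) (simp_all add: sign_def unsign_def)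

lemma bij_betw_sign: "bij_betw (map sign) (words n) (cube n)"
proof (rule bij_betw_byWitness[where f' = "map unsign"])
  show "\<forall>x\<in>cube n. map sign (map unsign x) = x"
    by (auto simp: cube_def sign_def unsign_def intro!: map_idI)
qed (auto simp: words_def cube_def sign_def unsign_def intro!: map_idI)

lemma expectation_uniform:
  "measure_pmf.expectation (uniform n) f = avg (words n) (\<lambda>z. f (map sign z))"
proof -
  have "cube n \<noteq> {}" using card_cube[of n] by auto
  then have "measure_pmf.expectation (uniform n) f = avg (cube n) f"
    by (simp add: integral_pmf_of_set finite_cube avg_def)
  then show ?thesis by (simp add: avg_bij[OF bij_betw_sign])
qed

definition program :: "robp \<Rightarrow> nat \<Rightarrow> nat prog_layer list" where
  "program B n = map (\<lambda>i. (layer B (Suc i), \<lambda>b. edge B (Suc i) (sign b))) [0..<n]"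

lemma program_Suc: "program B (Suc n) = program B n @ [(layer B (Suc n), \<lambda>b. edge B (Suc n) (sign b))]"
  by (simp add: program_def)

lemma length_program [simp]: "length (program B n) = n"
  by (simp add: program_def)

lemma run_program:
  "m \<le> length z \<Longrightarrow> run (program B m) (take m z) (start B) = vertex_at B (map sign z) m"
proof (induction m)
  case 0
  then show ?case by (simp add: program_def)
next
  case (Suc m)
  then show ?case
    by (simp add: program_Suc take_Suc_conv_app_nth run_append)
qed

lemma first_layer_program: "first_layer (program B m) (layer B (Suc m)) = layer B 1"
proof (induction m)
  case 0
  then show ?case by (simp add: program_def)
next
  case (Suc m)
  then show ?case by (simp add: program_Suc first_layer_append)
qed

lemma wf_program:
  assumes "is_robp w n B" "1 \<le> w" "m \<le> n"
  shows "wf_layers w (program B m) (layer B (Suc m))"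
  using assms(3)
proof (induction m)
  case 0
  then show ?case using assms by (simp add: program_def is_robp_def)
next
  case (Suc m)
  have fin: "finite (layer B i) \<and> card (layer B i) \<le> w" if "i \<in> {1..n + 1}" for i
    using assms(1,2) that by (cases "i = 1") (auto simp: is_robp_def)
  have "sign b \<in> {1, -1}" for b by (simp add: sign_def)
  then have "edge B (Suc m) (sign b) v \<in> layer B (Suc (Suc m))" if "v \<in> layer B (Suc m)" for b v
    using assms(1) Suc.prems that unfolding is_robp_def by (metis Suc_eq_plus1 Suc_leI atLeastAtMost_iff le_add2 plus_1_eq_Suc)
  then show ?case
    using Suc fin[of "Suc m"] fin[of "Suc (Suc m)"] by (simp add: program_Suc wf_append)
qed

lemma injective_layer_iff:
  "injective_layer (layer B i, \<lambda>b. edge B i (sign b)) \<longleftrightarrow> \<not> colliding B i"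
proof -
  have "(\<forall>b. P (sign b)) \<longleftrightarrow> (\<forall>b\<in>{1, -1}. P b)" for P
  proof -
    have "sign 0 = 1" "sign 1 = -1" by (simp_all add: sign_def)
    then show ?thesis by (metis (full_types) bit_not_zero_iff insert_iff singletonD)
  qed
  from this[of "\<lambda>b. inj_on (edge B i b) (layer B i)"] show ?thesis
    unfolding injective_layer_def colliding_def inj_on_def by auto
qed

lemma length_colliding:
  "length (filter (\<lambda>p. \<not> injective_layer p) (program B n)) = card {i \<in> {1..n}. colliding B i}"
proof -
  have "length (filter (\<lambda>p. \<not> injective_layer p) (program B n)) = card {i. i < n \<and> colliding B (Suc i)}"
    unfolding length_filter_conv_card program_def by (simp add: injective_layer_iff cong: conj_cong)
  also have "\<dots> = card (Suc ` {i. i < n \<and> colliding B (Suc i)})"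
    by (simp add: card_image)
  also have "Suc ` {i. i < n \<and> colliding B (Suc i)} = {i \<in> {1..n}. colliding B i}"
  proof (intro set_eqI iffI)
    fix i assume "i \<in> {i \<in> {1..n}. colliding B i}"
    then show "i \<in> Suc ` {i. i < n \<and> colliding B (Suc i)}"
      by (intro image_eqI[of _ _ "i - 1"]) auto
  qed auto
  finally show ?thesis .
qed

section \<open>The error budget for fixed parameters, for narrow and for wide programs\<close>

context
  fixes \<epsilon> :: real and n w l :: nat
  assumes eps: "0 < \<epsilon>" and n: "1 \<le> n"
begin

private abbreviation "L \<equiv> levels n"
private abbreviation "\<beta> \<equiv> unit_size n w"
private abbreviation "k \<equiv> num_copies \<epsilon> n w l"
private abbreviation "\<kappa> \<equiv> precision \<epsilon> + floorlog 2 l + w + 2"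
private abbreviation "gb \<equiv> gen_bits (block_size n w) L k n"

lemma levels_props: "1 \<le> L" "n < 2 ^ L" "L \<le> n" "L < 2 ^ floorlog 2 L" "1 \<le> floorlog 2 L"
proof -
  show L: "1 \<le> L" using n by (simp add: levels_def floorlog_def)
  show "n < 2 ^ L" using le_power_floorlog[of n] by (simp add: levels_def)
  have "2 ^ (L - 1) \<le> n" using floorlog_bounds[of n 2] n by (simp add: levels_def)
  moreover have "L - 1 < 2 ^ (L - 1)" by simp
  ultimately show "L \<le> n" by linarith
  show "L < 2 ^ floorlog 2 L" using le_power_floorlog[of L] by simp
  show "1 \<le> floorlog 2 L" using L by (simp add: floorlog_def)
qed

lemma unit_size_pos: "1 \<le> \<beta>"
  using levels_props by (simp add: unit_size_def)

lemma power_copies_le: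
  fixes x :: real
  assumes "0 \<le> x" "x \<le> 2 ^ (2 * \<beta>)"
  shows "(x / 2 ^ (4 * \<beta>)) ^ k \<le> 1 / 2 ^ (2 * \<kappa>)"
proof -
  have "x / 2 ^ (4 * \<beta>) \<le> 2 ^ (2 * \<beta>) / 2 ^ (4 * \<beta>)"
    using assms by (intro divide_right_mono) auto
  also have "\<dots> = 1 / 2 ^ (2 * \<beta>)"
    by (simp add: field_simps flip: power_add)
  finally have "(x / 2 ^ (4 * \<beta>)) ^ k \<le> (1 / 2 ^ (2 * \<beta>)) ^ k"
    using assms by (intro power_mono) auto
  also have "\<dots> = 1 / 2 ^ (2 * (\<beta> * k))"
    by (simp add: power_divide mult.assoc flip: power_mult)
  also have "\<dots> \<le> 1 / 2 ^ (2 * \<kappa>)"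
  proof -
    have "\<kappa> \<le> \<beta> * k"
      using dividend_less_times_div[of \<beta> \<kappa>] unit_size_pos by (simp add: num_copies_def)
    then show ?thesis by (intro divide_left_mono power_increasing) auto
  qed
  finally show ?thesis .
qed

lemma inverse_precision: "1 / 2 ^ precision \<epsilon> \<le> \<epsilon>"
proof -
  have "log 2 (1 / \<epsilon>) \<le> real (precision \<epsilon>)" unfolding precision_def by linarith
  then have "1 / \<epsilon> \<le> 2 powr real (precision \<epsilon>)" using eps by (simp add: log_le_iff)
  then show ?thesis using eps by (simp add: powr_realpow field_simps)
qed

lemma error_le: "2 ^ (2 * w + 4) * real (l + 1) * (1 / 2 ^ (2 * \<kappa>)) \<le> \<epsilon>"
proof -
  define A D where "A = 2 * w + 4 + floorlog 2 l" and "D = precision \<epsilon> + precision \<epsilon> + floorlog 2 l"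
  have l: "real (l + 1) \<le> 2 ^ floorlog 2 l"
    using le_power_floorlog[of l] by (metis Suc_eq_plus1 of_nat_le_iff of_nat_numeral of_nat_power)
  have "2 ^ (2 * w + 4) * real (l + 1) * (1 / 2 ^ (2 * \<kappa>))
      \<le> 2 ^ (2 * w + 4) * 2 ^ floorlog 2 l * (1 / 2 ^ (2 * \<kappa>))"
    using l by (intro mult_right_mono mult_left_mono) auto
  also have "\<dots> = 1 / 2 ^ D"
  proof -
    have "2 * \<kappa> = A + D" by (simp add: A_def D_def)
    then have "(2::real) ^ (2 * \<kappa>) = 2 ^ A * 2 ^ D" by (simp only: power_add)
    moreover have "(2::real) ^ (2 * w + 4) * 2 ^ floorlog 2 l = 2 ^ A" by (simp only: A_def power_add)
    ultimately show ?thesis by simp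
  qed
  also have "\<dots> \<le> 1 / 2 ^ precision \<epsilon>"
    unfolding D_def by (intro divide_left_mono power_increasing) auto
  finally show ?thesis using inverse_precision by linarith
qed

lemma fools_narrow:
  assumes B: "is_robp w n B" "card {i \<in> {1..n}. colliding B i} \<le> l" and w: "1 \<le> w" "w \<le> n"
  defines "v \<equiv> \<lambda>u. if u \<in> accepting B then -1 else 1 :: real"
  shows "\<bar>avg (words (seed_length \<epsilon> n w l)) (\<lambda>y. v (run (program B n) (gb y) (start B)))
    - val (program B n) v (start B)\<bar> \<le> \<epsilon>"
proof -
  let ?F = "layer B (Suc n)"
  have wf: "wf_layers w (program B n) ?F" by (rule wf_program[OF B(1) w(1)]) simp
  have s: "start B \<in> first_layer (program B n) ?F"
    unfolding first_layer_program using B(1) by (simp add: is_robp_def)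
  \<comment> \<open>For w \<le> L the bound w < 2^w is used, otherwise w \<le> n < 2^L.\<close>
  have x: "real L * (real w)\<^sup>2 \<le> 2 ^ (2 * \<beta>)"
  proof -
    have "w\<^sup>2 \<le> 2 ^ (2 * min w L)"
    proof (cases "w \<le> L")
      case True
      have "w\<^sup>2 \<le> (2 ^ w)\<^sup>2" by (intro power_mono) (simp_all add: less_imp_le)
      then show ?thesis using True by (simp add: power_mult[symmetric] mult.commute)
    next
      case False
      have "w\<^sup>2 \<le> (2 ^ L)\<^sup>2" using w levels_props by (intro power_mono) auto
      then show ?thesis using False by (simp add: power_mult[symmetric] mult.commute)
    qed
    then have "L * w\<^sup>2 \<le> 2 ^ floorlog 2 L * 2 ^ (2 * min w L)"
      using levels_props(4) by (intro mult_mono) auto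
    also have "\<dots> \<le> 2 ^ (2 * \<beta>)" unfolding power_add[symmetric] unit_size_def by (intro power_increasing) auto
    finally show ?thesis by (metis of_nat_le_iff of_nat_mult of_nat_numeral of_nat_power)
  qed
  have "\<bar>avg (words (seed_length \<epsilon> n w l)) (\<lambda>y. v (run (program B n) (gb y) (start B)))
      - val (program B n) v (start B)\<bar> \<le> weight (program B n) v * (real L * (real w)\<^sup>2 / 2 ^ (4 * \<beta>)) ^ k"
    unfolding seed_length_def
    using gen_bits_error[OF wf s w(1) _ _ block_size_def unit_size_pos] levels_props(2) by simp
  also have "\<dots> \<le> (6 * (real w)\<^sup>2 * (real l + 1)) * (1 / 2 ^ (2 * \<kappa>))"
  proof (intro mult_mono power_copies_le x)
    show "weight (program B n) v \<le> 6 * (real w)\<^sup>2 * (real l + 1)"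
      using B(2) by (intro weight_bound[OF wf]) (use w in \<open>auto simp: v_def length_colliding\<close>)
  qed auto
  also have "\<dots> \<le> 2 ^ (2 * w + 4) * real (l + 1) * (1 / 2 ^ (2 * \<kappa>))"
  proof (intro mult_right_mono)
    have "real w \<le> 2 ^ w" by (metis less_imp_le of_nat_less_two_power)
    then have "(real w)\<^sup>2 \<le> (2 ^ w)\<^sup>2" by (intro power_mono) auto
    then have "6 * (real w)\<^sup>2 \<le> 16 * (2 ^ w)\<^sup>2" by (intro mult_mono) auto
    also have "\<dots> = 2 ^ (2 * w + 4)" by (simp add: power_add power_mult[symmetric] mult.commute)
    finally have "6 * (real w)\<^sup>2 \<le> 2 ^ (2 * w + 4)" .
    then show "6 * (real w)\<^sup>2 * (real l + 1) \<le> 2 ^ (2 * w + 4) * real (l + 1)"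
      using mult_right_mono[of _ _ "real l + 1"] by (simp add: add.commute)
  qed auto
  also have "\<dots> \<le> \<epsilon>" by (rule error_le)
  finally show ?thesis .
qed

text \<open>
  If the width exceeds the length, the number of copies is large enough for the output to be close
  to uniform: each of the \<open>2 ^ n\<close> singletons is recognised by a program of width 2.
\<close>

definition point_program :: "bit list \<Rightarrow> bool prog_layer list" where
  "point_program z = map (\<lambda>b. (UNIV, \<lambda>c s. s \<and> c = b)) z"

lemma run_point_program: "length z' = length z \<Longrightarrow> run (point_program z) z' s \<longleftrightarrow> s \<and> z' = z"
proof (induction z arbitrary: z' s)
  case (Cons b z)
  then obtain b' z'' where z': "z' = b' # z''" "length z'' = length z" by (cases z') auto
  show ?case using Cons.IH[OF z'(2)] by (auto simp: z' point_program_def)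
qed (simp add: point_program_def)

lemma point_program_props:
  "wf_layers 2 (point_program z) UNIV" "first_layer (point_program z) UNIV = UNIV"
proof -
  show f: "first_layer (point_program z) UNIV = UNIV" for z
    by (cases z) (auto simp: point_program_def)
  show "wf_layers 2 (point_program z) UNIV"
  proof (induction z)
    case (Cons b z)
    then show ?case using f[of z] by (simp add: point_program_def)
  qed (simp add: point_program_def)
qed

lemma point_error:
  assumes "z \<in> words n" "n < w"
  shows "\<bar>avg (words (seed_length \<epsilon> n w l)) (\<lambda>y. of_bool (gb y = z)) - 1 / 2 ^ n\<bar>
    \<le> 24 * (real n + 1) * (1 / 2 ^ (2 * \<kappa>))"
proof -
  let ?ps = "point_program z" and ?v = "of_bool :: bool \<Rightarrow> real"
  have z: "length z = n" using assms by (simp add: words_def)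
  then have len: "length ?ps = n" by (simp add: point_program_def)
  have r: "?v (run ?ps (gb y) True) = of_bool (gb y = z)" for y
    using levels_props(2) z by (simp add: run_point_program length_gen_bits)
  have "val ?ps ?v True = avg (words n) (\<lambda>z'. of_bool (z' = z))"
    unfolding val_eq_avg len by (rule avg_cong) (simp add: run_point_program z words_def)
  also have "\<dots> = 1 / 2 ^ n"
  proof -
    have "words n \<inter> {z'. z' = z} = {z}" using assms by auto
    then show ?thesis by (simp add: avg_def card_words sum_of_bool_eq finite_words Int_def[symmetric])
  qed
  finally have val: "val ?ps ?v True = 1 / 2 ^ n" .
  have x: "real L * (real 2)\<^sup>2 \<le> 2 ^ (2 * \<beta>)"
  proof -
    have "min w L = L" using assms levels_props by simp
    then have \<beta>: "\<beta> = L + floorlog 2 L" by (simp add: unit_size_def)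
    have "L * 2\<^sup>2 \<le> 2 ^ floorlog 2 L * (2::nat) ^ 2"
      using levels_props(4) by (intro mult_mono) auto
    also have "\<dots> \<le> 2 ^ (2 * \<beta>)" unfolding power_add[symmetric] \<beta>
      using levels_props(1) by (intro power_increasing) auto
    finally show ?thesis by (metis of_nat_le_iff of_nat_mult of_nat_numeral of_nat_power)
  qed
  have "\<bar>avg (words (seed_length \<epsilon> n w l)) (\<lambda>y. ?v (run ?ps (gb y) True)) - val ?ps ?v True\<bar>
      \<le> weight ?ps ?v * (real L * (real 2)\<^sup>2 / 2 ^ (4 * \<beta>)) ^ k"
    unfolding seed_length_def
    using gen_bits_error[OF point_program_props(1) _ _ len _ block_size_def unit_size_pos, where s = True and L = L and v = ?v and k = k]
      levels_props(2) by (simp add: point_program_props)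
  also have "\<dots> \<le> (6 * (real 2)\<^sup>2 * (real n + 1)) * (1 / 2 ^ (2 * \<kappa>))"
  proof (intro mult_mono power_copies_le x)
    \<comment> \<open>All \<open>n\<close> layers of the program are allowed to collide.\<close>
    show "weight ?ps ?v \<le> 6 * (real 2)\<^sup>2 * (real n + 1)"
      by (rule weight_bound[OF point_program_props(1)]) (use length_filter_le[of _ ?ps] len in auto)
  qed auto
  finally show ?thesis unfolding r val by simp
qed

lemma fools_wide:
  fixes f :: "bit list \<Rightarrow> real"
  assumes "n < w" "\<And>z. \<bar>f z\<bar> \<le> 1"
  shows "\<bar>avg (words (seed_length \<epsilon> n w l)) (\<lambda>y. f (gb y)) - avg (words n) f\<bar> \<le> \<epsilon>"
proof -
  let ?S = "words (seed_length \<epsilon> n w l)"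
  have "gb y \<in> words n" for y using levels_props(2) by (simp add: words_def length_gen_bits)
  then have "f (gb y) = (\<Sum>z\<in>words n. f z * of_bool (gb y = z))" for y
    by (simp add: finite_words of_bool_def if_distrib[of "\<lambda>x. f _ * x"] sum.delta' cong: if_cong)
  then have "avg ?S (\<lambda>y. f (gb y)) = (\<Sum>z\<in>words n. f z * avg ?S (\<lambda>y. of_bool (gb y = z)))"
    by (simp add: avg_sum avg_cmult)
  moreover have "avg (words n) f = (\<Sum>z\<in>words n. f z * (1 / 2 ^ n))"
    by (simp add: avg_def card_words sum_divide_distrib)
  ultimately have "\<bar>avg ?S (\<lambda>y. f (gb y)) - avg (words n) f\<bar>
      = \<bar>\<Sum>z\<in>words n. f z * (avg ?S (\<lambda>y. of_bool (gb y = z)) - 1 / 2 ^ n)\<bar>"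
    by (simp add: sum_subtractf right_diff_distrib)
  also have "\<dots> \<le> (\<Sum>z\<in>words n. \<bar>f z * (avg ?S (\<lambda>y. of_bool (gb y = z)) - 1 / 2 ^ n)\<bar>)"
    by (rule sum_abs)
  also have "\<dots> \<le> (\<Sum>z\<in>words n. 1 * (24 * (real n + 1) * (1 / 2 ^ (2 * \<kappa>))))"
    unfolding abs_mult using assms by (intro sum_mono mult_mono point_error) auto
  also have "\<dots> = 2 ^ n * (24 * (real n + 1)) * (1 / 2 ^ (2 * \<kappa>))" by (simp add: card_words)
  also have "\<dots> \<le> 2 ^ (2 * w + 4) * (1 / 2 ^ (2 * \<kappa>))"
  proof (intro mult_right_mono)
    \<comment> \<open>The sum over the 2^n points costs another factor 2^n; since n < w, it is
      covered by the summand \<open>w\<close> in the exponent.\<close>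
    have "Suc n \<le> 2 ^ n" by (simp add: Suc_leI)
    then have "real (Suc n) \<le> real (2 ^ n)" by (rule of_nat_mono)
    then have "24 * (real n + 1) \<le> 2 ^ 5 * 2 ^ n" by simp
    then have "2 ^ n * (24 * (real n + 1)) \<le> 2 ^ n * (2 ^ 5 * 2 ^ n)"
      by (rule mult_left_mono) simp
    also have "\<dots> = 2 ^ (n + (5 + n))" by (simp only: power_add)
    also have "\<dots> \<le> 2 ^ (2 * w + 4)" using assms(1) by (intro power_increasing) auto
    finally show "2 ^ n * (24 * (real n + 1)) \<le> (2::real) ^ (2 * w + 4)" .
  qed auto
  also have "\<dots> \<le> 2 ^ (2 * w + 4) * real (l + 1) * (1 / 2 ^ (2 * \<kappa>))"
    by (intro mult_right_mono) auto
  also have "\<dots> \<le> \<epsilon>" by (rule error_le)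
  finally show ?thesis .
qed

end

theorem generator_fools:
  assumes "0 < \<epsilon>"
  shows "fools \<epsilon> (seed_length \<epsilon> n w l) n (generator \<epsilon> n w l) (robp_class w n l)"
  unfolding fools_def
proof
  fix f assume "f \<in> robp_class w n l"
  then obtain B where f: "f = robp_output n B" and B: "is_robp w n B" "card {i \<in> {1..n}. colliding B i} \<le> l"
    by (auto simp: robp_class_def)
  show "\<bar>measure_pmf.expectation (uniform n) f
      - measure_pmf.expectation (uniform (seed_length \<epsilon> n w l)) (\<lambda>y. f (generator \<epsilon> n w l y))\<bar> \<le> \<epsilon>"
  proof (cases "n = 0")
    case True
    then have "generator \<epsilon> n w l y = []" for y using length_generator[of \<epsilon> n w l y] by simp
    then show ?thesis
      using assms True
      by (simp add: expectation_uniform words_0 avg_def[of "{_}"] avg_const finite_words words_nonempty)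
  next
    case False
    then have n: "1 \<le> n" by simp
    define v :: "nat \<Rightarrow> real" where "v = (\<lambda>u. if u \<in> accepting B then -1 else 1)"
    let ?gb = "gen_bits (block_size n w) (levels n) (num_copies \<epsilon> n w l) n"
    have fv: "f (map sign z) = v (run (program B n) z (start B))" if "length z = n" for z
      using run_program[of n z B] that by (simp add: f robp_output_def v_def)
    have lg: "length (?gb y) = n" for y
      using levels_props(2)[OF assms n] by (simp add: length_gen_bits)
    have e1: "measure_pmf.expectation (uniform n) f = val (program B n) v (start B)"
      unfolding expectation_uniform val_eq_avg length_program
      by (rule avg_cong) (simp add: fv words_def)
    have e2: "measure_pmf.expectation (uniform (seed_length \<epsilon> n w l)) (\<lambda>y. f (generator \<epsilon> n w l y))
        = avg (words (seed_length \<epsilon> n w l)) (\<lambda>y. v (run (program B n) (?gb y) (start B)))"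
      unfolding expectation_uniform
      by (rule avg_cong) (simp add: generator_def o_def fv lg)
    \<comment> \<open>The edge leaving the start vertex makes layer 2 nonempty.\<close>
    have w: "1 \<le> w"
    proof -
      have "2 \<in> {2..n + 1}" "1 \<in> {1..n}" using n by auto
      then have "finite (layer B 2)" "card (layer B 2) \<le> w" "edge B 1 1 (start B) \<in> layer B (1 + 1)"
        using B(1) unfolding is_robp_def by blast+
      then show ?thesis by (cases w) (auto simp: numeral_2_eq_2)
    qed
    show ?thesis
    proof (cases "w \<le> n")
      case True
      show ?thesis unfolding e1 e2
        using fools_narrow[OF assms n B w True] by (simp add: v_def abs_minus_commute)
    next
      case False
      show ?thesis unfolding e1 e2 val_eq_avg length_program
        using fools_wide[OF assms n, of w "\<lambda>z. v (run (program B n) z (start B))" l] False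
        by (simp add: v_def abs_minus_commute)
    qed
  qed
qed

section \<open>A while language for Turing machines\<close>

text \<open>
  An action lists only the work tapes it changes: \<open>(j, s, d)\<close> writes \<open>s\<close> on tape \<open>j\<close> and moves its
  head in direction \<open>d\<close>.
\<close>

type_synonym action = "in_symbol \<Rightarrow> nat list \<Rightarrow> direction \<times> (nat \<times> nat \<times> direction) list \<times> int option"
type_synonym test = "in_symbol \<Rightarrow> nat list \<Rightarrow> bool"

datatype prog = Act action | Seq prog prog (infixr ";;" 60) | While test prog | When test prog

primrec prog_size :: "prog \<Rightarrow> nat" where
  "prog_size (Act f) = 1"
| "prog_size (p ;; p') = prog_size p + prog_size p'"
| "prog_size (While b p) = Suc (prog_size p)"
| "prog_size (When b p) = Suc (prog_size p)"

lemma prog_size_pos [simp]: "0 < prog_size p"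
  by (induction p) auto

definition idle :: "nat list \<Rightarrow> (nat \<times> direction) list" where
  "idle u = map (\<lambda>s. (s, Stay)) u"

definition expand :: "action \<Rightarrow> in_symbol \<Rightarrow> nat list \<Rightarrow> direction \<times> (nat \<times> direction) list \<times> int option" where
  "expand f a u = (case f a u of (d, ch, out) \<Rightarrow> (d, fold (\<lambda>(j, x) r. r[j := x]) ch (idle u), out))"

text \<open>The code of a program occupies the states from \<open>e\<close> on and leaves towards state \<open>x\<close>.\<close>

primrec code :: "prog \<Rightarrow> nat \<Rightarrow> nat \<Rightarrow> nat \<Rightarrow> in_symbol \<Rightarrow> nat list \<Rightarrow>
    nat \<times> direction \<times> (nat \<times> direction) list \<times> int option" where
  "code (Act f) e x q a u = (x, expand f a u)"
| "code (p ;; p') e x q a u = (if q < e + prog_size p then code p e (e + prog_size p) q a u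
     else code p' (e + prog_size p) x q a u)"
| "code (While b p) e x q a u = (if q = e then (if b a u then Suc e else x, Stay, idle u, None)
     else code p (Suc e) e q a u)"
| "code (When b p) e x q a u = (if q = e then (if b a u then Suc e else x, Stay, idle u, None)
     else code p (Suc e) x q a u)"

definition compile :: "nat \<Rightarrow> nat \<Rightarrow> prog \<Rightarrow> machine" where
  "compile K S p = \<lparr>num_states = Suc (prog_size p), num_symbols = S, num_tapes = K,
     halt_state = prog_size p,
     trans = (\<lambda>q a u. if q < prog_size p then code p 0 (prog_size p) q a u else (q, Stay, idle u, None))\<rparr>"

definition valid_action :: "nat \<Rightarrow> nat \<Rightarrow> action \<Rightarrow> bool" where
  "valid_action K S f \<longleftrightarrow> (\<forall>a u. length u = K \<and> set u \<subseteq> {..<S} \<longrightarrow>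
     (case f a u of (d, ch, out) \<Rightarrow> (\<forall>(j, s, d')\<in>set ch. s < S) \<and> out \<in> {None, Some 1, Some (-1)}))"

primrec valid_prog :: "nat \<Rightarrow> nat \<Rightarrow> prog \<Rightarrow> bool" where
  "valid_prog K S (Act f) \<longleftrightarrow> valid_action K S f"
| "valid_prog K S (p ;; p') \<longleftrightarrow> valid_prog K S p \<and> valid_prog K S p'"
| "valid_prog K S (While b p) \<longleftrightarrow> valid_prog K S p"
| "valid_prog K S (When b p) \<longleftrightarrow> valid_prog K S p"

section \<open>Compiled programs are machines\<close>

lemma length_fold_update [simp]: "length (fold (\<lambda>(j, x) r. r[j := x]) ch r) = length r"
  by (induction ch arbitrary: r) auto

lemma set_fold_update: "fst ` set (fold (\<lambda>(j, x) r. r[j := x]) ch r)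
    \<subseteq> fst ` set r \<union> (\<lambda>(j, s, d). s) ` set ch"
proof (induction ch arbitrary: r)
  case (Cons c ch)
  obtain j s d where c: "c = (j, s, d)" by (cases c)
  have "fst ` set (r[j := (s, d)]) \<subseteq> insert s (fst ` set r)"
    using set_update_subset_insert[of r j "(s, d)"] by auto
  moreover have "fst ` set (fold (\<lambda>(j, x) r. r[j := x]) (c # ch) r)
      \<subseteq> fst ` set (r[j := (s, d)]) \<union> (\<lambda>(j, s, d). s) ` set ch"
    using Cons[of "r[j := (s, d)]"] by (simp add: c)
  ultimately show ?case unfolding c list.set(2) image_insert prod.case by blast
qed simp

lemma code_valid:
  assumes "valid_prog K S p" "e \<le> q" "q < e + prog_size p" "length u = K" "set u \<subseteq> {..<S}"
  shows "case code p e x q a u of (q', d, acts, out) \<Rightarrow>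
    (q' = x \<or> q' < e + prog_size p) \<and> length acts = K \<and> fst ` set acts \<subseteq> {..<S} \<and>
    out \<in> {None, Some 1, Some (-1)}"
  using assms(1-3)
proof (induction p arbitrary: e x)
  case (Act f)
  obtain d ch out where f: "f a u = (d, ch, out)" by (cases "f a u")
  have "(\<lambda>(j, s, d). s) ` set ch \<subseteq> {..<S}" "out \<in> {None, Some 1, Some (-1)}"
  proof -
    have "case f a u of (d, ch, out) \<Rightarrow> (\<forall>(j, s, d')\<in>set ch. s < S) \<and> out \<in> {None, Some 1, Some (-1)}"
      by (rule Act(1)[unfolded valid_prog.simps valid_action_def, THEN spec, THEN spec, THEN mp])
        (use assms(4,5) in simp)
    then show "(\<lambda>(j, s, d). s) ` set ch \<subseteq> {..<S}" "out \<in> {None, Some 1, Some (-1)}"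
      unfolding f by auto
  qed
  moreover have "fst ` set (idle u) \<subseteq> {..<S}" using assms(5) by (auto simp: idle_def)
  ultimately have "fst ` set (fold (\<lambda>(j, x) r. r[j := x]) ch (idle u)) \<subseteq> {..<S}"
    using set_fold_update[of ch "idle u"] by blast
  then show ?case
    using \<open>out \<in> _\<close> assms(4) by (simp add: f expand_def idle_def)
next
  case (Seq p p')
  show ?case
  proof (cases "q < e + prog_size p")
    case True
    then show ?thesis using Seq.IH(1)[of e "e + prog_size p"] Seq.prems by (auto split: prod.splits)
  next
    case False
    then show ?thesis using Seq.IH(2)[of "e + prog_size p" x] Seq.prems by (auto split: prod.splits)
  qed
next
  case (While b p)
  then show ?case
    using While.IH[of "Suc e" e] assms(4,5) by (cases "q = e") (auto simp: idle_def split: prod.splits)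
next
  case (When b p)
  then show ?case
    using When.IH[of "Suc e" x] assms(4,5) by (cases "q = e") (auto simp: idle_def split: prod.splits)
qed

lemma is_machine_compile:
  assumes "valid_prog K S p" "0 < S"
  shows "is_machine (compile K S p)"
proof -
  have "case trans (compile K S p) q a u of (q', d, acts, out) \<Rightarrow>
      q' < Suc (prog_size p) \<and> length acts = K \<and> fst ` set acts \<subseteq> {..<S} \<and> out \<in> {None, Some 1, Some (-1)}"
    if "q < Suc (prog_size p)" "length u = K" "set u \<subseteq> {..<S}" for q a u
  proof (cases "q < prog_size p")
    case True
    then show ?thesis
      using code_valid[OF assms(1), of 0 q u "prog_size p" a] that by (auto simp: compile_def split: prod.splits)
  next
    case False
    then show ?thesis using that by (auto simp: compile_def idle_def)
  qed
  then show ?thesis using assms(2) unfolding is_machine_def by (simp add: compile_def)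
qed

text \<open>
  Tapes in use start with the marker 3 in cell 0. \<open>Zip l r\<close> is the tape with \<open>rev l @ r\<close> in the
  cells from 1 on, scanning the first cell of \<open>r\<close>; \<open>Home\<close> scans the marker, and \<open>Flag s\<close> is a tape
  of which only cell 0 is used.
\<close>

datatype work_tape = Zip "nat list" "nat list" | Home "nat list" | Flag nat

definition marked :: "nat list \<Rightarrow> nat \<Rightarrow> nat" where
  "marked xs c = (if c = 0 then 3 else if c \<le> length xs then xs ! (c - 1) else 0)"

fun cells :: "work_tape \<Rightarrow> nat \<Rightarrow> nat" where
  "cells (Zip l r) = marked (rev l @ r)"
| "cells (Home r) = marked r"
| "cells (Flag s) = (\<lambda>_. 0)(0 := s)"

fun pos :: "work_tape \<Rightarrow> nat" where
  "pos (Zip l r) = Suc (length l)"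
| "pos (Home r) = 0"
| "pos (Flag s) = 0"

fun extent :: "work_tape \<Rightarrow> nat" where
  "extent (Zip l r) = Suc (length l + length r)"
| "extent (Home r) = length r"
| "extent (Flag s) = 0"

fun scan :: "work_tape \<Rightarrow> nat" where
  "scan (Zip l []) = 0"
| "scan (Zip l (x # r)) = x"
| "scan (Home r) = 3"
| "scan (Flag s) = s"

text \<open>Writing a blank behind the word must not lengthen the list; otherwise rewriting the
  scanned symbol without moving would change the representation.\<close>

definition put :: "nat \<Rightarrow> nat list \<Rightarrow> nat list" where
  "put s r = (if r = [] \<and> s = 0 then [] else s # tl r)"

lemma put_simps [simp]: "put s (x # r) = s # r" "put 0 [] = []" "put (Suc n) [] = [Suc n]"
  "put (numeral k) [] = [numeral k]"
  by (simp_all add: put_def)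

fun overwrite :: "nat \<Rightarrow> direction \<Rightarrow> work_tape \<Rightarrow> work_tape" where
  "overwrite s Stay (Zip l r) = Zip l (put s r)"
| "overwrite s Go_Right (Zip l r) = Zip (s # l) (tl r)"
| "overwrite s Go_Left (Zip [] r) = Home (put s r)"
| "overwrite s Go_Left (Zip (y # l) r) = Zip l (y # put s r)"
| "overwrite s Go_Right (Home r) = Zip [] r"
| "overwrite s _ (Home r) = Home r"
| "overwrite s Go_Right (Flag s') = Zip [] []"
| "overwrite s _ (Flag s') = Flag s"

text \<open>The writes that keep a tape in one of the three shapes: the marker is only replaced by
  itself, and a \<open>Flag\<close> may be left to the right only by writing the marker, which is
  how marked tapes come into being.\<close>

fun writable :: "nat \<Rightarrow> direction \<Rightarrow> work_tape \<Rightarrow> bool" where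
  "writable s d (Zip l r) \<longleftrightarrow> True"
| "writable s d (Home r) \<longleftrightarrow> s = 3"
| "writable s d (Flag s') \<longleftrightarrow> d = Go_Right \<longrightarrow> s = 3"

section \<open>Abstract tapes and input heads describe cells and head positions\<close>

lemma marked_put: "marked (xs @ put s r) = (marked (xs @ r))(Suc (length xs) := s)"
  by (cases r) (auto simp: marked_def put_def fun_eq_iff nth_append nth_Cons split: nat.splits)

lemma marked_snoc: "marked (xs @ s # tl r) = (marked (xs @ r))(Suc (length xs) := s)"
  by (cases r) (auto simp: marked_def fun_eq_iff nth_append nth_Cons split: nat.splits)

lemma marked_put_Cons: "marked (rev l @ y # put s r) = (marked (rev l @ y # r))(Suc (Suc (length l)) := s)"
  using marked_put[of "rev l @ [y]" s r] by simp

lemma marked_zero: "(marked r)(0 := 3) = marked r"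
  by (auto simp: marked_def)

lemma marked_Nil: "marked [] = (\<lambda>_. 0)(0 := 3)"
  by (auto simp: marked_def)

lemma cells_scan: "cells t (pos t) = scan t"
  by (cases t rule: scan.cases) (auto simp: marked_def nth_append)

lemma cells_overwrite: "writable s d t \<Longrightarrow> cells (overwrite s d t) = (cells t)(pos t := s)"
  by (cases "(s, d, t)" rule: overwrite.cases)
    (auto simp: marked_put marked_snoc marked_put_Cons marked_put[of "[]", simplified] marked_zero marked_Nil)

lemma pos_overwrite: "writable s d t \<Longrightarrow> pos (overwrite s d t) = shift d (pos t)"
  by (cases "(s, d, t)" rule: overwrite.cases) auto

lemma pos_le_extent: "pos t \<le> extent t"
  by (cases t) auto

lemma overwrite_scan [simp]: "overwrite (scan t) Stay t = t" "writable (scan t) Stay t"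
  by (cases t rule: scan.cases; simp)+

text \<open>The input head with the part of the word to its left (reversed) and the part from it on.\<close>

datatype input = At_Left "in_symbol list" | In "in_symbol list" "in_symbol list"

fun word :: "input \<Rightarrow> in_symbol list" where
  "word (At_Left r) = r"
| "word (In l r) = rev l @ r"

fun input_pos :: "input \<Rightarrow> nat" where
  "input_pos (At_Left r) = 0"
| "input_pos (In l r) = Suc (length l)"

fun peek :: "input \<Rightarrow> in_symbol" where
  "peek (At_Left r) = Left_End"
| "peek (In l []) = Right_End"
| "peek (In l (a # r)) = a"

fun move :: "direction \<Rightarrow> input \<Rightarrow> input" where
  "move Stay i = i"
| "move Go_Right (At_Left r) = In [] r"
| "move Go_Right (In l []) = In l []"
| "move Go_Right (In l (a # r)) = In (a # l) r"
| "move Go_Left (At_Left r) = At_Left r"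
| "move Go_Left (In [] r) = At_Left r"
| "move Go_Left (In (a # l) r) = In l (a # r)"

lemma in_cell_peek: "in_cell (word i) (input_pos i) = peek i"
  by (cases i rule: peek.cases) (auto simp: in_cell_def nth_append)

lemma word_move: "word (move d i) = word i"
  by (cases "(d, i)" rule: move.cases) auto

lemma input_pos_move: "input_pos (move d i) = min (shift d (input_pos i)) (length (word i) + 1)"
proof (cases "(d, i)" rule: move.cases)
  case 1
  then show ?thesis by (cases i) auto
qed auto

section \<open>Terminating executions within a space bound\<close>

type_synonym situation = "input \<times> work_tape list \<times> int list"

text \<open>The used part of the tape is bounded instead of the head position. This is stronger by
  \<open>pos_le_extent\<close> and is not affected by moves inside the word.\<close>

definition fits :: "nat \<Rightarrow> work_tape list \<Rightarrow> bool" where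
  "fits s ts \<longleftrightarrow> (\<forall>t\<in>set ts. extent t < s)"

definition changed :: "(nat \<times> nat \<times> direction) list \<Rightarrow> work_tape list \<Rightarrow> work_tape list" where
  "changed ch ts = fold (\<lambda>(j, s, d) r. r[j := overwrite s d (ts ! j)]) ch ts"

definition emit :: "int option \<Rightarrow> int list" where
  "emit out = (case out of None \<Rightarrow> [] | Some b \<Rightarrow> [b])"

text \<open>A big-step semantics whose derivations carry the space bound: \<open>fits\<close> is
  demanded around every machine step, tests included. A derivation therefore gives termination and
  the bound on all intermediate head positions at once.\<close>

inductive exec :: "nat \<Rightarrow> prog \<Rightarrow> situation \<Rightarrow> situation \<Rightarrow> bool" for s where
  exec_Act: "f (peek i) (map scan ts) = (d, ch, out) \<Longrightarrow>
    \<forall>(j, x, d')\<in>set ch. j < length ts \<and> writable x d' (ts ! j) \<Longrightarrow>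
    fits s ts \<Longrightarrow> fits s (changed ch ts) \<Longrightarrow>
    exec s (Act f) (i, ts, w) (move d i, changed ch ts, w @ emit out)"
| exec_Seq: "exec s p c c' \<Longrightarrow> exec s p' c' c'' \<Longrightarrow> exec s (p ;; p') c c''"
| exec_While_False: "\<not> b (peek i) (map scan ts) \<Longrightarrow> fits s ts \<Longrightarrow>
    exec s (While b p) (i, ts, w) (i, ts, w)"
| exec_While_True: "b (peek i) (map scan ts) \<Longrightarrow> fits s ts \<Longrightarrow> exec s p (i, ts, w) c' \<Longrightarrow>
    exec s (While b p) c' c'' \<Longrightarrow> exec s (While b p) (i, ts, w) c''"
| exec_When_False: "\<not> b (peek i) (map scan ts) \<Longrightarrow> fits s ts \<Longrightarrow>
    exec s (When b p) (i, ts, w) (i, ts, w)"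
| exec_When_True: "b (peek i) (map scan ts) \<Longrightarrow> fits s ts \<Longrightarrow> exec s p (i, ts, w) c' \<Longrightarrow>
    exec s (When b p) (i, ts, w) c'"

fun configuration :: "nat \<Rightarrow> situation \<Rightarrow> config" where
  "configuration q (i, ts, w) = \<lparr>state = q, in_pos = input_pos i,
     tape = (\<lambda>j. if j < length ts then cells (ts ! j) else (\<lambda>_. 0)),
     head = (\<lambda>j. if j < length ts then pos (ts ! j) else 0), written = w\<rparr>"

definition reach :: "machine \<Rightarrow> in_symbol list \<Rightarrow> nat \<Rightarrow> config \<Rightarrow> config \<Rightarrow> bool" where
  "reach M inp s c c' \<longleftrightarrow> (\<exists>t. (step M inp ^^ t) c = c' \<and>
     (\<forall>t'\<le>t. \<forall>j<num_tapes M. head ((step M inp ^^ t') c) j < s))"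

lemma reach_trans: "reach M inp s c c' \<Longrightarrow> reach M inp s c' c'' \<Longrightarrow> reach M inp s c c''"
proof -
  assume "reach M inp s c c'" "reach M inp s c' c''"
  then obtain t t' where t: "(step M inp ^^ t) c = c'"
      "\<And>u j. u \<le> t \<Longrightarrow> j < num_tapes M \<Longrightarrow> head ((step M inp ^^ u) c) j < s"
    and t': "(step M inp ^^ t') c' = c''"
      "\<And>u j. u \<le> t' \<Longrightarrow> j < num_tapes M \<Longrightarrow> head ((step M inp ^^ u) c') j < s"
    unfolding reach_def by metis
  have add: "(step M inp ^^ (u + t)) c = (step M inp ^^ u) c'" for u
    using t(1) by (simp add: funpow_add)
  have "head ((step M inp ^^ u) c) j < s" if "u \<le> t' + t" "j < num_tapes M" for u j
  proof (cases "u \<le> t")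
    case False
    then have "u = (u - t) + t" by simp
    then show ?thesis using add[of "u - t"] t'(2)[of "u - t" j] that by auto
  qed (use t(2) that in auto)
  then show ?thesis unfolding reach_def using add[of t'] t'(1) by blast
qed

lemma fits_head: "fits s ts \<Longrightarrow> j < length ts \<Longrightarrow> head (configuration q (i, ts, w)) j < s"
  using pos_le_extent[of "ts ! j"] by (auto simp: fits_def le_less_trans)

lemma length_changed [simp]: "length (changed ch ts) = length ts"
proof -
  have "length (fold (\<lambda>(j, s, d) r. r[j := overwrite s d (ts ! j)]) ch r) = length r" for r
    by (induction ch arbitrary: r) auto
  then show ?thesis by (simp add: changed_def)
qed

text \<open>Both folds refer to the original tapes, so that for a repeated index the last entry wins
  on either side.\<close>

lemma expand_changed:
  assumes "\<forall>(j, x, d')\<in>set ch. j < length ts \<and> writable x d' (ts ! j)"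
  defines "acts \<equiv> fold (\<lambda>(j, x) r. r[j := x]) ch (idle (map scan ts))"
  shows "length acts = length ts"
    "j < length ts \<Longrightarrow> writable (fst (acts ! j)) (snd (acts ! j)) (ts ! j) \<and>
      changed ch ts ! j = overwrite (fst (acts ! j)) (snd (acts ! j)) (ts ! j)"
proof -
  show "length acts = length ts" by (simp add: acts_def idle_def)
  have "\<forall>j<length ts. writable (fst (fold (\<lambda>(j, x) r. r[j := x]) ch as ! j))
        (snd (fold (\<lambda>(j, x) r. r[j := x]) ch as ! j)) (ts ! j) \<and>
      fold (\<lambda>(j, s, d) r. r[j := overwrite s d (ts ! j)]) ch ts' ! j
      = overwrite (fst (fold (\<lambda>(j, x) r. r[j := x]) ch as ! j)) (snd (fold (\<lambda>(j, x) r. r[j := x]) ch as ! j)) (ts ! j)"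
    if "length as = length ts" "length ts' = length ts"
      "\<forall>j<length ts. writable (fst (as ! j)) (snd (as ! j)) (ts ! j) \<and> ts' ! j = overwrite (fst (as ! j)) (snd (as ! j)) (ts ! j)"
    for as ts'
    using that assms(1)
  proof (induction ch arbitrary: as ts')
    case (Cons c ch)
    obtain j0 s d where c: "c = (j0, s, d)" by (cases c)
    have "\<forall>j<length ts. writable (fst (as[j0 := (s, d)] ! j)) (snd (as[j0 := (s, d)] ! j)) (ts ! j) \<and>
        ts'[j0 := overwrite s d (ts ! j0)] ! j = overwrite (fst (as[j0 := (s, d)] ! j)) (snd (as[j0 := (s, d)] ! j)) (ts ! j)"
      using Cons.prems by (auto simp: c nth_list_update)
    then show ?case
      using Cons.IH[of "as[j0 := (s, d)]" "ts'[j0 := overwrite s d (ts ! j0)]"] Cons.prems by (simp add: c)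
  qed simp
  from this[of "idle (map scan ts)" ts]
  show "j < length ts \<Longrightarrow> writable (fst (acts ! j)) (snd (acts ! j)) (ts ! j) \<and>
      changed ch ts ! j = overwrite (fst (acts ! j)) (snd (acts ! j)) (ts ! j)"
    by (simp add: acts_def changed_def idle_def)
qed

lemma step_configuration:
  assumes M: "num_tapes M = length ts" "q \<noteq> halt_state M" "word i = inp"
    and tr: "trans M q (peek i) (map scan ts) = (q', d, acts, out)"
    and acts: "length acts = length ts" "length ts' = length ts"
      "\<And>j. j < length ts \<Longrightarrow> writable (fst (acts ! j)) (snd (acts ! j)) (ts ! j) \<and>
        ts' ! j = overwrite (fst (acts ! j)) (snd (acts ! j)) (ts ! j)"
  shows "step M inp (configuration q (i, ts, w)) = configuration q' (move d i, ts', w @ emit out)"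
proof -
  have s: "map (\<lambda>j. tape (configuration q (i, ts, w)) j (head (configuration q (i, ts, w)) j)) [0..<num_tapes M]
      = map scan ts"
    using M(1) by (auto simp: cells_scan intro!: nth_equalityI)
  have p: "in_cell inp (in_pos (configuration q (i, ts, w))) = peek i"
    using in_cell_peek[of i] M(3) by simp
  show ?thesis
    unfolding step_def s p
    using M tr acts by (simp add: input_pos_move emit_def fun_eq_iff cells_overwrite pos_overwrite)
qed

lemma reach_configuration:
  assumes "fits s ts" "fits s ts'" "num_tapes M = length ts" "q \<noteq> halt_state M" "word i = inp"
    "trans M q (peek i) (map scan ts) = (q', d, acts, out)" "length acts = length ts" "length ts' = length ts"
    "\<And>j. j < length ts \<Longrightarrow> writable (fst (acts ! j)) (snd (acts ! j)) (ts ! j) \<and>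
      ts' ! j = overwrite (fst (acts ! j)) (snd (acts ! j)) (ts ! j)"
  shows "reach M inp s (configuration q (i, ts, w)) (configuration q' (move d i, ts', w @ emit out))"
  unfolding reach_def
  using step_configuration[OF assms(3-9), of w] fits_head[OF assms(1)] fits_head[OF assms(2)] assms(3,8)
  by (intro exI[of _ 1]) (auto simp: le_Suc_eq simp del: configuration.simps)

lemma reach_test:
  assumes "fits s ts" "num_tapes M = length ts" "q \<noteq> halt_state M" "word i = inp"
    "trans M q (peek i) (map scan ts) = (q', Stay, idle (map scan ts), None)"
  shows "reach M inp s (configuration q (i, ts, w)) (configuration q' (i, ts, w))"
  using reach_configuration[OF assms(1,1-5), of w] by (simp add: idle_def emit_def)

text \<open>The machine is only required to follow \<open>code\<close> on the states of
  \<open>p\<close>. The statement thus applies to a program embedded in a larger one, and to the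
  body of a loop, whose exit is the state of the test.\<close>

theorem exec_reach:
  assumes "exec s p c c'" "num_tapes M = length (fst (snd c))" "word (fst c) = inp"
    "\<And>q a u. e \<le> q \<Longrightarrow> q < e + prog_size p \<Longrightarrow> trans M q a u = code p e x q a u"
    "e + prog_size p \<le> halt_state M"
  shows "reach M inp s (configuration e c) (configuration x c') \<and>
    length (fst (snd c')) = length (fst (snd c)) \<and> word (fst c') = word (fst c)"
  using assms
proof (induction arbitrary: e x rule: exec.induct)
  case (exec_Act f i ts d ch out w)
  have "reach M inp s (configuration e (i, ts, w)) (configuration x (move d i, changed ch ts, w @ emit out))"
    by (rule reach_configuration[OF exec_Act.hyps(3,4) _ _ _ _ expand_changed(1)[OF exec_Act.hyps(2)] _
          expand_changed(2)[OF exec_Act.hyps(2)]])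
      (use exec_Act.prems exec_Act.hyps(1) in \<open>auto simp: expand_def\<close>)
  then show ?case by (simp add: word_move)
next
  case (exec_Seq p c c' p' c'')
  have A: "reach M inp s (configuration e c) (configuration (e + prog_size p) c') \<and>
      length (fst (snd c')) = length (fst (snd c)) \<and> word (fst c') = word (fst c)"
    using exec_Seq.prems by (intro exec_Seq.IH(1)) auto
  moreover have "reach M inp s (configuration (e + prog_size p) c') (configuration x c'') \<and>
      length (fst (snd c'')) = length (fst (snd c')) \<and> word (fst c'') = word (fst c')"
    using exec_Seq.prems A by (intro exec_Seq.IH(2)) auto
  ultimately show ?case using reach_trans by metis
next
  case (exec_While_True b i ts p w c' c'')
  have "reach M inp s (configuration e (i, ts, w)) (configuration (Suc e) (i, ts, w))"
    by (rule reach_test) (use exec_While_True in auto)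
  moreover have A: "reach M inp s (configuration (Suc e) (i, ts, w)) (configuration e c') \<and>
      length (fst (snd c')) = length (fst (snd (i, ts, w))) \<and> word (fst c') = word (fst (i, ts, w))"
    using exec_While_True.prems by (intro exec_While_True.IH(1)) auto
  moreover have "reach M inp s (configuration e c') (configuration x c'') \<and>
      length (fst (snd c'')) = length (fst (snd c')) \<and> word (fst c'') = word (fst c')"
    using exec_While_True.prems A by (intro exec_While_True.IH(2)) auto
  ultimately show ?case using reach_trans by metis
next
  case (exec_When_True b i ts p w c')
  have "reach M inp s (configuration e (i, ts, w)) (configuration (Suc e) (i, ts, w))"
    by (rule reach_test) (use exec_When_True in auto)
  moreover have "reach M inp s (configuration (Suc e) (i, ts, w)) (configuration x c') \<and>
      length (fst (snd c')) = length (fst (snd (i, ts, w))) \<and> word (fst c') = word (fst (i, ts, w))"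
    using exec_When_True.prems by (intro exec_When_True.IH) auto
  ultimately show ?case using reach_trans by metis
qed (auto intro!: reach_test simp del: configuration.simps)

theorem exec_computes:
  assumes "exec s p (At_Left inp, replicate K (Flag 0), []) (i, ts, out)"
  shows "computes_in_space (compile K S p) inp out s"
proof -
  let ?M = "compile K S p"
  have M: "halt_state ?M = prog_size p" "num_tapes ?M = K"
    "\<And>q a u. q < prog_size p \<Longrightarrow> trans ?M q a u = code p 0 (prog_size p) q a u"
    by (simp_all add: compile_def)
  have "reach ?M inp s (configuration 0 (At_Left inp, replicate K (Flag 0), []))
      (configuration (halt_state ?M) (i, ts, out))"
    using exec_reach[OF assms, of ?M inp 0 "prog_size p"] by (simp add: M del: configuration.simps)
  moreover have "configuration 0 (At_Left inp, replicate K (Flag 0), []) = init"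
    by (auto simp: init_def fun_eq_iff)
  ultimately obtain t where t: "(step ?M inp ^^ t) init = configuration (halt_state ?M) (i, ts, out)"
      "\<And>u j. u \<le> t \<Longrightarrow> j < num_tapes ?M \<Longrightarrow> head ((step ?M inp ^^ u) init) j < s"
    unfolding reach_def by auto
  \<comment> \<open>A halted machine no longer moves, which extends the bound from the first
    \<open>t\<close> steps to all times.\<close>
  have halt: "(step ?M inp ^^ u) (configuration (halt_state ?M) (i, ts, out)) = configuration (halt_state ?M) (i, ts, out)" for u
    by (induction u) (simp_all add: step_def)
  have "head ((step ?M inp ^^ u) init) j < s" if "j < num_tapes ?M" for u j
  proof (cases "u \<le> t")
    case False
    then have "(step ?M inp ^^ u) init = (step ?M inp ^^ (u - t)) ((step ?M inp ^^ t) init)"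
      by (metis funpow_add le_add_diff_inverse2 linorder_linear o_apply)
    then show ?thesis using t(2)[of t j] that by (simp add: t(1) halt del: configuration.simps)
  qed (use t(2) that in auto)
  then show ?thesis unfolding computes_in_space_def using t(1) by (intro conjI exI[of _ t]) auto
qed

section \<open>The machine computing the generator\<close>

text \<open>
  Work tapes: 0 holds the output counter (least significant bit first), 1 the binary length of the
  counter; 2, 3, 4 hold the current block, the shift register of the Toeplitz matrix and the hash
  value under construction; 5, 6, 7 are single cells for a carried bit, a parity and the output bit.
  Symbols 1 and 2 stand for the bits 0 and 1.
\<close>

definition bit_symbol :: "bit \<Rightarrow> nat" where
  "bit_symbol b = (if b = 0 then 1 else 2)"

definition input_symbol :: "bit \<Rightarrow> in_symbol" where
  "input_symbol b = (if b = 0 then Plus else Minus)"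

abbreviation "syms xs \<equiv> map bit_symbol xs"
abbreviation "insyms xs \<equiv> map input_symbol xs"

definition right :: "nat \<Rightarrow> prog" where
  "right j = Act (\<lambda>a u. (Stay, [(j, u ! j, Go_Right)], None))"

definition left :: "nat \<Rightarrow> prog" where
  "left j = Act (\<lambda>a u. (Stay, [(j, u ! j, Go_Left)], None))"

definition home :: "nat \<Rightarrow> prog" where
  "home j = While (\<lambda>a u. u ! j \<noteq> 3) (left j) ;; right j"

definition to_end :: "nat \<Rightarrow> prog" where
  "to_end j = While (\<lambda>a u. u ! j \<noteq> 0) (right j)"

definition increment :: "nat \<Rightarrow> prog" where
  "increment j = While (\<lambda>a u. u ! j = 2) (Act (\<lambda>a u. (Stay, [(j, 1, Go_Right)], None))) ;;
     Act (\<lambda>a u. (Stay, [(j, 2, Stay)], None)) ;; home j"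

definition read :: prog where
  "read = Act (\<lambda>a u. (Go_Right, [], None))"

definition skip :: prog where
  "skip = While (\<lambda>a u. a = Plus) read"

definition append_cell :: prog where
  "append_cell = Act (\<lambda>a u. (Stay, [(2, 1, Go_Right), (3, 1, Go_Right), (4, 1, Go_Right)], None))"

text \<open>Eight cells are one unit of \<open>block_size\<close>.\<close>

definition append_cells :: prog where
  "append_cells = append_cell ;; append_cell ;; append_cell ;; append_cell ;;
     append_cell ;; append_cell ;; append_cell ;; append_cell"

text \<open>A single pass shifts the register by one cell and forms the scalar product of the block
  with the shifted register. Cell 5 carries the bit displaced from the previous register cell, and
  cell 6 accumulates the parity. A blank under the counter head suppresses all products.\<close>

definition sweep :: prog where
  "sweep = While (\<lambda>a u. u ! 2 \<noteq> 0) (Act (\<lambda>a u. (Stay,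
     [(2, u ! 2, Go_Right), (3, u ! 5, Go_Right), (5, u ! 3, Stay),
      (6, if u ! 0 \<noteq> 0 \<and> u ! 2 = 2 \<and> u ! 5 = 2 then 3 - u ! 6 else u ! 6, Stay)], None)))"

definition feed_pair :: prog where
  "feed_pair =
     Act (\<lambda>a u. (Go_Right, [(5, if a = Minus then 2 else 1, Stay), (6, 1, Stay)], None)) ;;
     sweep ;; home 2 ;; home 3 ;;
     Act (\<lambda>a u. (Go_Right, [(4, if a = Minus then 3 - u ! 6 else u ! 6, Go_Right)], None))"

abbreviation "feed_loop \<equiv> While (\<lambda>a u. u ! 4 \<noteq> 0) feed_pair"

definition feed_block :: prog where
  "feed_block = feed_loop ;; home 4"

text \<open>Under a counter bit 1 the block is kept; under a 0, and under the blank of the first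
  level, it is replaced by its hash value.\<close>

definition select :: prog where
  "select = When (\<lambda>a u. u ! 0 \<noteq> 2) (While (\<lambda>a u. u ! 2 \<noteq> 0)
     (Act (\<lambda>a u. (Stay, [(2, u ! 4, Go_Right), (4, u ! 4, Go_Right)], None))) ;; home 2 ;; home 4)"

text \<open>Tape 4 measures out \<open>q\<close> pairs of input bits per \<open>feed_block\<close>.
  The first run fills the register, and the hash value that it writes is overwritten by the second
  run, whose register contents form the rows of the Toeplitz matrix.\<close>

definition level :: prog where
  "level = feed_block ;; feed_block ;; select"

abbreviation "level_loop \<equiv> While (\<lambda>a u. u ! 0 \<noteq> 3) (level ;; left 0)"

text \<open>
  The first level is processed with the counter head on the blank behind the counter; \<open>sweep\<close> then
  treats the block as zero.
\<close>

definition copy :: prog where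
  "copy = level_loop ;;
     Act (\<lambda>a u. (Stay, [(0, u ! 0, Go_Right), (7, if u ! 2 = 2 then 3 - u ! 7 else u ! 7, Stay)], None)) ;;
     to_end 0"

text \<open>The zeros below the lowest 1 become ones, but that 1 is not yet cleared: the symbol
  under the head tells \<open>output_loop\<close> whether the counter was positive, and
  \<open>body\<close> starts by clearing it. A counter that was zero leaves the head on a
  blank.\<close>

definition decrement :: prog where
  "decrement = While (\<lambda>a u. u ! 0 = 1) (Act (\<lambda>a u. (Stay, [(0, 2, Go_Right)], None)))"

definition rewind :: prog where
  "rewind = While (\<lambda>a u. a \<noteq> Separator) (Act (\<lambda>a u. (Go_Left, [], None))) ;; read"

definition emit_bit :: prog where
  "emit_bit = Act (\<lambda>a u. (Stay, [], Some (if u ! 7 = 2 then -1 else 1)))"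

abbreviation "copy_loop \<equiv> While (\<lambda>a u. a \<noteq> Right_End) copy"

definition body :: prog where
  "body = Act (\<lambda>a u. (Stay, [(0, 1, Stay), (7, 1, Stay)], None)) ;; to_end 0 ;; rewind ;;
     copy_loop ;; emit_bit ;; home 0 ;; decrement"

abbreviation "count_input \<equiv> While (\<lambda>a u. a = Plus) (increment 0 ;; read)"
abbreviation "count_cells \<equiv> While (\<lambda>a u. u ! 0 \<noteq> 0) (increment 1 ;; right 0)"
abbreviation "build_by_cells \<equiv> While (\<lambda>a u. u ! 1 \<noteq> 0) (append_cells ;; right 1)"
abbreviation "build_by_input \<equiv> While (\<lambda>a u. a = Plus) (When (\<lambda>a u. u ! 0 \<noteq> 0) (append_cells ;; right 0) ;; read)"

text \<open>The length of the binary counter for \<open>n\<close> is \<open>levels n\<close>, so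
  counting its cells in binary on tape 1 gives a word of length
  \<open>floorlog 2 (levels n)\<close>. Each cell of that word contributes eight cells to a block;
  then the unary \<open>w\<close> is read while the counter is traversed, which adds eight cells min
  w (\<open>levels n\<close>) times.\<close>

definition prepare :: prog where
  "prepare = Act (\<lambda>a u. (Go_Right, [(0, 3, Go_Right), (1, 3, Go_Right), (2, 3, Go_Right),
       (3, 3, Go_Right), (4, 3, Go_Right), (5, 1, Stay), (6, 1, Stay), (7, 1, Stay)], None)) ;;
     count_input ;; read ;;
     count_cells ;; home 0 ;;
     build_by_cells ;;
     build_by_input ;;
     home 0 ;; home 2 ;; home 3 ;; home 4 ;; read ;; skip ;; read ;; skip ;; read"

abbreviation "output_loop \<equiv> While (\<lambda>a u. u ! 0 = 2) body"

definition main :: prog where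
  "main = prepare ;; decrement ;; output_loop"

lemma valid_main: "valid_prog 8 4 main"
proof -
  have n: "u ! j < 4" if "set u \<subseteq> {..<4}" "length u = 8" "j < 8" for u :: "nat list" and j
    using that by (metis lessThan_iff nth_mem subsetD)
  show ?thesis
    unfolding main_def prepare_def body_def emit_bit_def rewind_def decrement_def copy_def level_def
      select_def feed_block_def feed_pair_def sweep_def append_cells_def append_cell_def skip_def
      read_def increment_def to_end_def home_def left_def right_def
    by (auto simp: valid_action_def n diff_less_Suc less_Suc_eq_le)
qed

section \<open>Executions of the elementary tape operations\<close>

lemma exec_ActI:
  assumes "f (peek i) (map scan ts) = (d, ch, out)"
    "\<forall>(j, x, d')\<in>set ch. j < length ts \<and> writable x d' (ts ! j)"
    "fits s ts" "fits s ts'" "ts' = changed ch ts" "i' = move d i" "w' = w @ emit out"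
  shows "exec s (Act f) (i, ts, w) (i', ts', w')"
  unfolding assms(6,7,5) by (rule exec_Act) (use assms in auto)

lemma fits_update: "fits s ts \<Longrightarrow> extent t < s \<Longrightarrow> fits s (ts[j := t])"
  unfolding fits_def using set_update_subset_insert by fastforce

lemma fits_nth: "fits s ts \<Longrightarrow> j < length ts \<Longrightarrow> extent (ts ! j) < s"
  by (simp add: fits_def)

lemma exec_right:
  assumes "j < length ts" "ts ! j = Zip l (x # r)" "fits s ts"
  shows "exec s (right j) (i, ts, w) (i, ts[j := Zip (x # l) r], w)"
  unfolding right_def
  by (rule exec_ActI)
    (use assms fits_nth[OF assms(3,1)] in \<open>auto simp: changed_def emit_def intro!: fits_update\<close>)

lemma exec_right_Home:
  assumes "j < length ts" "ts ! j = Home r" "fits s (ts[j := Zip [] r])" "fits s ts"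
  shows "exec s (right j) (i, ts, w) (i, ts[j := Zip [] r], w)"
  unfolding right_def
  by (rule exec_ActI) (use assms in \<open>auto simp: changed_def emit_def\<close>)

lemma exec_left:
  assumes "j < length ts" "ts ! j = Zip l r" "fits s ts"
  shows "exec s (left j) (i, ts, w)
    (i, ts[j := (case l of [] \<Rightarrow> Home r | x # l' \<Rightarrow> Zip l' (x # r))], w)"
proof -
  let ?t = "case l of [] \<Rightarrow> Home r | x # l' \<Rightarrow> Zip l' (x # r)"
  have t: "overwrite (scan (Zip l r)) Go_Left (Zip l r) = ?t" "extent ?t \<le> extent (Zip l r)"
    by (cases l; cases r; simp)+
  have "fits s (ts[j := ?t])"
    using fits_nth[OF assms(3,1)] t(2) assms(2) by (intro fits_update[OF assms(3)]) simp
  then show ?thesis unfolding left_def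
    by (intro exec_ActI[OF refl]) (use assms t in \<open>auto simp: changed_def emit_def\<close>)
qed

lemma exec_home:
  assumes "j < length ts" "ts ! j = Zip l r" "fits s ts" "3 \<notin> set l" "3 \<notin> set r"
  shows "exec s (home j) (i, ts, w) (i, ts[j := Zip [] (rev l @ r)], w)"
proof -
  have "exec s (While (\<lambda>a u. u ! j \<noteq> 3) (left j)) (i, ts, w) (i, ts[j := Home (rev l @ r)], w)"
    using assms
  proof (induction l arbitrary: r ts)
    case Nil
    have l: "exec s (left j) (i, ts, w) (i, ts[j := Home r], w)"
      using exec_left[OF Nil.prems(1-3), of i w] by simp
    have "exec s (While (\<lambda>a u. u ! j \<noteq> 3) (left j)) (i, ts[j := Home r], w) (i, ts[j := Home r], w)"
    proof (rule exec_While_False)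
      show "fits s (ts[j := Home r])"
        using Nil.prems fits_nth[OF Nil.prems(3,1)] by (intro fits_update) auto
    qed (use Nil.prems in simp)
    from exec_While_True[OF _ _ l this] show ?case
      using Nil.prems by (cases r) auto
  next
    case (Cons x l)
    have "exec s (left j) (i, ts, w) (i, ts[j := Zip l (x # r)], w)"
      using exec_left[OF Cons.prems(1-3), of i w] by simp
    moreover have "exec s (While (\<lambda>a u. u ! j \<noteq> 3) (left j)) (i, ts[j := Zip l (x # r)], w)
        (i, ts[j := Zip l (x # r), j := Home (rev l @ x # r)], w)"
      using Cons.prems fits_nth[OF Cons.prems(3,1)] by (intro Cons.IH fits_update) auto
    ultimately show ?case
      using Cons.prems exec_While_True[of "\<lambda>a u. u ! j \<noteq> 3" i ts s "left j" w]
      by (cases r) auto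
  qed
  moreover have "exec s (right j) (i, ts[j := Home (rev l @ r)], w)
      (i, ts[j := Home (rev l @ r), j := Zip [] (rev l @ r)], w)"
    using assms fits_nth[OF assms(3,1)] by (intro exec_right_Home) (auto intro!: fits_update)
  ultimately show ?thesis unfolding home_def by (auto intro: exec_Seq)
qed

lemma exec_to_end:
  assumes "j < length ts" "ts ! j = Zip l r" "fits s ts" "0 \<notin> set r"
  shows "exec s (to_end j) (i, ts, w) (i, ts[j := Zip (rev r @ l) []], w)"
  using assms unfolding to_end_def
proof (induction r arbitrary: l ts)
  case Nil
  have "ts[j := Zip l []] = ts" using Nil.prems by (metis list_update_id)
  then show ?case using Nil.prems by (auto intro!: exec_While_False)
next
  case (Cons x r)
  have "exec s (While (\<lambda>a u. u ! j \<noteq> 0) (right j)) (i, ts[j := Zip (x # l) r], w)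
      (i, ts[j := Zip (x # l) r, j := Zip (rev r @ x # l) []], w)"
    using Cons.prems fits_nth[OF Cons.prems(3,1)] by (intro Cons.IH fits_update) auto
  from exec_While_True[OF _ _ exec_right[OF Cons.prems(1-3), of i w] this] show ?case
    using Cons.prems by auto
qed

lemma bit_symbol_simps [simp]: "bit_symbol b \<noteq> 0" "bit_symbol b \<noteq> 3" "0 \<noteq> bit_symbol b"
  "3 \<noteq> bit_symbol b" "bit_symbol 0 = 1" "bit_symbol 1 = 2" "bit_symbol b = 2 \<longleftrightarrow> b = 1"
  "bit_symbol b = 1 \<longleftrightarrow> b = 0" "bit_symbol b = Suc 0 \<longleftrightarrow> b = 0"
  by (cases b; simp add: bit_symbol_def)+

lemma set_syms [simp]: "0 \<notin> set (syms xs)" "3 \<notin> set (syms xs)"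
  by auto

section \<open>Incrementing a binary counter\<close>

fun inc :: "bit list \<Rightarrow> bit list" where
  "inc [] = [1]"
| "inc (b # bs) = (if b = 1 then 0 # inc bs else 1 # bs)"

lemma length_inc: "length bs \<le> length (inc bs)"
  by (induction bs) auto

lemma exec_increment:
  assumes "j < length ts" "ts ! j = Zip [] (syms bs)" "fits s ts" "Suc (length (inc bs)) < s"
  shows "exec s (increment j) (i, ts, w) (i, ts[j := Zip [] (syms (inc bs))], w)"
proof -
  let ?W = "While (\<lambda>a u. u ! j = 2) (Act (\<lambda>a u. (Stay, [(j, 1, Go_Right)], None)))"
  let ?A = "Act (\<lambda>a u. (Stay, [(j, 2, Stay)], None))"
  have "\<exists>l' r' t'. exec s ?W (i, ts, w) (i, t', w) \<and> exec s ?A (i, t', w) (i, ts[j := Zip l' r'], w) \<and>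
      rev l' @ r' = rev l @ syms (inc bs) \<and> 3 \<notin> set l' \<and> 3 \<notin> set r'"
    if "ts ! j = Zip l (syms bs)" "j < length ts" "fits s ts" "3 \<notin> set l" "Suc (length l + length (inc bs)) < s" for l bs ts
    using that
  proof (induction bs arbitrary: l ts)
    case Nil
    have "exec s ?W (i, ts, w) (i, ts, w)" using Nil by (intro exec_While_False) auto
    moreover have "exec s ?A (i, ts, w) (i, ts[j := Zip l [2]], w)"
      by (rule exec_ActI) (use Nil in \<open>auto simp: changed_def emit_def intro!: fits_update\<close>)
    ultimately show ?case using Nil by (intro exI[of _ l] exI[of _ "[2]"] exI[of _ ts]) auto
  next
    case (Cons b bs)
    show ?case
    proof (cases "b = 1")
      case True
      let ?t = "ts[j := Zip (1 # l) (syms bs)]"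
      have f: "fits s ?t" using Cons.prems length_inc[of bs] True by (intro fits_update) auto
      have "exec s (Act (\<lambda>a u. (Stay, [(j, 1, Go_Right)], None))) (i, ts, w) (i, ?t, w)"
        by (rule exec_ActI) (use Cons.prems f in \<open>auto simp: changed_def emit_def\<close>)
      moreover obtain l' r' t' where IH: "exec s ?W (i, ?t, w) (i, t', w)"
          "exec s ?A (i, t', w) (i, ?t[j := Zip l' r'], w)"
          "rev l' @ r' = rev (1 # l) @ syms (inc bs)" "3 \<notin> set l'" "3 \<notin> set r'"
        using Cons.IH[of ?t "1 # l"] Cons.prems True f by auto
      moreover have "ts ! j = Zip l (2 # syms bs)" using Cons.prems True by simp
      ultimately have "exec s ?W (i, ts, w) (i, t', w)"
        using Cons.prems exec_While_True[of "\<lambda>a u. u ! j = 2" i ts s] by auto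
      then show ?thesis using IH True by (intro exI[of _ l'] exI[of _ r'] exI[of _ t']) auto
    next
      case False
      then have b: "b = 0" by simp
      have "exec s ?W (i, ts, w) (i, ts, w)" using Cons.prems b by (intro exec_While_False) auto
      moreover have "exec s ?A (i, ts, w) (i, ts[j := Zip l (2 # syms bs)], w)"
        by (rule exec_ActI) (use Cons.prems b in \<open>auto simp: changed_def emit_def intro!: fits_update\<close>)
      ultimately show ?thesis using Cons.prems b
        by (intro exI[of _ l] exI[of _ "2 # syms bs"] exI[of _ ts]) auto
    qed
  qed
  from this[of ts "[]" bs] assms obtain l' r' t' where e: "exec s ?W (i, ts, w) (i, t', w)"
    "exec s ?A (i, t', w) (i, ts[j := Zip l' r'], w)" "rev l' @ r' = syms (inc bs)" "3 \<notin> set l'" "3 \<notin> set r'"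
    by auto
  have "length l' + length r' = length (inc bs)" using arg_cong[OF e(3), of length] by simp
  then have "exec s (home j) (i, ts[j := Zip l' r'], w) (i, ts[j := Zip l' r', j := Zip [] (rev l' @ r')], w)"
    using assms e by (intro exec_home fits_update) auto
  then show ?thesis unfolding increment_def using e by (auto intro!: exec_Seq)
qed

lemma exec_read:
  assumes "fits s ts"
  shows "exec s read (In l (a # r), ts, w) (In (a # l) r, ts, w)"
  unfolding read_def by (rule exec_ActI) (use assms in \<open>auto simp: changed_def emit_def\<close>)

lemma exec_skip:
  assumes "fits s ts" "r \<noteq> [] \<Longrightarrow> hd r \<noteq> Plus"
  shows "exec s skip (In l (replicate k Plus @ r), ts, w) (In (replicate k Plus @ l) r, ts, w)"
  unfolding skip_def
proof (induction k arbitrary: l)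
  case 0
  then show ?case using assms by (cases r) (auto intro!: exec_While_False)
next
  case (Suc k)
  have "exec s (While (\<lambda>a u. a = Plus) read) (In (Plus # l) (replicate k Plus @ r), ts, w)
      (In (replicate k Plus @ Plus # l) r, ts, w)" by (rule Suc)
  from exec_While_True[OF _ _ exec_read[OF assms(1)] this] show ?case
    using assms(1) by (auto simp: replicate_app_Cons_same)
qed

declare butlast.simps [simp del]

lemma butlast_Cons_Cons [simp]: "butlast (a # b # x) = a # butlast (b # x)" "butlast [a] = []"
  by (simp_all add: butlast.simps)

lemma image_bit_symbol [simp]: "0 \<notin> bit_symbol ` A" "3 \<notin> bit_symbol ` A"
  by auto

lemma list_update_numeral [simp]: "(x # xs)[numeral k := y] = x # xs[pred_numeral k := y]"
  by (simp add: numeral_eq_Suc)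

section \<open>Computing a Toeplitz product with a shift register\<close>

fun dot :: "bit list \<Rightarrow> bit list \<Rightarrow> bit" where
  "dot (a # x) (b # y) = a * b + dot x y"
| "dot _ _ = 0"

lemma dot_eq_sum: "length x = length y \<Longrightarrow> dot x y = (\<Sum>i<length x. x ! i * y ! i)"
proof (induction x y rule: dot.induct)
  case (1 a x b y)
  then show ?case by (simp add: sum.lessThan_Suc_shift del: sum.lessThan_Suc)
qed auto

lemma dot_zero: "dot (replicate k 0) y = 0"
proof (induction k arbitrary: y)
  case (Suc k)
  then show ?case by (cases y) simp_all
qed simp

text \<open>
  \<open>feed x R s\<close> shifts every first bit of a pair in \<open>s\<close> into the register \<open>R\<close> and returns the final
  register with the list of scalar products of \<open>x\<close> and the register, masked by the second bits.
\<close>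

fun feed :: "bit list \<Rightarrow> bit list \<Rightarrow> bit list \<Rightarrow> bit list \<times> bit list" where
  "feed x R (a # b # s) =
     (let R' = butlast (a # R); (R'', ys) = feed x R' s in (R'', (dot x R' + b) # ys))"
| "feed x R _ = (R, [])"

definition effective :: "work_tape \<Rightarrow> bit list \<Rightarrow> bit list" where
  "effective n x = (if scan n = 0 then replicate (length x) 0 else x)"

abbreviation "work n lc X R Y c p a \<equiv>
  [n, lc, X, R, Y, Flag (bit_symbol c), Flag (bit_symbol p), Flag (bit_symbol a)]"

abbreviation "regs n lc x R y c p a \<equiv>
  work n lc (Zip [] (syms x)) (Zip [] (syms R)) (Zip [] (syms y)) c p a"

lemma flip_symbol: "3 - bit_symbol p = bit_symbol (p + 1)"
  by (cases p) (simp_all add: bit_symbol_def)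

lemma exec_sweep:
  assumes "length rs = length xs" "Suc (length lx + length xs) < s" "Suc (length lr + length xs) < s"
    "extent n < s" "extent lc < s" "extent Y < s"
  shows "\<exists>c'. exec s sweep (i, work n lc (Zip lx (syms xs)) (Zip lr (syms rs)) Y c p a, w)
    (i, work n lc (Zip (rev (syms xs) @ lx) []) (Zip (rev (syms (butlast (c # rs))) @ lr) []) Y c'
      (p + dot (if scan n = 0 then replicate (length xs) 0 else xs) (butlast (c # rs))) a, w)"
  using assms
proof (induction xs arbitrary: rs lx lr c p)
  case Nil
  then show ?case unfolding sweep_def
    by (intro exI[of _ c]) (auto simp: fits_def intro!: exec_While_False)
next
  case (Cons x xs)
  then obtain r rs' where rs: "rs = r # rs'" "length rs' = length xs" by (cases rs) auto
  let ?ts = "work n lc (Zip lx (syms (x # xs))) (Zip lr (syms rs)) Y c p a"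
  let ?p = "p + (if scan n = 0 then 0 else x * c)"
  let ?ts' = "work n lc (Zip (bit_symbol x # lx) (syms xs)) (Zip (bit_symbol c # lr) (syms rs')) Y r ?p a"
  let ?f = "\<lambda>a u. (Stay, [(2, u ! 2, Go_Right), (3, u ! 5, Go_Right), (5, u ! 3, Stay),
      (6, if u ! 0 \<noteq> 0 \<and> u ! 2 = 2 \<and> u ! 5 = 2 then 3 - u ! 6 else u ! 6, Stay)], None)"
  have fits: "fits s ?ts" "fits s ?ts'" using Cons.prems rs by (auto simp: fits_def)
  have f: "?f (peek i) (map scan ?ts) = (Stay, [(2, bit_symbol x, Go_Right), (3, bit_symbol c, Go_Right),
      (5, bit_symbol r, Stay), (6, bit_symbol ?p, Stay)], None)"
    by (cases x; cases c; simp add: rs flip_symbol)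
  have "exec s (Act ?f) (i, ?ts, w) (i, ?ts', w)"
    by (rule exec_ActI, rule f) (use fits in \<open>simp_all add: changed_def emit_def rs\<close>)
  moreover obtain c' where "exec s sweep (i, ?ts', w)
      (i, work n lc (Zip (rev (syms xs) @ bit_symbol x # lx) []) (Zip (rev (syms (butlast (r # rs'))) @ bit_symbol c # lr) []) Y c'
        (?p + dot (if scan n = 0 then replicate (length xs) 0 else xs) (butlast (r # rs'))) a, w)"
    using Cons.IH[of rs' "bit_symbol x # lx" "bit_symbol c # lr" r ?p] Cons.prems rs by auto
  ultimately have "exec s sweep (i, ?ts, w)
      (i, work n lc (Zip (rev (syms xs) @ bit_symbol x # lx) []) (Zip (rev (syms (butlast (r # rs'))) @ bit_symbol c # lr) []) Y c'
        (?p + dot (if scan n = 0 then replicate (length xs) 0 else xs) (butlast (r # rs'))) a, w)"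
    unfolding sweep_def by (intro exec_While_True[OF _ fits(1)]) auto
  then show ?case by (intro exI[of _ c']) (auto simp: rs add.assoc dot_zero split: if_splits)
qed

lemma exec_feed_pair:
  assumes "length x = q" "length R = q" "Suc q < s" "extent n < s" "extent lc < s"
    "Suc (length ly + length (y0 # ry)) < s"
  shows "\<exists>c' p'. exec s feed_pair
    (In li (input_symbol a0 # input_symbol b0 # ir),
     work n lc (Zip [] (syms x)) (Zip [] (syms R)) (Zip ly (y0 # ry)) c p a, w)
    (In (input_symbol b0 # input_symbol a0 # li) ir,
     work n lc (Zip [] (syms x)) (Zip [] (syms (butlast (a0 # R))))
       (Zip (bit_symbol (dot (effective n x) (butlast (a0 # R)) + b0) # ly) ry) c' p' a, w)"
proof -
  let ?R = "butlast (a0 # R)"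
  let ?i = "In (input_symbol a0 # li) (input_symbol b0 # ir)"
  let ?X = "Zip [] (syms x)" and ?X' = "Zip (rev (syms x)) []" and ?Y = "Zip ly (y0 # ry)"
  let ?d = "dot (effective n x) ?R"
  have lR: "length ?R = q" using assms by simp
  have 1: "exec s (Act (\<lambda>a u. (Go_Right, [(5, if a = Minus then 2 else 1, Stay), (6, 1, Stay)], None)))
      (In li (input_symbol a0 # input_symbol b0 # ir), work n lc ?X (Zip [] (syms R)) ?Y c p a, w)
      (?i, work n lc ?X (Zip [] (syms R)) ?Y a0 0 a, w)"
    by (rule exec_ActI)
      (use assms in \<open>auto simp: changed_def emit_def fits_def input_symbol_def bit_symbol_def\<close>)
  obtain c' where 2: "exec s sweep (?i, work n lc ?X (Zip [] (syms R)) ?Y a0 0 a, w)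
      (?i, work n lc ?X' (Zip (rev (syms ?R)) []) ?Y c' ?d a, w)"
    using exec_sweep[of R x "[]" s "[]" n lc ?Y ?i a0 0 a w] assms by (auto simp: effective_def)
  have 3: "exec s (home 2) (?i, work n lc ?X' (Zip (rev (syms ?R)) []) ?Y c' ?d a, w)
      (?i, work n lc ?X (Zip (rev (syms ?R)) []) ?Y c' ?d a, w)"
    using exec_home[of 2 "work n lc ?X' (Zip (rev (syms ?R)) []) ?Y c' ?d a" "rev (syms x)" "[]" s ?i w]
      assms lR by (simp add: fits_def)
  have 4: "exec s (home 3) (?i, work n lc ?X (Zip (rev (syms ?R)) []) ?Y c' ?d a, w)
      (?i, work n lc ?X (Zip [] (syms ?R)) ?Y c' ?d a, w)"
    using exec_home[of 3 "work n lc ?X (Zip (rev (syms ?R)) []) ?Y c' ?d a" "rev (syms ?R)" "[]" s ?i w]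
      assms lR by (simp add: fits_def)
  let ?ts = "work n lc ?X (Zip [] (syms ?R)) ?Y c' ?d a"
  have f: "(\<lambda>a u. (Go_Right, [(4, if a = Minus then 3 - u ! 6 else u ! 6, Go_Right)], None)) (peek ?i) (map scan ?ts)
      = (Go_Right, [(4, bit_symbol (?d + b0), Go_Right)], None)"
    by (cases b0; simp add: input_symbol_def flip_symbol)
  have 5: "exec s (Act (\<lambda>a u. (Go_Right, [(4, if a = Minus then 3 - u ! 6 else u ! 6, Go_Right)], None)))
      (?i, work n lc ?X (Zip [] (syms ?R)) ?Y c' ?d a, w)
      (In (input_symbol b0 # input_symbol a0 # li) ir,
       work n lc ?X (Zip [] (syms ?R)) (Zip (bit_symbol (?d + b0) # ly) ry) c' ?d a, w)"
    by (rule exec_ActI, rule f) (use assms lR in \<open>simp_all add: changed_def emit_def fits_def\<close>)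
  show ?thesis
    unfolding feed_pair_def
    by (intro exI[of _ c'] exI[of _ ?d]) (rule exec_Seq[OF 1 exec_Seq[OF 2 exec_Seq[OF 3 exec_Seq[OF 4 5]]]])
qed

lemma feed_lengths: "length (fst (feed x R s)) = length R" "length (snd (feed x R s)) = length s div 2"
  by (induction x R s rule: feed.induct) (auto simp: Let_def split: prod.splits)

lemma exec_feed_block:
  assumes "length x = q" "length R = q" "Suc q < s" "extent n < s" "extent lc < s"
    "length y = q" "length z = 2 * q"
  shows "\<exists>c' p'. exec s feed_block
    (In li (insyms z @ ir), regs n lc x R y c p a, w)
    (In (rev (insyms z) @ li) ir,
     regs n lc x (fst (feed (effective n x) R z)) (snd (feed (effective n x) R z)) c' p' a, w)"
proof -
  let ?e = "effective n x" and ?X = "Zip [] (syms x)"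
  have "\<exists>c' p'. exec s feed_loop
      (In li (insyms z @ ir), work n lc ?X (Zip [] (syms R)) (Zip ly (syms y)) c p a, w)
      (In (rev (insyms z) @ li) ir,
       work n lc ?X (Zip [] (syms (fst (feed ?e R z))))
         (Zip (rev (syms (snd (feed ?e R z))) @ ly) []) c' p' a, w)"
    if "length z = 2 * length y" "length R = q" "Suc (length ly + length y) < s" for z y R ly li c p
    using that
  proof (induction y arbitrary: z R ly li c p)
    case Nil
    then show ?case using assms
      by (intro exI[of _ c] exI[of _ p]) (auto simp: fits_def intro!: exec_While_False)
  next
    case (Cons y0 y)
    then obtain a0 b0 z' where z: "z = a0 # b0 # z'" "length z' = 2 * length y"
      by (auto simp: length_Suc_conv)
    let ?R = "butlast (a0 # R)" and ?y = "dot ?e (butlast (a0 # R)) + b0"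
    obtain c1 p1 where 1: "exec s feed_pair
        (In li (input_symbol a0 # input_symbol b0 # insyms z' @ ir),
         work n lc ?X (Zip [] (syms R)) (Zip ly (bit_symbol y0 # syms y)) c p a, w)
        (In (input_symbol b0 # input_symbol a0 # li) (insyms z' @ ir),
         work n lc ?X (Zip [] (syms ?R)) (Zip (bit_symbol ?y # ly) (syms y)) c1 p1 a, w)"
      using exec_feed_pair[of x q R s n lc ly "bit_symbol y0" "syms y" li a0 b0 "insyms z' @ ir" c p a w]
        assms Cons.prems by auto
    obtain c2 p2 where 2: "exec s feed_loop
        (In (input_symbol b0 # input_symbol a0 # li) (insyms z' @ ir),
         work n lc ?X (Zip [] (syms ?R)) (Zip (bit_symbol ?y # ly) (syms y)) c1 p1 a, w)
        (In (rev (insyms z') @ input_symbol b0 # input_symbol a0 # li) ir,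
         work n lc ?X (Zip [] (syms (fst (feed ?e ?R z'))))
           (Zip (rev (syms (snd (feed ?e ?R z'))) @ bit_symbol ?y # ly) []) c2 p2 a, w)"
      using Cons.IH[of z' ?R "bit_symbol ?y # ly" "input_symbol b0 # input_symbol a0 # li" c1 p1]
        Cons.prems z by (auto)
    have f: "feed ?e R z = (fst (feed ?e ?R z'), ?y # snd (feed ?e ?R z'))"
      by (simp add: z Let_def split: prod.splits)
    have "exec s feed_loop
        (In li (input_symbol a0 # input_symbol b0 # insyms z' @ ir),
         work n lc ?X (Zip [] (syms R)) (Zip ly (bit_symbol y0 # syms y)) c p a, w)
        (In (rev (insyms z') @ input_symbol b0 # input_symbol a0 # li) ir,
         work n lc ?X (Zip [] (syms (fst (feed ?e ?R z'))))
           (Zip (rev (syms (snd (feed ?e ?R z'))) @ bit_symbol ?y # ly) []) c2 p2 a, w)"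
      by (rule exec_While_True[OF _ _ 1 2]) (use assms Cons.prems in \<open>auto simp: fits_def\<close>)
    then show ?case unfolding f by (intro exI[of _ c2] exI[of _ p2]) (simp add: z)
  qed
  from this[of z y R "[]" li c p] assms obtain c1 p1 where 1: "exec s feed_loop
      (In li (insyms z @ ir), work n lc ?X (Zip [] (syms R)) (Zip [] (syms y)) c p a, w)
      (In (rev (insyms z) @ li) ir,
       work n lc ?X (Zip [] (syms (fst (feed ?e R z)))) (Zip (rev (syms (snd (feed ?e R z)))) []) c1 p1 a, w)"
    by auto
  have 2: "exec s (home 4)
      (In (rev (insyms z) @ li) ir,
       work n lc ?X (Zip [] (syms (fst (feed ?e R z)))) (Zip (rev (syms (snd (feed ?e R z)))) []) c1 p1 a, w)
      (In (rev (insyms z) @ li) ir,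
       work n lc ?X (Zip [] (syms (fst (feed ?e R z)))) (Zip [] (syms (snd (feed ?e R z)))) c1 p1 a, w)"
    using exec_home[of 4 "work n lc ?X (Zip [] (syms (fst (feed ?e R z)))) (Zip (rev (syms (snd (feed ?e R z)))) []) c1 p1 a"
        "rev (syms (snd (feed ?e R z)))" "[]" s "In (rev (insyms z) @ li) ir" w] assms
    by (simp add: fits_def feed_lengths)
  show ?thesis unfolding feed_block_def
    by (intro exI[of _ c1] exI[of _ p1]) (rule exec_Seq[OF 1 2])
qed

lemma butlast_Cons_nth: "i < length R \<Longrightarrow> butlast (a # R) ! i = (a # R) ! i"
  by (simp add: nth_butlast)

text \<open>After \<open>m\<close> pairs the first bits stand in the register in reverse order, the
  latest in cell 0, and the old contents have moved up by \<open>m\<close> cells.\<close>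

lemma feed_fst:
  "length s = 2 * m \<Longrightarrow> i < length R \<Longrightarrow>
    fst (feed x R s) ! i = (if i < m then s ! (2 * (m - 1 - i)) else R ! (i - m))"
proof (induction m arbitrary: s R)
  case 0
  then show ?case by simp
next
  case (Suc m)
  then obtain a b s' where s: "s = a # b # s'" "length s' = 2 * m" by (auto simp: length_Suc_conv)
  have f: "fst (feed x R s) = fst (feed x (butlast (a # R)) s')"
    by (simp add: s Let_def split: prod.splits)
  have e: "2 * (m - i) = Suc (Suc (2 * (m - 1 - i)))" if "i < m" using that by simp
  have "0 < length R" "R \<noteq> []" using Suc.prems(2) by auto
  then show ?case unfolding f using Suc.IH[of s' "butlast (a # R)"] s(2) Suc.prems(2)
    by (auto simp: s butlast_Cons_nth e nth_Cons')
qed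

text \<open>When pair \<open>j\<close> is processed, cell \<open>i\<close> of the register holds the
  first bit of pair j - i, or old contents if there is no such pair.\<close>

lemma feed_snd:
  "length s = 2 * m \<Longrightarrow> length R = length x \<Longrightarrow> j < m \<Longrightarrow>
    snd (feed x R s) ! j = s ! (2 * j + 1) +
      (\<Sum>i<length x. (if i \<le> j then s ! (2 * (j - i)) else R ! (i - j - 1)) * x ! i)"
proof (induction m arbitrary: s R j)
  case 0
  then show ?case by simp
next
  case (Suc m)
  then obtain a b s' where s: "s = a # b # s'" "length s' = 2 * m" by (auto simp: length_Suc_conv)
  let ?R = "butlast (a # R)"
  have f: "snd (feed x R s) = (dot x ?R + b) # snd (feed x ?R s')"
    by (simp add: s Let_def split: prod.splits)
  have R: "?R ! i = (if i = 0 then a else R ! (i - 1))" if "i < length x" for i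
    using that Suc.prems(2) by (auto simp: butlast_Cons_nth nth_Cons')
  show ?case
  proof (cases j)
    case 0
    have "dot x ?R = (\<Sum>i<length x. (if i \<le> 0 then s ! (2 * (0 - i)) else R ! (i - 0 - 1)) * x ! i)"
      using Suc.prems(2) by (subst dot_eq_sum) (auto simp: R s mult.commute intro!: sum.cong)
    then show ?thesis unfolding f 0 by (simp add: s add.commute)
  next
    case (Suc j')
    have "(\<Sum>i<length x. (if i \<le> j' then s' ! (2 * (j' - i)) else ?R ! (i - j' - 1)) * x ! i)
        = (\<Sum>i<length x. (if i \<le> j then s ! (2 * (j - i)) else R ! (i - j - 1)) * x ! i)"
    proof (rule sum.cong)
      fix i assume i: "i \<in> {..<length x}"
      have "(if i \<le> j' then s' ! (2 * (j' - i)) else ?R ! (i - j' - 1))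
          = (if i \<le> j then s ! (2 * (j - i)) else R ! (i - j - 1))"
      proof (cases "i \<le> j'")
        case True
        then have "2 * (j - i) = Suc (Suc (2 * (j' - i)))" using Suc by simp
        then show ?thesis using True Suc by (simp add: s)
      next
        case False
        then show ?thesis using R[of "i - j' - 1"] i Suc by (auto simp: s)
      qed
      then show "(if i \<le> j' then s' ! (2 * (j' - i)) else ?R ! (i - j' - 1)) * x ! i
          = (if i \<le> j then s ! (2 * (j - i)) else R ! (i - j - 1)) * x ! i" by simp
    qed simp
    then show ?thesis
      unfolding f Suc using Suc.IH[OF s(2), of ?R j'] Suc.prems(2,3) Suc
      by (simp add: s)
  qed
qed

text \<open>After the first half of the word, cell \<open>i\<close> holds the first bit of pair q -
  1 - i. During pair \<open>j\<close> of the second half, cell \<open>i\<close> thus holds the first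
  bit of pair q + j - i of the whole word, whether it was read in this half or before; the initial
  register has been pushed out.\<close>

lemma feed_toeplitz:
  assumes "length x = q" "length R = q" "length s = 4 * q"
  shows "snd (feed x (fst (feed x R (take (2 * q) s))) (drop (2 * q) s)) = toeplitz q s x"
proof (rule nth_equalityI)
  let ?R = "fst (feed x R (take (2 * q) s))"
  show "length (snd (feed x ?R (drop (2 * q) s))) = length (toeplitz q s x)"
    using assms by (simp add: feed_lengths toeplitz_def)
  fix j assume "j < length (snd (feed x ?R (drop (2 * q) s)))"
  then have j: "j < q" using assms by (simp add: feed_lengths)
  have R: "?R ! i = s ! (2 * (q - 1 - i))" if "i < q" for i
    using feed_fst[of "take (2 * q) s" q i R x] assms that by simp
  have "snd (feed x ?R (drop (2 * q) s)) ! j = drop (2 * q) s ! (2 * j + 1) +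
      (\<Sum>i<q. (if i \<le> j then drop (2 * q) s ! (2 * (j - i)) else ?R ! (i - j - 1)) * x ! i)"
    using feed_snd[of "drop (2 * q) s" q ?R x j] assms j by (simp add: feed_lengths)
  also have "(\<Sum>i<q. (if i \<le> j then drop (2 * q) s ! (2 * (j - i)) else ?R ! (i - j - 1)) * x ! i)
      = (\<Sum>i<q. s ! (2 * (q + j - i)) * x ! i)"
  proof (rule sum.cong)
    fix i assume "i \<in> {..<q}"
    then have i: "i < q" by simp
    show "(if i \<le> j then drop (2 * q) s ! (2 * (j - i)) else ?R ! (i - j - 1)) * x ! i
        = s ! (2 * (q + j - i)) * x ! i"
    proof (cases "i \<le> j")
      case True
      then have "2 * q + 2 * (j - i) = 2 * (q + j - i)" by simp
      then show ?thesis using True assms j by simp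
    next
      case False
      then have "2 * (q - 1 - (i - j - 1)) = 2 * (q + j - i)" using i by simp
      then show ?thesis using False R[of "i - j - 1"] i by simp
    qed
  qed simp
  also have "drop (2 * q) s ! (2 * j + 1) = s ! (2 * (q + j) + 1)" using assms j by simp
  finally show "snd (feed x ?R (drop (2 * q) s)) ! j = toeplitz q s x ! j"
    using j by (simp add: toeplitz_def)
qed

text \<open>The situation between two levels. The register, the hash value and the two auxiliary
  cells may contain anything, since a level overwrites them before their contents can matter; only
  the lengths are fixed.\<close>

definition ready :: "nat \<Rightarrow> work_tape \<Rightarrow> work_tape \<Rightarrow> bit list \<Rightarrow> bit \<Rightarrow> work_tape list \<Rightarrow> bool" where
  "ready q n lc x a ts \<longleftrightarrow> (\<exists>R y c p. length x = q \<and> length R = q \<and> length y = q \<and>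
     ts = regs n lc x R y c p a)"

lemma ready_props:
  assumes "ready q n lc x a ts"
  shows "length ts = 8" "ts ! 0 = n" "ts ! 2 = Zip [] (syms x)" "ts ! 7 = Flag (bit_symbol a)"
    "map scan ts ! 0 = scan n" "map scan ts ! 7 = bit_symbol a" "length x = q"
    "ready q n' lc x a (ts[0 := n'])" "ready q n' lc x b (ts[0 := n', 7 := Flag (bit_symbol b)])"
    "Suc q < s \<Longrightarrow> extent n < s \<Longrightarrow> extent lc < s \<Longrightarrow> fits s ts" "ts \<noteq> []"
proof -
  obtain R y c p where len: "length x = q" "length R = q" "length y = q"
    and ts: "ts = regs n lc x R y c p a"
    using assms unfolding ready_def by blast
  show "ready q n' lc x a (ts[0 := n'])" "ready q n' lc x b (ts[0 := n', 7 := Flag (bit_symbol b)])"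
    unfolding ready_def ts by (rule exI[of _ R], rule exI[of _ y], rule exI[of _ c], rule exI[of _ p], use len in simp)+
qed (use assms in \<open>auto simp: ready_def fits_def\<close>)

lemma input_symbol_neq [simp]: "input_symbol b \<noteq> Separator" "input_symbol b \<noteq> Right_End"
  by (simp_all add: input_symbol_def)

lemma exec_select:
  assumes "scan n \<noteq> 2" "length x = q" "length y = q" "length R = q" "Suc q < s" "extent n < s" "extent lc < s"
  shows "exec s select
    (i, regs n lc x R y c p a, w)
    (i, regs n lc y R y c p a, w)"
proof -
  let ?R = "Zip [] (syms R)"
  let ?f = "\<lambda>a u. (Stay, [(2, u ! 4, Go_Right), (4, u ! 4, Go_Right)], None)"
  have "exec s (While (\<lambda>a u. u ! 2 \<noteq> 0) (Act ?f))
      (i, work n lc (Zip lx (syms x)) ?R (Zip ly (syms y)) c p a, w)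
      (i, work n lc (Zip (rev (syms y) @ lx) []) ?R (Zip (rev (syms y) @ ly) []) c p a, w)"
    if "length x = length y" "Suc (length lx + length y) < s" "Suc (length ly + length y) < s" for x y lx ly
    using that
  proof (induction x y arbitrary: lx ly rule: list_induct2)
    case Nil
    then show ?case using assms by (auto simp: fits_def intro!: exec_While_False)
  next
    case (Cons x0 x y0 y)
    have 1: "exec s (Act ?f) (i, work n lc (Zip lx (syms (x0 # x))) ?R (Zip ly (syms (y0 # y))) c p a, w)
        (i, work n lc (Zip (bit_symbol y0 # lx) (syms x)) ?R (Zip (bit_symbol y0 # ly) (syms y)) c p a, w)"
      by (rule exec_ActI) (use Cons assms in \<open>auto simp: changed_def emit_def fits_def\<close>)
    have 2: "exec s (While (\<lambda>a u. u ! 2 \<noteq> 0) (Act ?f))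
        (i, work n lc (Zip (bit_symbol y0 # lx) (syms x)) ?R (Zip (bit_symbol y0 # ly) (syms y)) c p a, w)
        (i, work n lc (Zip (rev (syms y) @ bit_symbol y0 # lx) []) ?R (Zip (rev (syms y) @ bit_symbol y0 # ly) []) c p a, w)"
      using Cons.IH[of "bit_symbol y0 # lx" "bit_symbol y0 # ly"] Cons by simp
    have "exec s (While (\<lambda>a u. u ! 2 \<noteq> 0) (Act ?f)) (i, work n lc (Zip lx (syms (x0 # x))) ?R (Zip ly (syms (y0 # y))) c p a, w)
        (i, work n lc (Zip (rev (syms y) @ bit_symbol y0 # lx) []) ?R (Zip (rev (syms y) @ bit_symbol y0 # ly) []) c p a, w)"
      by (rule exec_While_True[OF _ _ 1 2]) (use Cons assms in \<open>auto simp: fits_def\<close>)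
    then show ?case by simp
  qed
  from this[of x y "[]" "[]"] have 1: "exec s (While (\<lambda>a u. u ! 2 \<noteq> 0) (Act ?f))
      (i, work n lc (Zip [] (syms x)) ?R (Zip [] (syms y)) c p a, w)
      (i, work n lc (Zip (rev (syms y)) []) ?R (Zip (rev (syms y)) []) c p a, w)"
    using assms by simp
  have 2: "exec s (home 2) (i, work n lc (Zip (rev (syms y)) []) ?R (Zip (rev (syms y)) []) c p a, w)
      (i, work n lc (Zip [] (syms y)) ?R (Zip (rev (syms y)) []) c p a, w)"
    using exec_home[of 2 "work n lc (Zip (rev (syms y)) []) ?R (Zip (rev (syms y)) []) c p a" "rev (syms y)" "[]" s i w]
      assms by (simp add: fits_def)
  have 3: "exec s (home 4) (i, work n lc (Zip [] (syms y)) ?R (Zip (rev (syms y)) []) c p a, w)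
      (i, work n lc (Zip [] (syms y)) ?R (Zip [] (syms y)) c p a, w)"
    using exec_home[of 4 "work n lc (Zip [] (syms y)) ?R (Zip (rev (syms y)) []) c p a" "rev (syms y)" "[]" s i w]
      assms by (simp add: fits_def)
  show ?thesis unfolding select_def
    by (rule exec_When_True[OF _ _ exec_Seq[OF 1 exec_Seq[OF 2 3]]]) (use assms in \<open>auto simp: fits_def\<close>)
qed

lemma exec_level:
  assumes "ready q n lc x a ts" "Suc q < s" "extent n < s" "extent lc < s" "length z = 4 * q"
  shows "\<exists>ts'. ready q n lc (if scan n = 2 then x else toeplitz q z (effective n x)) a ts' \<and>
    exec s level (In li (insyms z @ ir), ts, w) (In (rev (insyms z) @ li) ir, ts', w)"
proof -
  obtain R y c p where len: "length x = q" "length R = q" "length y = q"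
    and ts: "ts = regs n lc x R y c p a"
    using assms(1) unfolding ready_def by blast
  let ?e = "effective n x"
  define z1 z2 where "z1 = take (2 * q) z" and "z2 = drop (2 * q) z"
  have z: "z = z1 @ z2" "length z1 = 2 * q" "length z2 = 2 * q" using assms by (auto simp: z1_def z2_def)
  define R1 y1 where "R1 = fst (feed ?e R z1)" and "y1 = snd (feed ?e R z1)"
  have l1: "length R1 = q" "length y1 = q" using len z by (simp_all add: R1_def y1_def feed_lengths)
  define R2 y2 where "R2 = fst (feed ?e R1 z2)" and "y2 = snd (feed ?e R1 z2)"
  have l2: "length R2 = q" "length y2 = q" using l1 z by (simp_all add: R2_def y2_def feed_lengths)
  have le: "length ?e = q" using len by (simp add: effective_def)
  have y2: "y2 = toeplitz q z ?e"
    unfolding y2_def R1_def z1_def z2_def by (rule feed_toeplitz[OF le len(2) assms(5)])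
  obtain c1 p1 where 1: "exec s feed_block (In li (insyms z1 @ insyms z2 @ ir), ts, w)
      (In (rev (insyms z1) @ li) (insyms z2 @ ir), regs n lc x R1 y1 c1 p1 a, w)"
    using exec_feed_block[OF len(1,2) assms(2-4) len(3) z(2)] unfolding ts R1_def y1_def by blast
  obtain c2 p2 where 2: "exec s feed_block
      (In (rev (insyms z1) @ li) (insyms z2 @ ir), regs n lc x R1 y1 c1 p1 a, w)
      (In (rev (insyms z2) @ rev (insyms z1) @ li) ir, regs n lc x R2 y2 c2 p2 a, w)"
    using exec_feed_block[OF len(1) l1(1) assms(2-4) l1(2) z(3)] unfolding R2_def y2_def by blast
  let ?i = "In (rev (insyms z2) @ rev (insyms z1) @ li) ir"
  have 3: "exec s select (?i, regs n lc x R2 y2 c2 p2 a, w)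
      (?i, regs n lc (if scan n = 2 then x else y2) R2 y2 c2 p2 a, w)"
  proof (cases "scan n = 2")
    case True
    then show ?thesis unfolding select_def
      using assms len l2 by (auto simp: fits_def intro!: exec_When_False)
  next
    case False
    then show ?thesis using exec_select[OF False len(1) l2(2,1) assms(2-4)] by simp
  qed
  have "ready q n lc (if scan n = 2 then x else y2) a
      (regs n lc (if scan n = 2 then x else y2) R2 y2 c2 p2 a)"
    unfolding ready_def using len l2 by (intro exI conjI) auto
  moreover have "exec s level (In li (insyms z @ ir), ts, w)
      (In (rev (insyms z) @ li) ir,
       regs n lc (if scan n = 2 then x else y2) R2 y2 c2 p2 a, w)"
    using exec_Seq[OF 1 exec_Seq[OF 2 3]] by (simp add: level_def z(1))
  ultimately show ?thesis unfolding y2 by blast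
qed

section \<open>Walking down the levels of a copy and summing over the copies\<close>

fun run_levels :: "nat \<Rightarrow> bit list \<Rightarrow> bit list list \<Rightarrow> bit list \<Rightarrow> bit list" where
  "run_levels q (m # ms) (h # hs) x = run_levels q ms hs (if m = 1 then x else toeplitz q h x)"
| "run_levels q _ _ x = x"

abbreviation "moved_left l r \<equiv> (case l of [] \<Rightarrow> Home r | y # l' \<Rightarrow> Zip l' (y # r))"

lemma exec_level_left:
  assumes "ready q (Zip l r) lc x a ts" "Suc q < s" "Suc (length l + length r) < s" "extent lc < s" "length z = 4 * q"
  shows "\<exists>ts'. ready q (moved_left l r) lc
      (if scan (Zip l r) = 2 then x else toeplitz q z (effective (Zip l r) x)) a ts' \<and>
    exec s (level ;; left 0) (In li (insyms z @ ir), ts, w) (In (rev (insyms z) @ li) ir, ts', w)"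
proof -
  obtain ts1 where 1: "ready q (Zip l r) lc (if scan (Zip l r) = 2 then x else toeplitz q z (effective (Zip l r) x)) a ts1"
    "exec s level (In li (insyms z @ ir), ts, w) (In (rev (insyms z) @ li) ir, ts1, w)"
    using exec_level[OF assms(1,2) _ assms(4,5), of li ir w] assms(3) by auto
  have "fits s ts1" using ready_props(10)[OF 1(1), of s] assms by auto
  then have "exec s (left 0) (In (rev (insyms z) @ li) ir, ts1, w)
      (In (rev (insyms z) @ li) ir, ts1[0 := moved_left l r], w)"
    using exec_left[of 0 ts1 l r s _ w] ready_props(1,2,11)[OF 1(1)] by simp
  then show ?thesis using exec_Seq[OF 1(2)] ready_props(8)[OF 1(1)] by blast
qed

lemma exec_levels:
  assumes "ready q (Zip (syms ms) (bit_symbol m # r)) lc x a ts" "hs \<in> seqs (words (4 * q)) (Suc (length ms))"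
    "Suc q < s" "Suc (Suc (length ms + length r)) < s" "extent lc < s"
  shows "\<exists>ts'. ready q (Home (rev (syms ms) @ bit_symbol m # r)) lc (run_levels q (m # ms) hs x) a ts' \<and>
    exec s level_loop (In li (insyms (concat hs) @ ir), ts, w) (In (rev (insyms (concat hs)) @ li) ir, ts', w)"
  using assms
proof (induction ms arbitrary: m r x ts hs li)
  case Nil
  obtain h where hs: "hs = [h]" "length h = 4 * q"
    using Nil.prems(2) by (auto simp: seqs_def words_def length_Suc_conv)
  let ?x = "if m = 1 then x else toeplitz q h x" and ?i = "In (rev (insyms h) @ li) ir"
  obtain ts1 where 1: "ready q (Home (bit_symbol m # r)) lc ?x a ts1"
    "exec s (level ;; left 0) (In li (insyms h @ ir), ts, w) (?i, ts1, w)"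
    using exec_level_left[OF Nil.prems(1,3) _ Nil.prems(5) hs(2), of li ir w] Nil.prems(4)
    by (auto simp: effective_def split: if_splits)
  have f: "fits s ts" using ready_props(10)[OF Nil.prems(1), of s] Nil.prems by auto
  have 2: "exec s level_loop (?i, ts1, w) (?i, ts1, w)"
    using ready_props(5)[OF 1(1)] ready_props(10)[OF 1(1), of s] Nil.prems by (intro exec_While_False) auto
  have "exec s level_loop (In li (insyms h @ ir), ts, w) (?i, ts1, w)"
    by (rule exec_While_True[OF _ f 1(2) 2]) (use ready_props(5)[OF Nil.prems(1)] in simp)
  then show ?case using 1(1) by (auto simp: hs)
next
  case (Cons m' ms)
  obtain h hs' where hs: "hs = h # hs'" "length h = 4 * q" "hs' \<in> seqs (words (4 * q)) (Suc (length ms))"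
    using Cons.prems(2) by (auto simp: seqs_def words_def length_Suc_conv)
  let ?x = "if m = 1 then x else toeplitz q h x" and ?i = "In (rev (insyms h) @ li) (insyms (concat hs') @ ir)"
  obtain ts1 where 1: "ready q (Zip (syms ms) (bit_symbol m' # bit_symbol m # r)) lc ?x a ts1"
    "exec s (level ;; left 0) (In li (insyms h @ insyms (concat hs') @ ir), ts, w) (?i, ts1, w)"
    using exec_level_left[OF Cons.prems(1,3) _ Cons.prems(5) hs(2), of li "insyms (concat hs') @ ir" w] Cons.prems(4)
    by (auto simp: effective_def split: if_splits)
  have f: "fits s ts" using ready_props(10)[OF Cons.prems(1), of s] Cons.prems by auto
  obtain ts' where 3: "ready q (Home (rev (syms ms) @ bit_symbol m' # bit_symbol m # r)) lc (run_levels q (m' # ms) hs' ?x) a ts'"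
    "exec s level_loop (?i, ts1, w) (In (rev (insyms (concat hs')) @ rev (insyms h) @ li) ir, ts', w)"
    using Cons.IH[OF 1(1) hs(3) Cons.prems(3) _ Cons.prems(5), of "rev (insyms h) @ li"] Cons.prems(4) by auto
  have "exec s level_loop (In li (insyms h @ insyms (concat hs') @ ir), ts, w)
      (In (rev (insyms (concat hs')) @ rev (insyms h) @ li) ir, ts', w)"
    by (rule exec_While_True[OF _ f 1(2) 3(2)]) (use ready_props(5)[OF Cons.prems(1)] in simp)
  then show ?case using 3(1) by (auto simp: hs)
qed

definition copy_bit :: "nat \<Rightarrow> bit list \<Rightarrow> bit list list \<Rightarrow> bit" where
  "copy_bit q bs hs = hd (run_levels q (rev bs) (tl hs) (toeplitz q (hd hs) (replicate q 0)))"

lemma exec_copy: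
  assumes "ready q (Zip (rev (syms bs)) []) lc x a ts" "hs \<in> seqs (words (4 * q)) (Suc (length bs))"
    "1 \<le> q" "bs \<noteq> []" "Suc q < s" "Suc (length bs) < s" "extent lc < s"
  shows "\<exists>ts' x'. ready q (Zip (rev (syms bs)) []) lc x' (a + copy_bit q bs hs) ts' \<and>
    exec s copy (In li (insyms (concat hs) @ ir), ts, w) (In (rev (insyms (concat hs)) @ li) ir, ts', w)"
proof -
  obtain m ms where bs: "rev bs = m # ms" using assms(4) by (cases "rev bs") auto
  have rs: "rev (syms bs) = bit_symbol m # syms ms" "syms bs = rev (syms ms) @ [bit_symbol m]"
    using arg_cong[OF bs, of syms] by (simp_all add: rev_map[symmetric] rev_swap)
  have lb: "length bs = Suc (length ms)" using arg_cong[OF bs, of length] by simp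
  obtain h hs' where hs: "hs = h # hs'" "length h = 4 * q" "hs' \<in> seqs (words (4 * q)) (Suc (length ms))"
    using assms(2) by (auto simp: seqs_def words_def length_Suc_conv lb)
  let ?n0 = "Zip (rev (syms bs)) []"
  let ?x = "toeplitz q h (replicate q 0)" and ?i = "In (rev (insyms h) @ li) (insyms (concat hs') @ ir)"
  have e: "effective ?n0 x = replicate q 0" using ready_props(7)[OF assms(1)] by (simp add: effective_def)
  obtain ts1 where 1: "ready q (Zip (syms ms) [bit_symbol m]) lc ?x a ts1"
    "exec s (level ;; left 0) (In li (insyms h @ insyms (concat hs') @ ir), ts, w) (?i, ts1, w)"
    using exec_level_left[OF assms(1,5) _ assms(7) hs(2), of li "insyms (concat hs') @ ir" w] assms(6)
    lb unfolding e by (auto simp: rs)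
  have f: "fits s ts" using ready_props(10)[OF assms(1), of s] assms by auto
  let ?x' = "run_levels q (m # ms) hs' ?x" and ?i' = "In (rev (insyms (concat hs')) @ rev (insyms h) @ li) ir"
  obtain ts2 where 3: "ready q (Home (syms bs)) lc ?x' a ts2" "exec s level_loop (?i, ts1, w) (?i', ts2, w)"
    using exec_levels[OF 1(1) hs(3) assms(5) _ assms(7), of "rev (insyms h) @ li" ir w] assms(6) lb by (auto simp: rs)
  have 4: "exec s level_loop (In li (insyms h @ insyms (concat hs') @ ir), ts, w) (?i', ts2, w)"
    by (rule exec_While_True[OF _ f 1(2) 3(2)]) (use ready_props(5)[OF assms(1)] in simp)
  have cb: "copy_bit q bs hs = hd ?x'" by (simp add: copy_bit_def bs hs)
  let ?a = "a + copy_bit q bs hs"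
  let ?ts3 = "ts2[0 := Zip [] (syms bs), 7 := Flag (bit_symbol ?a)]"
  have R3: "ready q (Zip [] (syms bs)) lc ?x' ?a ?ts3" by (rule ready_props(9)[OF 3(1)])
  have f3: "fits s ts2" "fits s ?ts3"
    using ready_props(10)[OF 3(1), of s] ready_props(10)[OF R3, of s] assms by auto
  have lx: "?x' \<noteq> []" using ready_props(7)[OF 3(1)] assms(3) by auto
  have "map scan ts2 ! 2 = bit_symbol (hd ?x')"
    using ready_props(1,3)[OF 3(1)] lx by (cases ?x') auto
  then have f: "(\<lambda>a u. (Stay, [(0, u ! 0, Go_Right), (7, if u ! 2 = 2 then 3 - u ! 7 else u ! 7, Stay)], None))
      (peek ?i') (map scan ts2) = (Stay, [(0, 3, Go_Right), (7, bit_symbol ?a, Stay)], None)"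
    using ready_props(5,6)[OF 3(1)] by (cases "hd ?x'") (simp_all add: cb flip_symbol)
  have 5: "exec s (Act (\<lambda>a u. (Stay, [(0, u ! 0, Go_Right), (7, if u ! 2 = 2 then 3 - u ! 7 else u ! 7, Stay)], None)))
      (?i', ts2, w) (?i', ?ts3, w)"
    by (rule exec_ActI, rule f)
      (use f3 ready_props(1,2,4,11)[OF 3(1)] in \<open>auto simp: changed_def emit_def\<close>)
  let ?ts4 = "?ts3[0 := ?n0]"
  have 6: "exec s (to_end 0) (?i', ?ts3, w) (?i', ?ts4, w)"
    using exec_to_end[of 0 ?ts3 "[]" "syms bs" s ?i' w] ready_props(1,2,11)[OF R3] f3 by simp
  have "exec s copy (In li (insyms (concat hs) @ ir), ts, w) (In (rev (insyms (concat hs)) @ li) ir, ?ts4, w)"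
    using exec_Seq[OF 4 exec_Seq[OF 5 6]] by (simp add: copy_def hs)
  then show ?thesis using ready_props(8)[OF R3] by blast
qed

lemma exec_copies:
  assumes "ready q (Zip (rev (syms bs)) []) lc x a ts" "z \<in> words (k * (Suc (length bs) * (4 * q)))"
    "1 \<le> q" "bs \<noteq> []" "Suc q < s" "Suc (length bs) < s" "extent lc < s"
  shows "\<exists>ts' x'. ready q (Zip (rev (syms bs)) []) lc x'
      (a + (\<Sum>y\<leftarrow>chunks (Suc (length bs) * (4 * q)) k z. copy_bit q bs (chunks (4 * q) (Suc (length bs)) y))) ts' \<and>
    exec s copy_loop (In li (insyms z), ts, w) (In (rev (insyms z) @ li) [], ts', w)"
  using assms(1,2)
proof (induction k arbitrary: z a x ts li)
  case 0
  have "exec s copy_loop (In li [], ts, w) (In li [], ts, w)"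
    using ready_props(10)[OF 0(1), of s] assms(5-7) by (intro exec_While_False) auto
  then show ?case using 0 by (auto simp: words_0)
next
  case (Suc k)
  let ?m = "Suc (length bs) * (4 * q)"
  define y z' where "y = take ?m z" and "z' = drop ?m z"
  have z: "z = y @ z'" "length y = ?m" "z' \<in> words (k * ?m)"
    using Suc.prems(2) by (auto simp: y_def z'_def words_def)
  let ?hs = "chunks (4 * q) (Suc (length bs)) y"
  have hs: "?hs \<in> seqs (words (4 * q)) (Suc (length bs))" "concat ?hs = y"
    using z(2) chunks_in_seqs[of y "Suc (length bs)" "4 * q"] concat_chunks[of y "Suc (length bs)" "4 * q"]
    by (auto simp: words_def simp del: chunks.simps)
  obtain ts1 x1 where 1: "ready q (Zip (rev (syms bs)) []) lc x1 (a + copy_bit q bs ?hs) ts1"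
    "exec s copy (In li (insyms y @ insyms z'), ts, w) (In (rev (insyms y) @ li) (insyms z'), ts1, w)"
    using exec_copy[OF Suc.prems(1) hs(1) assms(3-7), of li "insyms z'" w] unfolding hs(2) by blast
  obtain ts2 x2 where 2: "ready q (Zip (rev (syms bs)) []) lc x2
      (a + copy_bit q bs ?hs + (\<Sum>y\<leftarrow>chunks ?m k z'. copy_bit q bs (chunks (4 * q) (Suc (length bs)) y))) ts2"
    "exec s copy_loop (In (rev (insyms y) @ li) (insyms z'), ts1, w)
      (In (rev (insyms z') @ rev (insyms y) @ li) [], ts2, w)"
    using Suc.IH[OF 1(1) z(3), of "rev (insyms y) @ li"] by blast
  have f: "fits s ts" using ready_props(10)[OF Suc.prems(1), of s] assms by auto
  have "0 < length y" using z(2) assms(3) by simp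
  then obtain b y' where y: "y = b # y'" by (cases y) auto
  \<comment> \<open>The seed of a copy is nonempty because of 1 \<le> q, so the loop cannot mistake
    the start of a copy for the end of the input.\<close>
  have pk: "peek (In li (insyms y @ insyms z')) \<noteq> Right_End"
    by (simp add: y)
  have "exec s copy_loop (In li (insyms y @ insyms z'), ts, w)
      (In (rev (insyms z') @ rev (insyms y) @ li) [], ts2, w)"
    by (rule exec_While_True[OF pk f 1(2) 2(2)])
  moreover have "chunks ?m (Suc k) z = y # chunks ?m k z'" by (simp add: y_def z'_def)
  ultimately show ?case using 2(1) unfolding z(1)[symmetric]
    by (intro exI[of _ ts2] exI[of _ x2]) (simp add: z(1) add.assoc del: chunks.simps)
qed

section \<open>The output loop and its counter\<close>

lemma exec_rewind:
  assumes "fits s ts"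
  shows "exec s rewind (In (rev (insyms z1) @ Separator # li) (insyms z2), ts, w)
    (In (Separator # li) (insyms (z1 @ z2)), ts, w)"
proof -
  let ?b = "\<lambda>a u. a \<noteq> Separator" and ?A = "Act (\<lambda>a u. (Go_Left, [], None))"
  have l: "exec s ?A (i, ts, w) (move Go_Left i, ts, w)" for i
    by (rule exec_ActI) (use assms in \<open>auto simp: changed_def emit_def\<close>)
  have W: "exec s (While ?b ?A) (In (rev (insyms z1) @ Separator # li) (insyms z2), ts, w)
      (In li (Separator # insyms (z1 @ z2)), ts, w)"
  proof (induction z1 arbitrary: z2 rule: rev_induct)
    case Nil
    have "exec s (While ?b ?A) (In li (Separator # insyms z2), ts, w) (In li (Separator # insyms z2), ts, w)"
      using assms by (intro exec_While_False) auto
    then show ?case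
      using exec_While_True[OF _ assms l, of ?b "In (Separator # li) (insyms z2)"]
      by (cases z2) auto
  next
    case (snoc b z1)
    have "peek (In (input_symbol b # rev (insyms z1) @ Separator # li) (insyms z2)) \<noteq> Separator"
      by (cases z2) auto
    then show ?case
      using exec_While_True[OF _ assms l, of ?b "In (input_symbol b # rev (insyms z1) @ Separator # li) (insyms z2)"]
        snoc[of "b # z2"] by auto
  qed
  show ?thesis unfolding rewind_def by (rule exec_Seq[OF W exec_read[OF assms]])
qed

fun nval :: "bit list \<Rightarrow> nat" where
  "nval [] = 0"
| "nval (b # bs) = of_bool (b = 1) + 2 * nval bs"

fun dec :: "bit list \<Rightarrow> bit list" where
  "dec [] = []"
| "dec (b # bs) = (if b = 1 then 0 # bs else 1 # dec bs)"

lemma length_dec [simp]: "length (dec bs) = length bs"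
  by (induction bs) auto

lemma nval_dec: "nval bs \<noteq> 0 \<Longrightarrow> nval (dec bs) = nval bs - 1"
  by (induction bs) (auto simp: of_bool_def split: if_splits)

text \<open>The head stops on the lowest 1 of the counter. Replacing this symbol 2 by 1, which is
  left to \<open>body\<close>, would complete the decremented counter.\<close>

lemma exec_decrement:
  assumes "ready q (Zip l (syms bs)) lc x a ts" "Suc q < s" "Suc (length l + length bs) < s" "extent lc < s"
  shows "\<exists>l' r'. exec s decrement (i, ts, w) (i, ts[0 := Zip l' r'], w) \<and>
    (if nval bs = 0 then r' = [] \<and> length l' = length l + length bs
     else \<exists>r. r' = 2 # r \<and> rev l' @ 1 # r = rev l @ syms (dec bs))"
  using assms(1,3) unfolding decrement_def
proof (induction bs arbitrary: l ts)
  case Nil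
  have "ts[0 := Zip l []] = ts" using ready_props(2)[OF Nil(1)] by (metis list.simps(8) list_update_id)
  then have "exec s (While (\<lambda>a u. u ! 0 = 1) (Act (\<lambda>a u. (Stay, [(0, 2, Go_Right)], None)))) (i, ts, w)
      (i, ts[0 := Zip l []], w)"
    using ready_props(5,10)[OF Nil(1)] Nil assms(2,4)
    by (auto intro!: exec_While_False)
  then show ?case by (intro exI[of _ l] exI[of _ "[]"]) auto
next
  case (Cons b bs)
  let ?A = "Act (\<lambda>a u. (Stay, [(0, 2, Go_Right)], None))"
  have f: "fits s ts" using ready_props(10)[OF Cons.prems(1), of s] Cons.prems assms by auto
  show ?case
  proof (cases "b = 1")
    case True
    have "ts[0 := Zip l (2 # syms bs)] = ts"
      using ready_props(2)[OF Cons.prems(1)] True by (metis bit_symbol_simps(6) list.simps(9) list_update_id)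
    then have "exec s (While (\<lambda>a u. u ! 0 = 1) ?A) (i, ts, w) (i, ts[0 := Zip l (2 # syms bs)], w)"
      using ready_props(5)[OF Cons.prems(1)] True f by (auto intro!: exec_While_False)
    then show ?thesis using True by (intro exI[of _ l] exI[of _ "2 # syms bs"]) auto
  next
    case False
    then have b: "b = 0" by simp
    let ?ts = "ts[0 := Zip (2 # l) (syms bs)]"
    have R: "ready q (Zip (2 # l) (syms bs)) lc x a ?ts" by (rule ready_props(8)[OF Cons.prems(1)])
    have f': "fits s ?ts" using ready_props(10)[OF R, of s] Cons.prems assms by auto
    have 1: "exec s ?A (i, ts, w) (i, ?ts, w)"
      by (rule exec_ActI) (use f f' ready_props(1,2,11)[OF Cons.prems(1)] in \<open>auto simp: changed_def emit_def\<close>)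
    obtain l' r' where 2: "exec s (While (\<lambda>a u. u ! 0 = 1) ?A) (i, ?ts, w) (i, ?ts[0 := Zip l' r'], w)"
      "if nval bs = 0 then r' = [] \<and> length l' = length (2 # l) + length bs
       else \<exists>r. r' = 2 # r \<and> rev l' @ 1 # r = rev (2 # l) @ syms (dec bs)"
      using Cons.IH[OF R] Cons.prems(2) by auto
    have "exec s (While (\<lambda>a u. u ! 0 = 1) ?A) (i, ts, w) (i, ?ts[0 := Zip l' r'], w)"
      by (rule exec_While_True[OF _ f 1 2(1)]) (use ready_props(5)[OF Cons.prems(1)] b in simp)
    then show ?thesis using 2(2) b by (intro exI[of _ l'] exI[of _ r']) (auto split: if_splits)
  qed
qed

definition output_bit :: "nat \<Rightarrow> nat \<Rightarrow> bit list \<Rightarrow> bit list \<Rightarrow> bit" where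
  "output_bit q k z bs = (\<Sum>y\<leftarrow>chunks (Suc (length bs) * (4 * q)) k z. copy_bit q bs (chunks (4 * q) (Suc (length bs)) y))"

text \<open>As \<open>decrement\<close> is the last command of \<open>body\<close>, the induction on
  the counter is about a decrement followed by the loop. The input head may start anywhere in the
  seed, because each round leaves it at the end and \<open>rewind\<close> brings it back.\<close>

lemma exec_main_loop:
  assumes z: "z \<in> words (k * (Suc L * (4 * q)))" and v: "\<And>bs. length bs = L \<Longrightarrow> output_bit q k z bs = f (nval bs)"
    and q: "0 < L \<Longrightarrow> 1 \<le> q" and s: "Suc q < s" "Suc L < s" "extent lc < s"
  shows "ready q (Zip [] (syms bs)) lc x a ts \<Longrightarrow> length bs = L \<Longrightarrow> z1 @ z2 = z \<Longrightarrow>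
    \<exists>c fin ts'. exec s decrement (In (rev (insyms z1) @ Separator # li) (insyms z2), ts, w) c \<and>
      exec s output_loop c (fin, ts', w @ map (\<lambda>j. sign (f j)) (rev [0..<nval bs]))"
proof (induction "nval bs" arbitrary: bs x a ts z1 z2 w)
  case 0
  let ?i = "In (rev (insyms z1) @ Separator # li) (insyms z2)"
  obtain l' where 1: "exec s decrement (?i, ts, w) (?i, ts[0 := Zip l' []], w)" "length l' = length bs"
    using exec_decrement[OF 0(2) s(1) _ s(3), of ?i w] 0 s by auto
  have R: "ready q (Zip l' []) lc x a (ts[0 := Zip l' []])" by (rule ready_props(8)[OF 0(2)])
  have 2: "exec s output_loop (?i, ts[0 := Zip l' []], w) (?i, ts[0 := Zip l' []], w)"
    using ready_props(5,10)[OF R] s 0 1(2) by (intro exec_While_False) auto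
  show ?case
    by (rule exI[of _ "(?i, ts[0 := Zip l' []], w)"], rule exI[of _ ?i], rule exI[of _ "ts[0 := Zip l' []]"])
      (use 1(1) 2 0(1) in simp)
next
  case (Suc v bs)
  let ?i = "In (rev (insyms z1) @ Separator # li) (insyms z2)"
  let ?j = "In (Separator # li) (insyms z)" and ?e = "In (rev (insyms z) @ Separator # li) []"
  obtain l r where 1: "exec s decrement (?i, ts, w) (?i, ts[0 := Zip l (2 # r)], w)"
    "rev l @ 1 # r = syms (dec bs)"
    using exec_decrement[OF Suc(3) s(1) _ s(3), of ?i w] Suc.hyps(2) Suc.prems(2) s by auto
  let ?bs = "dec bs"
  have lb: "length ?bs = L" "?bs \<noteq> []" "0 < L" using Suc.hyps(2) Suc.prems(2) by (cases bs; auto)+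
  have lr: "Suc (length l + length r) = L" using arg_cong[OF 1(2), of length] lb by simp
  have v': "nval ?bs = v" using nval_dec[of bs] Suc.hyps(2) by simp
  let ?ts1 = "ts[0 := Zip l (2 # r)]"
  have R1: "ready q (Zip l (2 # r)) lc x a ?ts1" by (rule ready_props(8)[OF Suc(3)])
  let ?ts2 = "?ts1[0 := Zip l (1 # r), 7 := Flag (bit_symbol 0)]"
  have R2: "ready q (Zip l (1 # r)) lc x 0 ?ts2" by (rule ready_props(9)[OF R1])
  have f: "fits s ?ts1" "fits s ?ts2"
    using ready_props(10)[OF R1, of s] ready_props(10)[OF R2, of s] s lr by auto
  have 2: "exec s (Act (\<lambda>a u. (Stay, [(0, 1, Stay), (7, 1, Stay)], None))) (?i, ?ts1, w) (?i, ?ts2, w)"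
    by (rule exec_ActI) (use f ready_props(1,2,4,11)[OF R1] in \<open>auto simp: changed_def emit_def\<close>)
  let ?n3 = "Zip (rev (syms ?bs)) []"
  let ?ts3 = "?ts2[0 := ?n3]"
  have R3: "ready q ?n3 lc x 0 ?ts3" by (rule ready_props(8)[OF R2])
  have f3: "fits s ?ts3" using ready_props(10)[OF R3, of s] s lb by auto
  have sr: "rev (1 # r) @ l = rev (syms ?bs)" unfolding 1(2)[symmetric] by simp
  have "0 \<notin> set (1 # r)"
  proof -
    have "set (1 # r) \<subseteq> set (syms ?bs)" unfolding 1(2)[symmetric] by auto
    then show ?thesis using set_syms(1) by blast
  qed
  then have 3: "exec s (to_end 0) (?i, ?ts2, w) (?i, ?ts3, w)"
    using exec_to_end[of 0 ?ts2 l "1 # r" s ?i w] ready_props(1,2,11)[OF R2] f(2) unfolding sr by simp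
  have 4: "exec s rewind (?i, ?ts3, w) (?j, ?ts3, w)"
    using exec_rewind[OF f3, of z1 li z2 w] Suc.prems(3) by simp
  obtain ts4 x4 where R4: "ready q ?n3 lc x4 (f v) ts4"
    and 5: "exec s copy_loop (?j, ?ts3, w) (?e, ts4, w)"
    using exec_copies[OF R3, of z k s "Separator # li" w] v[OF lb(1)] z q[OF lb(3)] lb s v'
    by (auto simp: output_bit_def)
  have f4: "fits s ts4" using ready_props(10)[OF R4, of s] s lb by auto
  let ?w = "w @ [sign (f v)]"
  have g: "(\<lambda>a u. (Stay, [], Some (if u ! 7 = 2 then -1 else 1))) (peek ?e) (map scan ts4)
      = (Stay, [], Some (sign (f v)))"
    using ready_props(6)[OF R4] by (cases "f v") (simp_all add: sign_def)
  have 6: "exec s emit_bit (?e, ts4, w) (?e, ts4, ?w)"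
    unfolding emit_bit_def by (rule exec_ActI, rule g) (use f4 in \<open>auto simp: changed_def emit_def\<close>)
  let ?ts5 = "ts4[0 := Zip [] (syms ?bs)]"
  have R5: "ready q (Zip [] (syms ?bs)) lc x4 (f v) ?ts5" by (rule ready_props(8)[OF R4])
  have 7: "exec s (home 0) (?e, ts4, ?w) (?e, ?ts5, ?w)"
    using exec_home[of 0 ts4 "rev (syms ?bs)" "[]" s ?e ?w] ready_props(1,2,11)[OF R4] f4 by simp
  obtain c fin ts' where 8: "exec s decrement (?e, ?ts5, ?w) c"
    "exec s output_loop c (fin, ts', ?w @ map (\<lambda>j. sign (f j)) (rev [0..<nval ?bs]))"
    using Suc.hyps(1)[OF v'[symmetric] R5 lb(1), of z "[]" ?w] by auto
  have 9: "exec s body (?i, ?ts1, w) c"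
    unfolding body_def
    by (rule exec_Seq[OF 2 exec_Seq[OF 3 exec_Seq[OF 4 exec_Seq[OF 5 exec_Seq[OF 6 exec_Seq[OF 7 8(1)]]]]]])
  have "exec s output_loop (?i, ?ts1, w)
      (fin, ts', ?w @ map (\<lambda>j. sign (f j)) (rev [0..<nval ?bs]))"
    by (rule exec_While_True[OF _ f(1) 9 8(2)]) (use ready_props(5)[OF R1] in simp)
  moreover have "?w @ map (\<lambda>j. sign (f j)) (rev [0..<nval ?bs]) = w @ map (\<lambda>j. sign (f j)) (rev [0..<nval bs])"
    unfolding v' Suc.hyps(2)[symmetric] by simp
  ultimately show ?case using 1(1) by metis
qed

section \<open>Counter values as positions in the output of the generator\<close>

lemma nval_less: "nval bs < 2 ^ length bs"
  by (induction bs) (auto simp: of_bool_def)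

lemma nval_snoc: "nval (bs @ [b]) = nval bs + of_bool (b = 1) * 2 ^ length bs"
  by (induction bs) (auto simp: algebra_simps)

text \<open>From the most significant bit on, every bit of the counter chooses a half of the output,
  a 1 the first half and a 0 the second. This is the binary expansion of the position with all bits
  complemented.\<close>

lemma hd_run_levels:
  assumes "nisan (words q) (words (4 * q)) (toeplitz q) hd" "length hs = length ms"
  shows "hd (run_levels q ms hs x)
    = nisan.gen (toeplitz q) hd hs x ! (2 ^ length ms - 1 - nval (rev ms))"
  using assms(2)
proof (induction ms arbitrary: hs x)
  case Nil
  then show ?case using nisan.gen.simps[OF assms(1)] by simp
next
  case (Cons m ms)
  interpret nisan "words q" "words (4 * q)" "toeplitz q" hd by (rule assms(1))
  obtain h hs' where hs: "hs = h # hs'" "length hs' = length ms" using Cons.prems by (cases hs) auto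
  let ?v = "nval (rev ms)"
  have v: "?v < 2 ^ length ms" using nval_less[of "rev ms"] by simp
  have V: "nval (rev (m # ms)) = ?v + of_bool (m = 1) * 2 ^ length ms" by (simp add: nval_snoc)
  show ?case
  proof (cases "m = 1")
    case True
    have "2 ^ length (m # ms) - 1 - nval (rev (m # ms)) = 2 ^ length ms - 1 - ?v"
      unfolding V using True by simp
    then show ?thesis using Cons.IH[OF hs(2), of x] v True by (simp add: hs nth_append)
  next
    case False
    have "2 ^ length (m # ms) - 1 - nval (rev (m # ms)) = 2 ^ length ms + (2 ^ length ms - 1 - ?v)"
      unfolding V using False v by simp
    then show ?thesis using Cons.IH[OF hs(2), of "toeplitz q h x"] False by (simp add: hs nth_append)
  qed
qed

lemma output_bit_eq:
  assumes "1 \<le> q" "length bs = L" "z \<in> words (k * (Suc L * (4 * q)))"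
  shows "output_bit q k z bs
    = (\<Sum>c<k. copy_output q L (chunks (Suc L * (4 * q)) k z ! c) ! (2 ^ L - 1 - nval bs))"
proof -
  have "copy_bit q bs (chunks (4 * q) (Suc L) y) = copy_output q L y ! (2 ^ L - 1 - nval bs)" for y
    unfolding copy_bit_def copy_output_def Let_def
    using hd_run_levels[OF nisan_toeplitz[OF assms(1)], of "tl (chunks (4 * q) (Suc L) y)" "rev bs"] assms(2)
    by simp
  then show ?thesis
    by (simp add: output_bit_def assms(2) sum_list_sum_nth atLeast0LessThan del: chunks.simps)
qed

section \<open>Initial contents of the tapes\<close>

definition binary :: "nat \<Rightarrow> bit list" where
  "binary n = (inc ^^ n) []"

lemma nval_inc: "nval (inc bs) = Suc (nval bs)"
  by (induction bs) auto

lemma nval_binary [simp]: "nval (binary n) = n"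
  unfolding binary_def by (induction n) (simp_all add: nval_inc)

lemma length_normal: "bs = [] \<or> last bs = 1 \<Longrightarrow> length bs = floorlog 2 (nval bs)"
proof (induction bs)
  case (Cons b bs)
  show ?case
  proof (cases "bs = []")
    case True
    then show ?thesis using Cons.prems compute_floorlog[of 2 1] by (simp add: floorlog_def)
  next
    case False
    then have l: "last bs = 1" using Cons.prems by simp
    have "nval bs \<noteq> 0"
      using False l by (induction bs) (auto split: if_splits)
    then show ?thesis using Cons.IH l compute_floorlog[of 2 "nval (b # bs)"] by simp
  qed
qed (simp add: floorlog_def)

lemma normal_inc: "bs = [] \<or> last bs = 1 \<Longrightarrow> inc bs \<noteq> [] \<and> last (inc bs) = 1"
  by (induction bs) auto

lemma length_binary: "length (binary n) = floorlog 2 n"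
proof -
  have "binary n = [] \<or> last (binary n) = 1"
    unfolding binary_def by (induction n) (auto simp: normal_inc)
  from length_normal[OF this] show ?thesis by simp
qed

lemma length_inc_funpow: "length bs \<le> length ((inc ^^ k) bs)"
  by (induction k) (use length_inc order_trans in auto)

lemma exec_count_input:
  assumes "ts ! 0 = Zip [] (syms bs)" "ts \<noteq> []" "fits s ts" "Suc (length ((inc ^^ k) bs)) < s"
  shows "exec s count_input
    (In li (replicate k Plus @ Separator # rest), ts, w)
    (In (replicate k Plus @ li) (Separator # rest), ts[0 := Zip [] (syms ((inc ^^ k) bs))], w)"
  using assms
proof (induction k arbitrary: li bs ts)
  case 0
  then have "ts[0 := Zip [] (syms bs)] = ts" by (metis list_update_id)
  then show ?case using 0 by (auto intro!: exec_While_False)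
next
  case (Suc k)
  let ?ts = "ts[0 := Zip [] (syms (inc bs))]"
  have k: "(inc ^^ Suc k) bs = (inc ^^ k) (inc bs)" by (simp add: funpow_swap1)
  have l: "Suc (length (inc bs)) < s" using Suc.prems(4) length_inc_funpow[of "inc bs" k] unfolding k by linarith
  have f: "fits s ?ts" using Suc.prems l by (intro fits_update) auto
  have 1: "exec s (increment 0) (In li (Plus # replicate k Plus @ Separator # rest), ts, w)
      (In li (Plus # replicate k Plus @ Separator # rest), ?ts, w)"
    using Suc.prems l by (intro exec_increment) auto
  have 2: "exec s count_input
      (In (Plus # li) (replicate k Plus @ Separator # rest), ?ts, w)
      (In (replicate k Plus @ Plus # li) (Separator # rest), ?ts[0 := Zip [] (syms ((inc ^^ k) (inc bs)))], w)"
    using Suc.prems f unfolding k by (intro Suc.IH) auto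
  have "exec s count_input
      (In li (Plus # replicate k Plus @ Separator # rest), ts, w)
      (In (replicate k Plus @ Plus # li) (Separator # rest), ?ts[0 := Zip [] (syms ((inc ^^ k) (inc bs)))], w)"
    by (rule exec_While_True[OF _ Suc.prems(3) exec_Seq[OF 1 exec_read[OF f]] 2]) simp
  then show ?case unfolding k by (simp add: replicate_app_Cons_same)
qed

lemma exec_count_cells:
  assumes "ts = Zip l r # Zip [] (syms bs) # ts'" "0 \<notin> set r" "fits s ts"
    "Suc (length ((inc ^^ length r) bs)) < s"
  shows "exec s count_cells (i, ts, w)
    (i, Zip (rev r @ l) [] # Zip [] (syms ((inc ^^ length r) bs)) # ts', w)"
  using assms
proof (induction r arbitrary: l bs ts)
  case Nil
  then show ?case by (auto intro!: exec_While_False)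
next
  case (Cons x r)
  let ?bs = "inc bs"
  have k: "(inc ^^ length (x # r)) bs = (inc ^^ length r) ?bs" by (simp add: funpow_swap1)
  have l: "Suc (length ?bs) < s" using Cons.prems(4) length_inc_funpow[of ?bs "length r"] unfolding k by linarith
  have 1: "exec s (increment 1) (i, ts, w) (i, Zip l (x # r) # Zip [] (syms ?bs) # ts', w)"
    using exec_increment[of 1 ts bs s i w] Cons.prems(1,3) l by simp
  have f1: "fits s (Zip l (x # r) # Zip [] (syms ?bs) # ts')"
    using Cons.prems(1,3) l by (auto simp: fits_def)
  have 2: "exec s (right 0) (i, Zip l (x # r) # Zip [] (syms ?bs) # ts', w)
      (i, Zip (x # l) r # Zip [] (syms ?bs) # ts', w)"
    using exec_right[of 0 "Zip l (x # r) # Zip [] (syms ?bs) # ts'" l x r s i w] f1 by simp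
  have 3: "exec s count_cells
      (i, Zip (x # l) r # Zip [] (syms ?bs) # ts', w)
      (i, Zip (rev r @ x # l) [] # Zip [] (syms ((inc ^^ length r) ?bs)) # ts', w)"
    using Cons.prems f1 unfolding k by (intro Cons.IH) (auto simp: fits_def)
  have "exec s count_cells (i, ts, w)
      (i, Zip (rev r @ x # l) [] # Zip [] (syms ((inc ^^ length r) ?bs)) # ts', w)"
    by (rule exec_While_True[OF _ Cons.prems(3) exec_Seq[OF 1 2] 3]) (use Cons.prems in auto)
  then show ?case unfolding k by simp
qed

abbreviation "built n lc m \<equiv> [n, lc, Zip (replicate m 1) [], Zip (replicate m 1) [], Zip (replicate m 1) [],
  Flag 1, Flag 1, Flag (1::nat)]"

lemma exec_append_cell:
  assumes "extent n < s" "extent lc < s" "Suc (Suc m) < s"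
  shows "exec s append_cell (i, built n lc m, w) (i, built n lc (Suc m), w)"
  unfolding append_cell_def
  by (rule exec_ActI) (use assms in \<open>auto simp: changed_def emit_def fits_def\<close>)

lemma exec_append_cells:
  assumes "extent n < s" "extent lc < s" "m + 9 < s"
  shows "exec s append_cells (i, built n lc m, w) (i, built n lc (m + 8), w)"
proof -
  have 1: "exec s append_cell (i, built n lc k, w) (i, built n lc (Suc k), w)" if "k \<le> m + 7" for k
    using assms that by (intro exec_append_cell) auto
  have e: "m + 8 = Suc (Suc (Suc (Suc (Suc (Suc (Suc (Suc m)))))))" by simp
  show ?thesis unfolding append_cells_def e
    by (rule exec_Seq[OF 1 exec_Seq[OF 1 exec_Seq[OF 1 exec_Seq[OF 1 exec_Seq[OF 1 exec_Seq[OF 1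
          exec_Seq[OF 1 1]]]]]]]) simp_all
qed

lemma exec_units_cells:
  assumes "0 \<notin> set r" "extent n < s" "Suc (length l + length r) < s" "m + 8 * length r + 1 < s"
  shows "exec s build_by_cells (i, built n (Zip l r) m, w)
    (i, built n (Zip (rev r @ l) []) (m + 8 * length r), w)"
  using assms
proof (induction r arbitrary: l m)
  case Nil
  then show ?case by (auto simp: fits_def intro!: exec_While_False)
next
  case (Cons x r)
  have 1: "exec s append_cells (i, built n (Zip l (x # r)) m, w) (i, built n (Zip l (x # r)) (m + 8), w)"
    using Cons.prems by (intro exec_append_cells) auto
  have 2: "exec s (right 1) (i, built n (Zip l (x # r)) (m + 8), w) (i, built n (Zip (x # l) r) (m + 8), w)"
    using exec_right[of 1 "built n (Zip l (x # r)) (m + 8)" l x r s i w] Cons.prems by (simp add: fits_def)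
  have 3: "exec s build_by_cells (i, built n (Zip (x # l) r) (m + 8), w)
      (i, built n (Zip (rev r @ x # l) []) (m + 8 + 8 * length r), w)"
    using Cons.prems by (intro Cons.IH) auto
  have "exec s build_by_cells (i, built n (Zip l (x # r)) m, w)
      (i, built n (Zip (rev r @ x # l) []) (m + 8 + 8 * length r), w)"
    by (rule exec_While_True[OF _ _ exec_Seq[OF 1 2] 3]) (use Cons.prems in \<open>auto simp: fits_def\<close>)
  moreover have "m + 8 + 8 * length r = m + 8 * length (x # r)" by simp
  ultimately show ?case by (simp del: replicate.simps)
qed

lemma exec_units_input:
  assumes "0 \<notin> set r" "extent lc < s" "Suc (length l + length r) < s" "m + 8 * min k (length r) + 1 < s"
  shows "exec s build_by_input
    (In li (replicate k Plus @ Separator # rest), built (Zip l r) lc m, w)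
    (In (replicate k Plus @ li) (Separator # rest),
     built (Zip (rev (take k r) @ l) (drop k r)) lc (m + 8 * min k (length r)), w)"
  using assms
proof (induction k arbitrary: li l r m)
  case 0
  then show ?case by (auto simp: fits_def intro!: exec_While_False)
next
  case (Suc k)
  let ?W = "build_by_input"
  let ?i = "In li (Plus # replicate k Plus @ Separator # rest)"
  have f: "fits s (built (Zip l r) lc m)" using Suc.prems by (auto simp: fits_def)
  show ?case
  proof (cases r)
    case Nil
    have 1: "exec s (When (\<lambda>a u. u ! 0 \<noteq> 0) (append_cells ;; right 0)) (?i, built (Zip l r) lc m, w)
        (?i, built (Zip l r) lc m, w)"
      using f Nil by (intro exec_When_False) auto
    have 2: "exec s ?W (In (Plus # li) (replicate k Plus @ Separator # rest), built (Zip l r) lc m, w)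
        (In (replicate k Plus @ Plus # li) (Separator # rest), built (Zip l r) lc m, w)"
      using Suc.IH[of r l m "Plus # li"] Suc.prems Nil by simp
    have "exec s ?W (?i, built (Zip l r) lc m, w)
        (In (replicate k Plus @ Plus # li) (Separator # rest), built (Zip l r) lc m, w)"
      by (rule exec_While_True[OF _ f exec_Seq[OF 1 exec_read[OF f]] 2]) simp
    then show ?thesis using Nil by (simp add: replicate_app_Cons_same)
  next
    case (Cons x r')
    have 1: "exec s append_cells (?i, built (Zip l (x # r')) lc m, w) (?i, built (Zip l (x # r')) lc (m + 8), w)"
      using Suc.prems Cons by (intro exec_append_cells) auto
    have 2: "exec s (right 0) (?i, built (Zip l (x # r')) lc (m + 8), w) (?i, built (Zip (x # l) r') lc (m + 8), w)"
      using exec_right[of 0 "built (Zip l (x # r')) lc (m + 8)" l x r' s ?i w] Suc.prems Cons by (simp add: fits_def)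
    have f2: "fits s (built (Zip (x # l) r') lc (m + 8))" using Suc.prems Cons by (auto simp: fits_def)
    have 3: "exec s (When (\<lambda>a u. u ! 0 \<noteq> 0) (append_cells ;; right 0)) (?i, built (Zip l r) lc m, w)
        (?i, built (Zip (x # l) r') lc (m + 8), w)"
      unfolding Cons by (rule exec_When_True[OF _ _ exec_Seq[OF 1 2]]) (use f Suc.prems Cons in auto)
    have 4: "exec s ?W (In (Plus # li) (replicate k Plus @ Separator # rest), built (Zip (x # l) r') lc (m + 8), w)
        (In (replicate k Plus @ Plus # li) (Separator # rest),
         built (Zip (rev (take k r') @ x # l) (drop k r')) lc (m + 8 + 8 * min k (length r')), w)"
      using Suc.prems Cons by (intro Suc.IH) auto
    have "exec s ?W (?i, built (Zip l r) lc m, w)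
        (In (replicate k Plus @ Plus # li) (Separator # rest),
         built (Zip (rev (take k r') @ x # l) (drop k r')) lc (m + 8 + 8 * min k (length r')), w)"
      by (rule exec_While_True[OF _ f exec_Seq[OF 3 exec_read[OF f2]] 4]) simp
    moreover have "m + 8 + 8 * min k (length r') = m + 8 * min (Suc k) (length r)" by (simp add: Cons)
    ultimately show ?thesis using Cons by (simp add: replicate_app_Cons_same del: replicate.simps)
        (simp add: replicate_app_Cons_same)
  qed
qed

lemma exec_prepare:
  fixes n w l k :: nat and z :: "bit list"
  defines "L \<equiv> levels n" and "q \<equiv> block_size n w"
  assumes s: "Suc q < s" "Suc L < s" "Suc (floorlog 2 L) < s"
  shows "\<exists>li lc ts. exec s prepare
      (At_Left (replicate n Plus @ Separator # replicate w Plus @ Separator # replicate l Plus @ Separator #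
         replicate k Plus @ Separator # insyms z), replicate 8 (Flag 0), [])
      (In (Separator # li) (insyms z), ts, []) \<and>
    ready q (Zip [] (syms (binary n))) lc (replicate q 0) 0 ts \<and> extent lc < s"
proof -
  let ?B = "binary n" and ?C = "binary L"
  have B: "length ?B = L" "length ?C = floorlog 2 L" by (simp_all add: length_binary L_def levels_def)
  have q: "q = 8 * floorlog 2 L + 8 * min w L" by (simp add: q_def block_size_def unit_size_def L_def)
  let ?k = "replicate k Plus @ Separator # insyms z"
  let ?l = "replicate l Plus @ Separator # ?k"
  let ?w = "replicate w Plus @ Separator # ?l"
  let ?n = "replicate n Plus @ Separator # ?w"
  let ?E = "Zip [] []"
  let ?ts1 = "built ?E ?E 0"
  have 1: "exec s (Act (\<lambda>a u. (Go_Right, [(0, 3, Go_Right), (1, 3, Go_Right), (2, 3, Go_Right),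
       (3, 3, Go_Right), (4, 3, Go_Right), (5, 1, Stay), (6, 1, Stay), (7, 1, Stay)], None)))
      (At_Left ?n, replicate 8 (Flag 0), []) (In [] ?n, ?ts1, [])"
    by (rule exec_ActI) (use s in \<open>auto simp: changed_def emit_def fits_def numeral_eq_Suc\<close>)
  let ?i2 = "In (replicate n Plus) (Separator # ?w)"
  have 2: "exec s count_input (In [] ?n, ?ts1, [])
      (?i2, built (Zip [] (syms ?B)) ?E 0, [])"
    using exec_count_input[of ?ts1 "[]" s n "[]" ?w "[]"] s B by (simp add: binary_def[symmetric] fits_def)
  let ?i3 = "In (Separator # replicate n Plus) ?w"
  have 3: "exec s read (?i2, built (Zip [] (syms ?B)) ?E 0, []) (?i3, built (Zip [] (syms ?B)) ?E 0, [])"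
    using s B by (intro exec_read) (auto simp: fits_def)
  have 4: "exec s count_cells (?i3, built (Zip [] (syms ?B)) ?E 0, [])
      (?i3, built (Zip (rev (syms ?B)) []) (Zip [] (syms ?C)) 0, [])"
    using exec_count_cells[of "built (Zip [] (syms ?B)) ?E 0" "[]" "syms ?B" "[]" _ s ?i3 "[]"] s B
    by (simp add: fits_def binary_def[of L])
  have 5: "exec s (home 0) (?i3, built (Zip (rev (syms ?B)) []) (Zip [] (syms ?C)) 0, [])
      (?i3, built (Zip [] (syms ?B)) (Zip [] (syms ?C)) 0, [])"
    using exec_home[of 0 "built (Zip (rev (syms ?B)) []) (Zip [] (syms ?C)) 0" "rev (syms ?B)" "[]" s ?i3 "[]"] s B
    by (simp add: fits_def)
  let ?lc = "Zip (rev (syms ?C)) []"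
  have 6: "exec s build_by_cells
      (?i3, built (Zip [] (syms ?B)) (Zip [] (syms ?C)) 0, [])
      (?i3, built (Zip [] (syms ?B)) ?lc (8 * floorlog 2 L), [])"
    using exec_units_cells[of "syms ?C" "Zip [] (syms ?B)" s "[]" 0 ?i3 "[]"] s B q by simp
  let ?i7 = "In (replicate w Plus @ Separator # replicate n Plus) (Separator # ?l)"
  let ?n7 = "Zip (rev (take w (syms ?B))) (drop w (syms ?B))"
  have 7: "exec s build_by_input
      (?i3, built (Zip [] (syms ?B)) ?lc (8 * floorlog 2 L), []) (?i7, built ?n7 ?lc q, [])"
    using exec_units_input[of "syms ?B" ?lc s "[]" "8 * floorlog 2 L" w "Separator # replicate n Plus" ?l "[]"] s B q
    by simp
  let ?b = "replicate q (1::nat)"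
  let ?Z = "Zip (replicate q 1) []" and ?Z' = "Zip [] (replicate q 1)"
  have 8: "exec s (home 0) (?i7, built ?n7 ?lc q, []) (?i7, built (Zip [] (syms ?B)) ?lc q, [])"
  proof -
    have "3 \<notin> set (take w (syms ?B))" "3 \<notin> set (drop w (syms ?B))"
      using set_syms(2) by (metis in_set_takeD, metis in_set_dropD)
    then show ?thesis
      using exec_home[of 0 "built ?n7 ?lc q" "rev (take w (syms ?B))" "drop w (syms ?B)" s ?i7 "[]"] s B
      by (simp add: fits_def)
  qed
  have 9: "exec s (home 2) (?i7, built (Zip [] (syms ?B)) ?lc q, [])
      (?i7, [Zip [] (syms ?B), ?lc, ?Z', ?Z, ?Z, Flag 1, Flag 1, Flag 1], [])"
    using exec_home[of 2 "built (Zip [] (syms ?B)) ?lc q" ?b "[]" s ?i7 "[]"] s B by (simp add: fits_def)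
  have 10: "exec s (home 3) (?i7, [Zip [] (syms ?B), ?lc, ?Z', ?Z, ?Z, Flag 1, Flag 1, Flag 1], [])
      (?i7, [Zip [] (syms ?B), ?lc, ?Z', ?Z', ?Z, Flag 1, Flag 1, Flag 1], [])"
    using exec_home[of 3 "[Zip [] (syms ?B), ?lc, ?Z', ?Z, ?Z, Flag 1, Flag 1, Flag 1]" ?b "[]" s ?i7 "[]"] s B
    by (simp add: fits_def)
  let ?ts = "[Zip [] (syms ?B), ?lc, ?Z', ?Z', ?Z', Flag 1, Flag 1, Flag 1]"
  have 11: "exec s (home 4) (?i7, [Zip [] (syms ?B), ?lc, ?Z', ?Z', ?Z, Flag 1, Flag 1, Flag 1], []) (?i7, ?ts, [])"
    using exec_home[of 4 "[Zip [] (syms ?B), ?lc, ?Z', ?Z', ?Z, Flag 1, Flag 1, Flag 1]" ?b "[]" s ?i7 "[]"] s B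
    by (simp add: fits_def)
  have f: "fits s ?ts" using s B by (simp add: fits_def)
  let ?j8 = "replicate w Plus @ Separator # replicate n Plus"
  let ?j9 = "replicate l Plus @ Separator # ?j8"
  let ?j10 = "replicate k Plus @ Separator # ?j9"
  have 12: "exec s read (?i7, ?ts, []) (In (Separator # ?j8) ?l, ?ts, [])" by (rule exec_read[OF f])
  have 13: "exec s skip (In (Separator # ?j8) ?l, ?ts, []) (In ?j9 (Separator # ?k), ?ts, [])"
    by (rule exec_skip[OF f]) simp
  have 14: "exec s read (In ?j9 (Separator # ?k), ?ts, []) (In (Separator # ?j9) ?k, ?ts, [])" by (rule exec_read[OF f])
  have 15: "exec s skip (In (Separator # ?j9) ?k, ?ts, []) (In ?j10 (Separator # insyms z), ?ts, [])"
    by (rule exec_skip[OF f]) simp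
  have 16: "exec s read (In ?j10 (Separator # insyms z), ?ts, []) (In (Separator # ?j10) (insyms z), ?ts, [])"
    by (rule exec_read[OF f])
  have "exec s prepare (At_Left ?n, replicate 8 (Flag 0), []) (In (Separator # ?j10) (insyms z), ?ts, [])"
    unfolding prepare_def
    by (rule exec_Seq[OF 1 exec_Seq[OF 2 exec_Seq[OF 3 exec_Seq[OF 4 exec_Seq[OF 5 exec_Seq[OF 6 exec_Seq[OF 7
        exec_Seq[OF 8 exec_Seq[OF 9 exec_Seq[OF 10 exec_Seq[OF 11 exec_Seq[OF 12 exec_Seq[OF 13 exec_Seq[OF 14
        exec_Seq[OF 15 16]]]]]]]]]]]]]]])
  moreover have "ready q (Zip [] (syms ?B)) ?lc (replicate q 0) 0 ?ts"
    unfolding ready_def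
    by (rule exI[of _ "replicate q 0"], rule exI[of _ "replicate q 0"], rule exI[of _ 0], rule exI[of _ 0]) simp
  moreover have "extent ?lc < s" using s B by simp
  ultimately show ?thesis by blast
qed

section \<open>Correctness and space consumption of the whole machine\<close>

lemma map_encode_sign: "map encode_sign y = insyms (map unsign y)"
  by (simp add: encode_sign_def input_symbol_def unsign_def)

lemma exec_main:
  assumes "y \<in> cube (seed_length \<epsilon> n w l)"
    "Suc (block_size n w) < s" "Suc (levels n) < s" "Suc (floorlog 2 (levels n)) < s"
  shows "\<exists>i ts. exec s main (At_Left (encode_input (precision \<epsilon>) n w l y), replicate 8 (Flag 0), [])
    (i, ts, generator \<epsilon> n w l y)"
proof -
  let ?L = "levels n" and ?q = "block_size n w" and ?k = "num_copies \<epsilon> n w l" and ?z = "map unsign y"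
  have z: "?z \<in> words (?k * (Suc ?L * (4 * ?q)))"
    using assms(1) by (simp add: words_def cube_def seed_length_def)
  have q: "1 \<le> ?q" if "0 < ?L"
  proof -
    have "0 < floorlog 2 ?L" using that by (simp add: floorlog_def)
    then show ?thesis by (simp add: block_size_def unit_size_def)
  qed

  \<comment> \<open>If there are no levels then n = 0 and nothing is written; \<open>g\<close> then
    only has to satisfy the hypothesis of \<open>exec_main_loop\<close> for the empty
    counter.\<close>
  define g where "g v = (if ?L = 0 then output_bit ?q ?k ?z []
    else (\<Sum>c<?k. copy_output ?q ?L (chunks (Suc ?L * (4 * ?q)) ?k ?z ! c) ! (2 ^ ?L - 1 - v)))" for v
  have v: "output_bit ?q ?k ?z bs = g (nval bs)" if "length bs = ?L" for bs
    using that output_bit_eq[OF q that z] by (cases "?L = 0") (auto simp: g_def)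
  obtain li lc ts where 1: "exec s prepare (At_Left (encode_input (precision \<epsilon>) n w l y), replicate 8 (Flag 0), [])
      (In (Separator # li) (insyms ?z), ts, [])"
    and r: "ready ?q (Zip [] (syms (binary n))) lc (replicate ?q 0) 0 ts" and lc: "extent lc < s"
    using exec_prepare[of n w s l "precision \<epsilon>" ?z] assms(2-4)
    unfolding encode_input_def map_encode_sign by auto
  have "length (binary n) = ?L" by (simp add: length_binary levels_def)
  from exec_main_loop[OF z v q assms(2,3) lc r this, where ?z1.0 = "[]" and li = li and w = "[]"]
  obtain c fin ts' where 2: "exec s decrement (In (Separator # li) (insyms ?z), ts, []) c"
    and 3: "exec s output_loop c (fin, ts', map (\<lambda>j. sign (g j)) (rev [0..<n]))"
    by auto
  have "map (\<lambda>j. sign (g j)) (rev [0..<n]) = generator \<epsilon> n w l y"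
  proof (rule nth_equalityI)
    fix p assume "p < length (map (\<lambda>j. sign (g j)) (rev [0..<n]))"
    then have p: "p < n" by simp
    have L: "Suc n \<le> 2 ^ ?L" using le_power_floorlog[of n] by (simp add: levels_def)
    have L0: "?L \<noteq> 0" using p by (simp add: levels_def floorlog_def)
    \<comment> \<open>Output position p is written when the counter has the value n - 1 - p, which
      addresses bit p after the first 2^L - n bits.\<close>
    have e: "2 ^ ?L - 1 - (n - Suc p) = 2 ^ ?L - n + p" using p L by simp
    have lt: "2 ^ ?L + p - n < 2 ^ ?L" using p L by linarith
    have "rev [0..<n] ! p = n - Suc p" using p by (simp add: rev_nth)
    then show "map (\<lambda>j. sign (g j)) (rev [0..<n]) ! p = generator \<epsilon> n w l y ! p"
      using p L L0 by (simp add: generator_def gen_bits_def mask_def g_def lt e[symmetric] del: chunks.simps)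
  qed (simp add: length_generator)
  then show ?thesis unfolding main_def using exec_Seq[OF 1 exec_Seq[OF 2 3]] by metis
qed

theorem log_space_explicit_generator: "log_space_explicit seed_length generator"
  unfolding log_space_explicit_def
proof (intro exI[of _ "compile 8 4 main"] conjI exI[of _ "60::real"] allI impI ballI)
  show "is_machine (compile 8 4 main)" by (rule is_machine_compile[OF valid_main]) simp
next
  fix \<epsilon> :: real and n w l :: nat and y :: "int list"
  assume y: "y \<in> cube (seed_length \<epsilon> n w l)"
  define s where "s = block_size n w + levels n + floorlog 2 (levels n) + 2"
  obtain i ts where "exec s main (At_Left (encode_input (precision \<epsilon>) n w l y), replicate 8 (Flag 0), [])
      (i, ts, generator \<epsilon> n w l y)"
    using exec_main[OF y, of s] by (auto simp: s_def)
  then have "computes_in_space (compile 8 4 main) (encode_input (precision \<epsilon>) n w l y) (generator \<epsilon> n w l y) s"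
    by (rule exec_computes)
  moreover have "real s \<le> 60 * lg (real n)"
  proof -
    \<comment> \<open>Hence a block has at most 8 * 2 * \<open>levels n\<close> cells, and the two
      counters add at most 2 * \<open>levels n\<close>.\<close>
    have "floorlog 2 (levels n) \<le> levels n" by (rule floorlog_leI) auto
    then have "s \<le> 18 * levels n + 2" by (simp add: s_def block_size_def unit_size_def)
    then have "real s \<le> 18 * real (levels n) + 2" by linarith
    then show ?thesis using floorlog_le[of n] lg_ge_1[of "real n"] by (simp add: levels_def)
  qed
  ultimately show "\<exists>s. real s \<le> 60 * lg (real n) \<and>
      computes_in_space (compile 8 4 main) (encode_input (precision \<epsilon>) n w l y) (generator \<epsilon> n w l y) s"
    by blast
qed

theorem theorem7p9:
  shows "\<exists>(r :: real \<Rightarrow> nat \<Rightarrow> nat \<Rightarrow> nat \<Rightarrow> nat)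
          (G :: real \<Rightarrow> nat \<Rightarrow> nat \<Rightarrow> nat \<Rightarrow> int list \<Rightarrow> int list).
     log_space_explicit r G \<and>
     (\<forall>\<epsilon>>0. \<forall>n w l.
        G \<epsilon> n w l \<in> cube (r \<epsilon> n w l) \<rightarrow> cube n \<and>
        fools \<epsilon> (r \<epsilon> n w l) n (G \<epsilon> n w l) (robp_class w n l)) \<and>
     (\<exists>C::real. \<forall>\<epsilon>>0. \<forall>n w l.
        real (r \<epsilon> n w l)
          \<le> C * (lg (lg (real n)) + lg (1 / \<epsilon>) + lg (real l) + real w) * lg (real n))"
  using log_space_explicit_generator generator_in_cube generator_fools seed_length_bound
  by (intro exI[of _ seed_length] exI[of _ generator] exI[of _ 384] conjI) auto

end
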